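(* Consider the periodic-review inventory control problem described in the context, with its Markov decision process $(\mathbb{X},\mathbb{A},c,q)$, and let $\{\alpha_n\}_{n=1,2,\ldots}$ be any sequence of nonnegative discount factors with $\alpha_n\uparrow1$ and $\alpha_1>\alpha^*$. (a) The process satisfies Assumptions (W* ) and (B), the sequence $\{u_{\alpha_n}\}_{n=1,2,\ldots}$ is equicontinuous on $\mathbb{X}$, and there exists a nonnegative measurable function $U$ on $\mathbb{X}$ such that $U(x)\ge u_{\alpha_n}(x)$ for all $x\in\mathbb{X}$, $n=1,2,\ldots$, and $\int_{\mathbb{X}}U(y)\,q(dy|x,a)<+\infty$ for all $x\in\mathbb{X}$, $a\in\mathbb{A}$. (b) Consequently, there exists a subsequence $\{\alpha_{n_k}\}_{k=1,2,\ldots}$ of $\{\alpha_n\}$ such that $u_{\alpha_{n_k}}(x)\to\tilde u(x)$ for all $x\in\mathbb{X}$, where $\tilde u$ is the average-cost relative value function defined for the sequence $\{\alpha_{n_k}\}$, the function $\tilde u$ is continuous, and there exists a stationary policy $\varphi$ such that for all $x\in\mathbb{X}$ $$w+\tilde u(x)=K I_{\{\varphi(x)>0\}}+H(x+\varphi(x))-\bar c x=\min\Big\{\min_{a\ge0}[K+H(x+a)],\,H(x)\Big\}-\bar c x,\qquad(\ast)$$ where $$H(x):=\bar c x+\mathbb{E}[h(x-D)]+\mathbb{E}[\tilde u(x-D)],\qquad x\in\mathbb{X};$$ moreover, every stationary policy satisfying $(\ast)$ is average-cost optimal. (c) In addition, the functions $\tilde u$ and $H$ are $K$-convex, continuous and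 inf-compact. (d) A stationary optimal policy $\varphi$ satisfying $(\ast)$ can be selected as an $(s^*,S^* )$ policy of the following kind: for each nonnegative $\alpha\in(\alpha^*,1)$ let an $(s'_\alpha,S'_\alpha)$ policy be optimal for the discount factor $\alpha$, and let $(s^*,S^* )$ be any limit point of the (bounded) sequence $\{(s'_{\alpha_n},S'_{\alpha_n})\}_{n=1,2,\ldots}$, the subsequence $\{\alpha_{n_k}\}$ in (b), used to define $\tilde u$ and $H$, being chosen so that also $(s^*,S^* )=\lim_{k\to\infty}(s'_{\alpha_{n_k}},S'_{\alpha_{n_k}})$. (e) A stationary optimal policy $\varphi$ satisfying $(\ast)$ can also be selected as an $(s,S)$ policy with $S\in\arg\min_{x\in\mathbb{X}}H(x)$ and $s=\inf\{x\le S:\ H(x)\le K+H(S)\}$.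
   Context: Inventory model. Either (i) $\mathbb{X}=\mathbb{R}$, $\mathbb{A}=[0,+\infty)$, or (ii) $\mathbb{X}=\mathbb{Z}$, $\mathbb{A}=\{0,1,2,\ldots\}$; all points, intervals, infima and actions $a\ge0$ are understood within $\mathbb{X}$, resp. $\mathbb{A}$. Parameters: fixed ordering cost $K\ge0$; per unit ordering cost $\bar c>0$; holding/backordering cost $h:\mathbb{X}\to\mathbb{R}$, convex, with $h(x)\to\infty$ as $|x|\to\infty$, normalized so that $h\ge0$ and $h(0)=0$; i.i.d. nonnegative finite demands $D_1,D_2,\ldots$ (integer-valued in case (ii)), with $D$ distributed as $D_1$, $\mathbb{E}[h(x-D)]<\infty$ for all $x\in\mathbb{X}$, and $\mathbb{P}(D>0)>0$. Dynamics: $x_{t+1}=x_t+a_t-D_{t+1}$, so $q(B|x,a)=\mathbb{P}(x+a-D\in B)$. One-step cost: $c(x,a)=K I_{\{a>0\}}+\bar c a+\mathbb{E}[h(x+a-D)]$, where $I$ denotes an indicator. $\alpha^*:=1+\lim_{x\to-\infty}\frac{h(x)}{\bar c x}$; the limit exists (possibly $-\infty$) and $\alpha^*<1$. Policies and costs. A policy $\pi=(\pi_0,\pi_1,\ldots)$ is a sequence of regular transition probabilities $\pi_t$ from histories $(\mathbb{X}\times\mathbb{A})^t\times\mathbb{X}$ to $\mathbb{A}$; $\Pi$ is the set of all policies. A stationary policy is a measurable map $\varphi:\mathbb{X}\to\mathbb{A}$ giving the action in the current state. $\mathbb{E}_x^\pi$ is the expectation for initial state $x$ and policy $\pi$. For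 $\alpha\in[0,1)$: $v_\alpha^\pi(x)=\mathbb{E}_x^\pi\sum_{t=0}^\infty\alpha^tc(x_t,a_t)$, $v_\alpha(x)=\inf_{\pi\in\Pi}v_\alpha^\pi(x)$, $m_\alpha=\inf_{x\in\mathbb{X}}v_\alpha(x)$, $u_\alpha(x)=v_\alpha(x)-m_\alpha$. A policy $\pi$ is optimal for the discount factor $\alpha$ if $v_\alpha^\pi=v_\alpha$ on $\mathbb{X}$. Average cost: $w^\pi(x)=\limsup_{N\to\infty}\frac1N\mathbb{E}_x^\pi\sum_{t=0}^{N-1}c(x_t,a_t)$, $w(x)=\inf_{\pi\in\Pi}w^\pi(x)$; $\pi$ is average-cost optimal if $w^\pi(x)=w(x)$ for all $x\in\mathbb{X}$. The constant $w$ is $w:=\liminf_{\alpha\uparrow1}(1-\alpha)m_\alpha$ (under (W* ) and (B) it is known that $w=\lim_{\alpha\uparrow1}(1-\alpha)m_\alpha$ and $w(x)=w$ for all $x$). A function $f:\mathcal{U}\to\mathbb{R}\cup\{+\infty\}$ on a metric space is inf-compact if $\{u\in \mathcal{U}:f(u)\le\lambda\}$ is compact for every $\lambda\in\mathbb{R}$; $f:\mathbb{X}\times\mathbb{A}\to\mathbb{R}\cup\{+\infty\}$ is $\mathbb{K}$-inf-compact if its restriction to $C\times\mathbb{A}$ is inf-compact for every nonempty compact $C\subseteq\mathbb{X}$. Assumption (W* ): (i) $c$ is $\mathbb{K}$-inf-compact and bounded below; (ii) for every bounded continuous $f:\mathbb{X}\to\mathbb{R}$ the function $(x,a)\mapsto\int_{\mathbb{X}}f(y)q(dy|x,a)$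 is continuous on $\mathbb{X}\times\mathbb{A}$. Assumption (B): (i) $\inf_{x\in\mathbb{X}}w(x)<+\infty$; (ii) $\sup_{\alpha\in[0,1)}u_\alpha(x)<\infty$ for every $x\in\mathbb{X}$. For a sequence of nonnegative discount factors $\beta_n\uparrow1$, the average-cost relative value function defined for this sequence is $\tilde u(x)=\liminf_{n\to\infty,\,y\to x}u_{\beta_n}(y)$, i.e. the largest number such that $\tilde u(x)\le\liminf_{n\to\infty}u_{\beta_n}(y_n)$ for all sequences $y_n\to x$. A family $\mathcal{H}$ of real-valued functions on $\mathbb{X}$ is equicontinuous if for each $x\in\mathbb{X}$ and $\epsilon>0$ there is an open set $G\ni x$ with $|g(y)-g(x)|<\epsilon$ for all $y\in G$ and all $g\in\mathcal{H}$. $f:\mathbb{X}\to\mathbb{R}$ is $K$-convex if $f((1-\lambda)x+\lambda y)\le(1-\lambda)f(x)+\lambda f(y)+\lambda K$ for all $x\le y$ in $\mathbb{X}$ and $\lambda\in(0,1)$ with $(1-\lambda)x+\lambda y\in\mathbb{X}$. For $s\le S$ in $\mathbb{X}$, the $(s,S)$ policy is the stationary policy that orders up to the level $S$ (action $S-x$) if $x<s$ and does not order (action $0$) if $x\ge s$. *)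

theory Defs
  imports "HOL-Probability.Probability"
begin

section \<open>Analytic notions relative to a subset of a space\<close>

text \<open>
  The inventory model has state space either the reals or the integers. Both are treated as
  subsets \<open>X\<close> of the reals with the subspace topology and the trace of the Borel
  sigma-algebra, so every notion below is relative to a carrier set. Functions on \<open>X\<close> are
  represented by functions on the whole type, whose values off \<open>X\<close> are irrelevant.
\<close>

definition K_convex_on :: "real set \<Rightarrow> real \<Rightarrow> (real \<Rightarrow> real) \<Rightarrow> bool" where
  "K_convex_on X K f \<longleftrightarrow>
     (\<forall>x\<in>X. \<forall>y\<in>X. \<forall>l. x \<le> y \<and> 0 < l \<and> l < 1 \<and> (1 - l) * x + l * y \<in> X \<longrightarrow>
        f ((1 - l) * x + l * y) \<le> (1 - l) * f x + l * f y + l * K)"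

definition inf_compact_on :: "'a::topological_space set \<Rightarrow> ('a \<Rightarrow> real) \<Rightarrow> bool" where
  "inf_compact_on U f \<longleftrightarrow> (\<forall>l. compact {u \<in> U. f u \<le> l})"

definition KK_inf_compact_on ::
  "'s::topological_space set \<Rightarrow> 'a::topological_space set \<Rightarrow> ('s \<Rightarrow> 'a \<Rightarrow> real) \<Rightarrow> bool" where
  "KK_inf_compact_on X A f \<longleftrightarrow>
     (\<forall>C. C \<noteq> {} \<and> C \<subseteq> X \<and> compact C \<longrightarrow> inf_compact_on (C \<times> A) (\<lambda>(x, a). f x a))"

definition equicontinuous_on :: "'s::topological_space set \<Rightarrow> ('s \<Rightarrow> real) set \<Rightarrow> bool" where
  "equicontinuous_on X F \<longleftrightarrow>
     (\<forall>x\<in>X. \<forall>e>0. \<exists>G. open G \<and> x \<in> G \<and> (\<forall>y \<in> G \<inter> X. \<forall>g\<in>F. \<bar>g y - g x\<bar> < e))"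


section \<open>Markov decision processes\<close>

text \<open>
  All actions are available in every state. Costs are meant to be nonnegative: expected total
  costs are Lebesgue integrals with values in \<^typ>\<open>ennreal\<close>.
\<close>

record ('s, 'a) mdp =
  states  :: "'s set"
  actions :: "'a set"
  cost    :: "'s \<Rightarrow> 'a \<Rightarrow> real"
  kern    :: "'s \<Rightarrow> 'a \<Rightarrow> 's measure"

definition state_space :: "('s::topological_space, 'a::topological_space) mdp \<Rightarrow> 's measure" where
  "state_space M = restrict_space borel (states M)"

definition action_space :: "('s::topological_space, 'a::topological_space) mdp \<Rightarrow> 'a measure" where
  "action_space M = restrict_space borel (actions M)"

definition sa_space :: "('s::topological_space, 'a::topological_space) mdp \<Rightarrow> ('s \<times> 'a) measure" where
  "sa_space M = state_space M \<Otimes>\<^sub>M action_space M"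

text \<open>
  A history at time \<open>t\<close> is a pair of the past state-action pairs, indexed by \<open>{0..<t}\<close>, and the
  current state.
\<close>

type_synonym ('s, 'a) policy = "nat \<Rightarrow> (nat \<Rightarrow> 's \<times> 'a) \<times> 's \<Rightarrow> 'a measure"

definition policies :: "('s::topological_space, 'a::topological_space) mdp \<Rightarrow> ('s, 'a) policy set" where
  "policies M =
     {p. \<forall>t. p t \<in> (PiM {0..<t} (\<lambda>_. sa_space M)) \<Otimes>\<^sub>M state_space M \<rightarrow>\<^sub>M prob_algebra (action_space M)}"

definition stationary_policies :: "('s::topological_space, 'a::topological_space) mdp \<Rightarrow> ('s \<Rightarrow> 'a) set" where
  "stationary_policies M = state_space M \<rightarrow>\<^sub>M action_space M"

definition stationary :: "('s::topological_space, 'a::topological_space) mdp \<Rightarrow> ('s \<Rightarrow> 'a) \<Rightarrow> ('s, 'a) policy" where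
  "stationary M \<phi> = (\<lambda>t (\<omega>, y). return (action_space M) (\<phi> y))"

text \<open>
  Conditional law of the pair of state and action at time \<open>t\<close>, given the earlier pairs \<open>\<omega>\<close>,
  for initial state \<open>x\<close>.
\<close>

definition next_state :: "('s::topological_space, 'a::topological_space) mdp \<Rightarrow> 's \<Rightarrow> nat \<Rightarrow> (nat \<Rightarrow> 's \<times> 'a) \<Rightarrow> 's measure" where
  "next_state M x t \<omega> =
     (case t of 0 \<Rightarrow> return (state_space M) x
      | Suc t' \<Rightarrow> kern M (fst (\<omega> t')) (snd (\<omega> t')))"

definition step_law ::
  "('s::topological_space, 'a::topological_space) mdp \<Rightarrow> ('s, 'a) policy \<Rightarrow> 's \<Rightarrow> nat \<Rightarrow> (nat \<Rightarrow> 's \<times> 'a) \<Rightarrow> ('s \<times> 'a) measure" where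
  "step_law M p x t \<omega> =
     next_state M x t \<omega> \<bind> (\<lambda>y. p t (\<omega>, y) \<bind> (\<lambda>a. return (sa_space M) (y, a)))"

text \<open>The Ionescu-Tulcea measure on trajectories; \<open>strategic_law_wf\<close> below shows that it applies.\<close>

definition strategic_law ::
  "('s::topological_space, 'a::topological_space) mdp \<Rightarrow> ('s, 'a) policy \<Rightarrow> 's \<Rightarrow> (nat \<Rightarrow> 's \<times> 'a) measure" where
  "strategic_law M p x =
     projective_family.lim UNIV (Ionescu_Tulcea.CI (step_law M p x) (\<lambda>_. sa_space M)) (\<lambda>_. sa_space M)"

definition disc_cost ::
  "('s::topological_space, 'a::topological_space) mdp \<Rightarrow> real \<Rightarrow> ('s, 'a) policy \<Rightarrow> 's \<Rightarrow> ennreal" where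
  "disc_cost M \<alpha> p x =
     (\<integral>\<^sup>+\<omega>. (\<Sum>t. ennreal (\<alpha> ^ t * cost M (fst (\<omega> t)) (snd (\<omega> t)))) \<partial>strategic_law M p x)"

definition disc_value :: "('s::topological_space, 'a::topological_space) mdp \<Rightarrow> real \<Rightarrow> 's \<Rightarrow> ennreal" where
  "disc_value M \<alpha> x = (INF p\<in>policies M. disc_cost M \<alpha> p x)"

definition disc_min :: "('s::topological_space, 'a::topological_space) mdp \<Rightarrow> real \<Rightarrow> ennreal" where
  "disc_min M \<alpha> = (INF x\<in>states M. disc_value M \<alpha> x)"

definition rel_disc_value :: "('s::topological_space, 'a::topological_space) mdp \<Rightarrow> real \<Rightarrow> 's \<Rightarrow> ennreal" where
  "rel_disc_value M \<alpha> x = disc_value M \<alpha> x - disc_min M \<alpha>"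

definition disc_optimal :: "('s::topological_space, 'a::topological_space) mdp \<Rightarrow> real \<Rightarrow> ('s, 'a) policy \<Rightarrow> bool" where
  "disc_optimal M \<alpha> p \<longleftrightarrow> p \<in> policies M \<and> (\<forall>x\<in>states M. disc_cost M \<alpha> p x = disc_value M \<alpha> x)"

definition avg_cost ::
  "('s::topological_space, 'a::topological_space) mdp \<Rightarrow> ('s, 'a) policy \<Rightarrow> 's \<Rightarrow> ennreal" where
  "avg_cost M p x =
     limsup (\<lambda>N. (\<integral>\<^sup>+\<omega>. (\<Sum>t<N. ennreal (cost M (fst (\<omega> t)) (snd (\<omega> t)))) \<partial>strategic_law M p x)
                  / of_nat N)"

definition avg_value :: "('s::topological_space, 'a::topological_space) mdp \<Rightarrow> 's \<Rightarrow> ennreal" where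
  "avg_value M x = (INF p\<in>policies M. avg_cost M p x)"

definition avg_optimal :: "('s::topological_space, 'a::topological_space) mdp \<Rightarrow> ('s, 'a) policy \<Rightarrow> bool" where
  "avg_optimal M p \<longleftrightarrow> p \<in> policies M \<and> (\<forall>x\<in>states M. avg_cost M p x = avg_value M x)"

definition avg_const :: "('s::topological_space, 'a::topological_space) mdp \<Rightarrow> ennreal" where
  "avg_const M = Liminf (at_left 1) (\<lambda>\<alpha>. ennreal (1 - \<alpha>) * disc_min M \<alpha>)"

definition assumption_W :: "('s::topological_space, 'a::topological_space) mdp \<Rightarrow> bool" where
  "assumption_W M \<longleftrightarrow>
     KK_inf_compact_on (states M) (actions M) (cost M) \<and>
     (\<exists>b. \<forall>x\<in>states M. \<forall>a\<in>actions M. b \<le> cost M x a) \<and>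
     (\<forall>f::'s \<Rightarrow> real. bounded (f ` states M) \<and> continuous_on (states M) f \<longrightarrow>
        continuous_on (states M \<times> actions M) (\<lambda>(x, a). \<integral>y. f y \<partial>kern M x a))"

definition assumption_B :: "('s::topological_space, 'a::topological_space) mdp \<Rightarrow> bool" where
  "assumption_B M \<longleftrightarrow>
     (INF x\<in>states M. avg_value M x) < \<infinity> \<and>
     (\<forall>x\<in>states M. (SUP \<alpha>\<in>{0..<1}. rel_disc_value M \<alpha> x) < \<infinity>)"

text \<open>
  The lower limit of \<open>rel_disc_value M (\<beta> n) y\<close> as \<open>n \<rightarrow> \<infinity>\<close> and \<open>y \<rightarrow> x\<close>: the largest number
  below \<open>liminf (\<lambda>n. rel_disc_value M (\<beta> n) (y n))\<close> for all sequences of states \<open>y \<longlonglongrightarrow> x\<close>.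
\<close>

definition avg_rel_value ::
  "('s::topological_space, 'a::topological_space) mdp \<Rightarrow> (nat \<Rightarrow> real) \<Rightarrow> 's \<Rightarrow> ennreal" where
  "avg_rel_value M \<beta> x =
     Inf {liminf (\<lambda>n. rel_disc_value M (\<beta> n) (y n)) | y. (\<forall>n. y n \<in> states M) \<and> y \<longlonglongrightarrow> x}"


section \<open>The inventory model\<close>

text \<open>
  \<open>K_convex_on X 0\<close> is convexity on \<open>X\<close>, also when \<open>X\<close> is the set of integers. The demands are
  \<open>D 1, D 2, \<dots>\<close>; the value \<open>D 0\<close> plays no role.
\<close>

locale inventory = prob_space P for P :: "'w measure" +
  fixes D :: "nat \<Rightarrow> 'w \<Rightarrow> real" and X :: "real set" and K cbar :: real and h :: "real \<Rightarrow> real"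
  assumes X_cases: "X = UNIV \<or> X = \<int>"
    and K_nonneg: "0 \<le> K"
    and cbar_pos: "0 < cbar"
    and h_convex: "K_convex_on X 0 h"
    and h_at_top: "filterlim h at_top (inf at_infinity (principal X))"
    and h_nonneg: "\<And>x. x \<in> X \<Longrightarrow> 0 \<le> h x"
    and h_zero: "h 0 = 0"
    and D_indep: "indep_vars (\<lambda>_. borel) D {1..}"
    and D_ident: "\<And>t. 1 \<le> t \<Longrightarrow> distr P borel (D t) = distr P borel (D 1)"
    and D_nonneg: "\<And>t \<omega>. 1 \<le> t \<Longrightarrow> \<omega> \<in> space P \<Longrightarrow> 0 \<le> D t \<omega>"
    and D_in_X: "\<And>t \<omega>. 1 \<le> t \<Longrightarrow> \<omega> \<in> space P \<Longrightarrow> D t \<omega> \<in> X"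
    and h_D_integrable: "\<And>x. x \<in> X \<Longrightarrow> integrable P (\<lambda>\<omega>. h (x - D 1 \<omega>))"
    and D_pos: "prob {\<omega> \<in> space P. 0 < D 1 \<omega>} > 0"

definition inventory_mdp ::
  "'w measure \<Rightarrow> ('w \<Rightarrow> real) \<Rightarrow> real set \<Rightarrow> real \<Rightarrow> real \<Rightarrow> (real \<Rightarrow> real) \<Rightarrow> (real, real) mdp" where
  "inventory_mdp P D X K cbar h =
     \<lparr> states = X, actions = X \<inter> {0..},
       cost = (\<lambda>x a. (if a > 0 then K else 0) + cbar * a + (\<integral>\<omega>. h (x + a - D \<omega>) \<partial>P)),
       kern = (\<lambda>x a. distr P (restrict_space borel X) (\<lambda>\<omega>. x + a - D \<omega>)) \<rparr>"

definition alpha_star :: "real set \<Rightarrow> real \<Rightarrow> (real \<Rightarrow> real) \<Rightarrow> ereal" where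
  "alpha_star X cbar h = 1 + Lim (inf at_bot (principal X)) (\<lambda>x. ereal (h x / (cbar * x)))"

definition inventory_H ::
  "'w measure \<Rightarrow> ('w \<Rightarrow> real) \<Rightarrow> real \<Rightarrow> (real \<Rightarrow> real) \<Rightarrow> (real \<Rightarrow> real) \<Rightarrow> real \<Rightarrow> real" where
  "inventory_H P D cbar h f x =
     cbar * x + (\<integral>\<omega>. h (x - D \<omega>) \<partial>P) + (\<integral>\<omega>. f (x - D \<omega>) \<partial>P)"

text \<open>
  The average-cost optimality equations for the constant \<open>w\<close>, the relative value function \<open>f\<close>
  and the action selection \<open>\<phi>\<close>. The action \<open>b\<close> attains the minimum of \<open>K + H (x + a)\<close> over
  the actions \<open>a\<close>.
\<close>

definition optimality_equations ::
  "real set \<Rightarrow> real \<Rightarrow> real \<Rightarrow> real \<Rightarrow> (real \<Rightarrow> real) \<Rightarrow> (real \<Rightarrow> real) \<Rightarrow> (real \<Rightarrow> real) \<Rightarrow> bool" where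
  "optimality_equations X K cbar w f H \<phi> \<longleftrightarrow>
     (\<forall>x\<in>X. w + f x = (if \<phi> x > 0 then K else 0) + H (x + \<phi> x) - cbar * x \<and>
        (\<exists>b \<in> X \<inter> {0..}. (\<forall>a \<in> X \<inter> {0..}. K + H (x + b) \<le> K + H (x + a)) \<and>
           w + f x = min (K + H (x + b)) (H x) - cbar * x))"

definition sS_policy :: "real \<Rightarrow> real \<Rightarrow> real \<Rightarrow> real" where
  "sS_policy s S x = (if x < s then S - x else 0)"

definition argmin_on :: "real set \<Rightarrow> (real \<Rightarrow> real) \<Rightarrow> real set" where
  "argmin_on X H = {y \<in> X. \<forall>x\<in>X. H y \<le> H x}"


section \<open>Well-definedness of the trajectory measure\<close>

lemma measurable_next_state:
  assumes "(\<lambda>(x, a). kern M x a) \<in> sa_space M \<rightarrow>\<^sub>M prob_algebra (state_space M)"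
    and "x \<in> states M"
  shows "next_state M x t \<in> PiM {0..<t} (\<lambda>_. sa_space M) \<rightarrow>\<^sub>M prob_algebra (state_space M)"
proof (cases t)
  case 0
  have "return (state_space M) x \<in> space (prob_algebra (state_space M))"
    using assms(2)
    by (auto simp: space_prob_algebra state_space_def space_restrict_space intro!: prob_space_return)
  then show ?thesis by (simp add: 0 next_state_def[abs_def])
next
  case (Suc t')
  have c: "(\<lambda>\<omega>. \<omega> t') \<in> PiM {0..<t} (\<lambda>_. sa_space M) \<rightarrow>\<^sub>M sa_space M"
    by (rule measurable_component_singleton) (simp add: Suc)
  show ?thesis
    using measurable_compose[OF c assms(1)]
    by (simp add: Suc next_state_def[abs_def] case_prod_beta)
qed

lemma measurable_step_law:
  assumes kern: "(\<lambda>(x, a). kern M x a) \<in> sa_space M \<rightarrow>\<^sub>M prob_algebra (state_space M)"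
    and p: "p \<in> policies M" and x: "x \<in> states M"
  shows "step_law M p x t \<in> PiM {0..<t} (\<lambda>_. sa_space M) \<rightarrow>\<^sub>M prob_algebra (sa_space M)"
proof -
  have p': "p t \<in> PiM {0..<t} (\<lambda>_. sa_space M) \<Otimes>\<^sub>M state_space M \<rightarrow>\<^sub>M prob_algebra (action_space M)"
    using p by (simp add: policies_def)
  have r: "(\<lambda>(z, a). return (sa_space M) (snd z, a)) \<in>
      (PiM {0..<t} (\<lambda>_. sa_space M) \<Otimes>\<^sub>M state_space M) \<Otimes>\<^sub>M action_space M \<rightarrow>\<^sub>M prob_algebra (sa_space M)"
    unfolding case_prod_beta
    by (rule measurable_compose[OF _ measurable_return_prob_space]) (simp add: sa_space_def)
  have q: "(\<lambda>(\<omega>, y). p t (\<omega>, y) \<bind> (\<lambda>a. return (sa_space M) (y, a))) \<in>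
      PiM {0..<t} (\<lambda>_. sa_space M) \<Otimes>\<^sub>M state_space M \<rightarrow>\<^sub>M prob_algebra (sa_space M)"
    unfolding case_prod_beta prod.collapse
    by (rule measurable_bind_prob_space2[OF p']) (rule r)
  show ?thesis
    unfolding step_law_def[abs_def]
    by (rule measurable_bind_prob_space2[OF measurable_next_state[OF kern x]]) (use q in simp)
qed

lemma strategic_law_wf:
  fixes M :: "('s::topological_space, 'a::topological_space) mdp"
  assumes "(\<lambda>(x, a). kern M x a) \<in> sa_space M \<rightarrow>\<^sub>M prob_algebra (state_space M)"
    and "p \<in> policies M" and "x \<in> states M"
  shows "Ionescu_Tulcea (step_law M p x) (\<lambda>_. sa_space M)"
proof (rule Ionescu_Tulcea.intro)
  fix t :: nat
  note m = measurable_step_law[OF assms, of t]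
  show "step_law M p x t \<in> PiM {0..<t} (\<lambda>_. sa_space M) \<rightarrow>\<^sub>M subprob_algebra (sa_space M)"
    using m by (rule measurable_prob_algebraD)
  fix \<omega> :: "nat \<Rightarrow> 's \<times> 'a"
  assume "\<omega> \<in> space (PiM {0..<t} (\<lambda>_. sa_space M))"
  from measurable_space[OF m this]
  show "prob_space (step_law M p x t \<omega>)" by (simp add: space_prob_algebra)
qed

lemma (in inventory) kern_measurable:
  defines "M \<equiv> inventory_mdp P (D 1) X K cbar h"
  shows "(\<lambda>(x, a). kern M x a) \<in> sa_space M \<rightarrow>\<^sub>M prob_algebra (state_space M)"
proof -
  have sp: "state_space M = restrict_space borel X" "action_space M = restrict_space borel (X \<inter> {0..})"
    by (simp_all add: M_def inventory_mdp_def state_space_def action_space_def)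
  have D1[measurable]: "D 1 \<in> borel_measurable P"
    using indep_vars_def2[of "\<lambda>_. borel" D "{1..}"] D_indep by auto
  have diff: "x + a - D 1 \<omega> \<in> X" if "x \<in> X" "a \<in> X" "\<omega> \<in> space P" for x a \<omega>
    using that D_in_X[of 1 \<omega>] X_cases by auto
  have [measurable]: "(\<lambda>x. x) \<in> borel_measurable (restrict_space borel Y)" for Y :: "real set"
    by (rule measurable_restrict_space1) simp
  have m: "(\<lambda>(z, \<omega>). fst z + snd z - D 1 \<omega>) \<in> sa_space M \<Otimes>\<^sub>M P \<rightarrow>\<^sub>M state_space M"
    unfolding sa_space_def sp
  proof (rule measurable_restrict_space2)
    show "(\<lambda>(z, \<omega>). fst z + snd z - D 1 \<omega>) \<in>
        space ((restrict_space borel X \<Otimes>\<^sub>M restrict_space borel (X \<inter> {0..})) \<Otimes>\<^sub>M P) \<rightarrow> X"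
      by (auto simp: space_pair_measure space_restrict_space simp del: One_nat_def intro: diff)
    have "(\<lambda>z. fst z) \<in> borel_measurable (restrict_space borel X \<Otimes>\<^sub>M restrict_space borel (X \<inter> {0..}))"
      "(\<lambda>z. snd z) \<in> borel_measurable (restrict_space borel X \<Otimes>\<^sub>M restrict_space borel (X \<inter> {0..}))"
      by (rule measurable_compose[OF measurable_fst], simp,
          rule measurable_compose[OF measurable_snd], simp)
    then show "(\<lambda>(z, \<omega>). fst z + snd z - D 1 \<omega>) \<in>
        borel_measurable ((restrict_space borel X \<Otimes>\<^sub>M restrict_space borel (X \<inter> {0..})) \<Otimes>\<^sub>M P)"
      by measurable
  qed
  have "(\<lambda>z. distr P (state_space M) (\<lambda>\<omega>. fst z + snd z - D 1 \<omega>)) \<in> sa_space M \<rightarrow>\<^sub>M prob_algebra (state_space M)"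
  proof (rule measurable_prob_algebraI)
    show "prob_space (distr P (state_space M) (\<lambda>\<omega>. fst z + snd z - D 1 \<omega>))"
      if "z \<in> space (sa_space M)" for z
      using measurable_Pair2[OF m that] by (auto intro: prob_space_distr)
    show "(\<lambda>z. distr P (state_space M) (\<lambda>\<omega>. fst z + snd z - D 1 \<omega>)) \<in> sa_space M \<rightarrow>\<^sub>M subprob_algebra (state_space M)"
      using measurable_distr2[OF m, of "\<lambda>_. P"]
      by (simp add: space_subprob_algebra subprob_space_axioms)
  qed
  then show ?thesis
    by (simp add: M_def inventory_mdp_def case_prod_beta state_space_def)
qed

end

theory Submission
  imports Defs "HOL-Complex_Analysis.Great_Picard"
begin

text \<open>
  Everything rests on one class of functions, called \<open>regular\<close> below, whose constants do not depend
  on the discount factor \<open>\<alpha> \<in> [a0, 1]\<close>, where \<open>a0\<close> exceeds \<open>\<alpha>*\<close>. A regular function is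
  nonnegative and \<open>K\<close>-convex, it loses at most \<open>K + cbar (y - x)\<close> when the state is raised from \<open>x\<close>
  to \<open>y\<close>, it falls with slope at least \<open>cbar\<close> far on the left, and it is locally Lipschitz with an
  explicit constant. The optimality operator maps this class into itself
  (\<open>regular_bellman\<close>). The reasons are as follows.

  \<^item> The condition \<open>\<alpha> > \<alpha>*\<close> says that on the left the holding cost has a slope steeper than
    \<open>(1 - \<alpha>) cbar\<close> (\<open>steep_state\<close>). So waiting one period with an overdue order is more expensive
    than what is saved by discounting, and the level cost \<open>Gf \<alpha> f\<close> falls with a definite slope there.
    On the right it is coercive because raising the state gains at most \<open>K + cbar (y - x)\<close>. Together
    with \<open>K\<close>-convexity this gives Scarf's argument (\<open>sS_optimal_Inf\<close>): an \<open>(s, S)\<close> rule solves the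
    one-period problem, and \<open>s\<close> and \<open>S\<close> range over a compact set common to all \<open>\<alpha>\<close>.
  \<^item> \<open>K\<close>-convexity is preserved by the minimization over orders (\<open>K_convex_on_order_value\<close>).
  \<^item> Two copies of the system that start at distance \<open>\<delta>\<close> keep this distance until an order merges
    them. While no order is placed the state falls, and as it may not fall below \<open>s\<close> the expected
    waiting time is bounded. The exponential function \<open>lyap\<close>, which decreases in expectation along
    the demand, turns this coupling into an inductive inequality, which is the Lipschitz bound.

  Value iteration is started inside the class, at a function \<open>f0\<close> below all discounted costs; it
  increases to a regular fixed point \<open>v \<alpha>\<close>, which is then the discounted value
  (\<open>disc_value_eq\<close>): along a policy of finite cost the contribution of \<open>f0\<close> vanishes in the
  long run, as \<open>f0\<close> is dominated by a multiple of \<open>h\<close>.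

  The minimum of \<open>v \<alpha>\<close> is approached on a bounded set of states, so the Lipschitz bound makes the
  relative values \<open>u \<alpha> = v \<alpha> - m \<alpha>\<close> pointwise bounded and equicontinuous. A diagonal sequence
  converges, and the optimality equation passes to the limit (\<open>bellman_limit\<close>), because minimizers
  stay in a compact set and level costs converge continuously. The constant in the limit equation is
  a limit of \<open>(1 - \<alpha>) m \<alpha>\<close> along the sequence. It is the same for all sequences: iterating the
  equation shows that the \<open>(s, S)\<close> policy has at most this average cost, and Abel summation shows that
  no policy has an average cost below any other limit of \<open>(1 - \<alpha>) m \<alpha>\<close> (\<open>limit_unique\<close>).
  The limit function is again regular, so Scarf's argument applies to it as well; and levels that are
  optimal along the sequence converge to optimal levels (\<open>sS_optimal_limit\<close>).
\<close>


section \<open>Expected stage costs under the trajectory measure\<close>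

text \<open>
  A policy enters the expected costs only through the laws of the single stages
  \<open>\<omega> t\<close>. For these the trajectory measure reduces to two rules: the next state is
  drawn from the kernel (\<open>expect_state_Suc\<close>), and a stationary policy turns every action
  into a function of the state (\<open>expect_stationary\<close>).
\<close>

locale mdp_run =
  fixes M :: "('s::topological_space, 'a::topological_space) mdp" and p :: "('s, 'a) policy" and x :: 's
  assumes kern: "(\<lambda>(x, a). kern M x a) \<in> sa_space M \<rightarrow>\<^sub>M prob_algebra (state_space M)"
    and policy: "p \<in> policies M" and start: "x \<in> states M"
begin

sublocale IT: Ionescu_Tulcea "step_law M p x" "\<lambda>_. sa_space M"
  using kern policy start by (rule strategic_law_wf)

lemma strategic_law_eq: "strategic_law M p x = IT.PF.lim"
  by (simp add: strategic_law_def)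

lemma sets_strategic_law [measurable_cong]:
  "sets (strategic_law M p x) = sets (PiM UNIV (\<lambda>_. sa_space M))"
  by (simp add: strategic_law_eq)

definition expect :: "nat \<Rightarrow> ('s \<times> 'a \<Rightarrow> ennreal) \<Rightarrow> ennreal" where
  "expect t f = (\<integral>\<^sup>+\<omega>. f (\<omega> t) \<partial>strategic_law M p x)"

lemma nn_integral_strategic_law_restrict:
  assumes [measurable]: "f \<in> borel_measurable (PiM {0..<n} (\<lambda>_. sa_space M))"
  shows "(\<integral>\<^sup>+\<omega>. f (restrict \<omega> {0..<n}) \<partial>strategic_law M p x) = (\<integral>\<^sup>+\<omega>. f \<omega> \<partial>IT.C 0 n (\<lambda>_. undefined))"
proof -
  have u: "(\<lambda>_. undefined) \<in> space (PiM {0..<0::nat} (\<lambda>_. sa_space M))"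
    by (simp add: space_PiM)
  have up: "IT.up_to {0..<n} = n"
  proof (rule antisym)
    show "IT.up_to {0..<n} \<le> n"
      by (simp add: IT.up_to_iff)
    show "n \<le> IT.up_to {0..<n}"
      using IT.up_to_less[of "{0..<n}" "n - 1"] by (cases n) auto
  qed
  have "IT.C 0 n (\<lambda>_. undefined) = IT.CI {0..<n}"
    unfolding IT.CI_def up using IT.distr_C[of n n, OF le_refl u] by simp
  also have "\<dots> = distr (strategic_law M p x) (PiM {0..<n} (\<lambda>_. sa_space M)) (\<lambda>\<omega>. restrict \<omega> {0..<n})"
    by (simp add: IT.distr_lim strategic_law_eq)
  finally show ?thesis
    by (simp add: nn_integral_distr sets_strategic_law measurable_cong_sets[OF sets_strategic_law refl])
qed

text \<open>
  The coordinate \<open>t\<close> is integrated out first: up to time \<open>t + 1\<close> the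
  measure is the law up to time \<open>t\<close>, extended by the conditional law of the next pair.
\<close>

lemma expect_step_law:
  assumes f [measurable]: "f \<in> borel_measurable (sa_space M)"
  shows "expect t f = (\<integral>\<^sup>+\<omega>. (\<integral>\<^sup>+z. f z \<partial>step_law M p x t (restrict \<omega> {0..<t})) \<partial>strategic_law M p x)"
proof -
  have u: "(\<lambda>_. undefined) \<in> space (PiM {0..<0::nat} (\<lambda>_. sa_space M))"
    by (simp add: space_PiM)
  note [measurable] = IT.P
  have "expect t f = (\<integral>\<^sup>+\<omega>. f (restrict \<omega> {0..<Suc t} t) \<partial>strategic_law M p x)"
    by (simp add: expect_def)
  also have "\<dots> = (\<integral>\<^sup>+\<omega>. f (\<omega> t) \<partial>IT.C 0 (Suc t) (\<lambda>_. undefined))"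
    by (rule nn_integral_strategic_law_restrict) measurable
  also have "\<dots> = (\<integral>\<^sup>+\<omega>'. (\<integral>\<^sup>+\<omega>. f (\<omega> t) \<partial>IT.eP t \<omega>') \<partial>IT.C 0 t (\<lambda>_. undefined))"
    using IT.measurable_eP[of t] IT.sets_C[OF u, of t]
    by (simp, subst nn_integral_bind[where B="PiM {0..<Suc t} (\<lambda>_. sa_space M)"])
       (auto simp: measurable_cong_sets[OF IT.sets_C[OF u, of t] refl])
  also have "\<dots> = (\<integral>\<^sup>+\<omega>'. (\<integral>\<^sup>+z. f z \<partial>step_law M p x t \<omega>') \<partial>IT.C 0 t (\<lambda>_. undefined))"
    by (intro nn_integral_cong) (simp add: IT.space_C[OF u] IT.nn_integral_eP)
  also have "\<dots> = (\<integral>\<^sup>+\<omega>. (\<integral>\<^sup>+z. f z \<partial>step_law M p x t (restrict \<omega> {0..<t})) \<partial>strategic_law M p x)"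
    by (rule nn_integral_strategic_law_restrict[symmetric]) measurable
  finally show ?thesis .
qed

lemma space_restrict_history:
  "\<omega> \<in> space (strategic_law M p x) \<Longrightarrow> restrict \<omega> {0..<t} \<in> space (PiM {0..<t} (\<lambda>_. sa_space M))"
  by (auto simp: strategic_law_eq space_PiM)

lemma nn_integral_step_law:
  assumes f [measurable]: "f \<in> borel_measurable (sa_space M)"
    and \<omega>: "\<omega> \<in> space (PiM {0..<t} (\<lambda>_. sa_space M))"
  shows "(\<integral>\<^sup>+z. f z \<partial>step_law M p x t \<omega>) = (\<integral>\<^sup>+y. (\<integral>\<^sup>+a. f (y, a) \<partial>p t (\<omega>, y)) \<partial>next_state M x t \<omega>)"
proof -
  have p [measurable]: "p t \<in> PiM {0..<t} (\<lambda>_. sa_space M) \<Otimes>\<^sub>M state_space M \<rightarrow>\<^sub>M prob_algebra (action_space M)"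
    using policy by (simp add: policies_def)
  have py: "(\<lambda>y. p t (\<omega>, y)) \<in> state_space M \<rightarrow>\<^sub>M prob_algebra (action_space M)"
    using measurable_compose[OF measurable_Pair1'[OF \<omega>] p] .
  have N: "next_state M x t \<omega> \<in> space (prob_algebra (state_space M))"
    using measurable_space[OF measurable_next_state[OF kern start] \<omega>] .
  then have sN: "sets (next_state M x t \<omega>) = sets (state_space M)"
    by (simp add: space_prob_algebra)
  have r: "(\<lambda>(y, a). return (sa_space M) (y, a)) \<in> state_space M \<Otimes>\<^sub>M action_space M \<rightarrow>\<^sub>M prob_algebra (sa_space M)"
    by (simp add: sa_space_def)
  have q: "(\<lambda>y. p t (\<omega>, y) \<bind> (\<lambda>a. return (sa_space M) (y, a))) \<in> state_space M \<rightarrow>\<^sub>M prob_algebra (sa_space M)"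
    by (rule measurable_bind_prob_space2[OF py]) (use r in simp)
  have "(\<integral>\<^sup>+z. f z \<partial>step_law M p x t \<omega>) =
      (\<integral>\<^sup>+y. (\<integral>\<^sup>+z. f z \<partial>(p t (\<omega>, y) \<bind> (\<lambda>a. return (sa_space M) (y, a)))) \<partial>next_state M x t \<omega>)"
    unfolding step_law_def
    by (rule nn_integral_bind[OF f]) (use measurable_prob_algebraD[OF q] in \<open>simp add: measurable_cong_sets[OF sN refl]\<close>)
  also have "\<dots> = (\<integral>\<^sup>+y. (\<integral>\<^sup>+a. f (y, a) \<partial>p t (\<omega>, y)) \<partial>next_state M x t \<omega>)"
  proof (rule nn_integral_cong)
    fix y assume "y \<in> space (next_state M x t \<omega>)"
    then have y: "y \<in> space (state_space M)"
      using sets_eq_imp_space_eq[OF sN] by simp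
    have sp: "sets (p t (\<omega>, y)) = sets (action_space M)"
      using measurable_space[OF py y] by (simp add: space_prob_algebra)
    have ry: "(\<lambda>a. return (sa_space M) (y, a)) \<in> p t (\<omega>, y) \<rightarrow>\<^sub>M subprob_algebra (sa_space M)"
      using measurable_prob_algebraD[OF measurable_compose[OF measurable_Pair1'[OF y] r]]
      by (simp add: measurable_cong_sets[OF sp refl])
    have "(\<integral>\<^sup>+z. f z \<partial>(p t (\<omega>, y) \<bind> (\<lambda>a. return (sa_space M) (y, a))))
        = (\<integral>\<^sup>+a. (\<integral>\<^sup>+z. f z \<partial>return (sa_space M) (y, a)) \<partial>p t (\<omega>, y))"
      by (rule nn_integral_bind[OF f ry])
    also have "\<dots> = (\<integral>\<^sup>+a. f (y, a) \<partial>p t (\<omega>, y))"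
      using y sets_eq_imp_space_eq[OF sp]
      by (intro nn_integral_cong nn_integral_return f) (auto simp: sa_space_def space_pair_measure)
    finally show "(\<integral>\<^sup>+z. f z \<partial>(p t (\<omega>, y) \<bind> (\<lambda>a. return (sa_space M) (y, a)))) = (\<integral>\<^sup>+a. f (y, a) \<partial>p t (\<omega>, y))" .
  qed
  finally show ?thesis .
qed

lemma expect_policy:
  assumes f [measurable]: "f \<in> borel_measurable (sa_space M)"
  shows "expect t f = (\<integral>\<^sup>+\<omega>. (\<integral>\<^sup>+y. (\<integral>\<^sup>+a. f (y, a) \<partial>p t (restrict \<omega> {0..<t}, y))
      \<partial>next_state M x t (restrict \<omega> {0..<t})) \<partial>strategic_law M p x)"
  unfolding expect_step_law[OF f]
  by (intro nn_integral_cong nn_integral_step_law f space_restrict_history)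

lemma expect_state:
  assumes g [measurable]: "g \<in> borel_measurable (state_space M)"
  shows "expect t (\<lambda>z. g (fst z)) =
    (\<integral>\<^sup>+\<omega>. (\<integral>\<^sup>+y. g y \<partial>next_state M x t (restrict \<omega> {0..<t})) \<partial>strategic_law M p x)"
proof -
  have "expect t (\<lambda>z. g (fst z)) = (\<integral>\<^sup>+\<omega>. (\<integral>\<^sup>+y. (\<integral>\<^sup>+a. g y \<partial>p t (restrict \<omega> {0..<t}, y))
      \<partial>next_state M x t (restrict \<omega> {0..<t})) \<partial>strategic_law M p x)"
    by (subst expect_policy) (auto simp: sa_space_def)
  also have "\<dots> = (\<integral>\<^sup>+\<omega>. (\<integral>\<^sup>+y. g y \<partial>next_state M x t (restrict \<omega> {0..<t})) \<partial>strategic_law M p x)"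
  proof (intro nn_integral_cong)
    fix \<omega> y assume \<omega>: "\<omega> \<in> space (strategic_law M p x)"
      and y: "y \<in> space (next_state M x t (restrict \<omega> {0..<t}))"
    note \<omega>' = space_restrict_history[OF \<omega>, of t]
    have "y \<in> space (state_space M)"
      using y sets_eq_imp_space_eq measurable_space[OF measurable_next_state[OF kern start] \<omega>']
      by (auto simp: space_prob_algebra)
    moreover have "p t \<in> PiM {0..<t} (\<lambda>_. sa_space M) \<Otimes>\<^sub>M state_space M \<rightarrow>\<^sub>M prob_algebra (action_space M)"
      using policy by (simp add: policies_def)
    ultimately have "p t (restrict \<omega> {0..<t}, y) \<in> space (prob_algebra (action_space M))"
      using \<omega>' by (auto elim!: measurable_space simp: space_pair_measure)
    then have "prob_space (p t (restrict \<omega> {0..<t}, y))"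
      by (simp add: space_prob_algebra)
    then show "(\<integral>\<^sup>+a. g y \<partial>p t (restrict \<omega> {0..<t}, y)) = g y"
      by (simp add: prob_space.emeasure_space_1)
  qed
  finally show ?thesis .
qed

lemma prob_space_strategic_law: "prob_space (strategic_law M p x)"
proof (rule prob_space_distrD[of "\<lambda>\<omega>. restrict \<omega> {}" _ "PiM {} (\<lambda>_. sa_space M)"])
  show "(\<lambda>\<omega>. restrict \<omega> {}) \<in> strategic_law M p x \<rightarrow>\<^sub>M PiM {} (\<lambda>_. sa_space M)"
    by (intro measurable_restrict) auto
  show "prob_space (distr (strategic_law M p x) (PiM {} (\<lambda>_. sa_space M)) (\<lambda>\<omega>. restrict \<omega> {}))"
    unfolding strategic_law_eq by (subst IT.distr_lim) (auto intro: IT.PF.prob_space_P)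
qed

lemma expect_state_0:
  assumes g [measurable]: "g \<in> borel_measurable (state_space M)"
  shows "expect 0 (\<lambda>z. g (fst z)) = g x"
  using start prob_space.emeasure_space_1[OF prob_space_strategic_law]
  unfolding expect_state[OF g]
  using nn_integral_return[OF _ g, of x]
  by (simp add: next_state_def state_space_def space_restrict_space)

lemma expect_state_Suc:
  assumes g [measurable]: "g \<in> borel_measurable (state_space M)"
  shows "expect (Suc t) (\<lambda>z. g (fst z)) = expect t (\<lambda>z. \<integral>\<^sup>+y. g y \<partial>kern M (fst z) (snd z))"
  unfolding expect_state[OF g] by (simp add: next_state_def expect_def)

lemma measurable_kern_integral:
  assumes g [measurable]: "g \<in> borel_measurable (state_space M)"
  shows "(\<lambda>z. \<integral>\<^sup>+y. g y \<partial>kern M (fst z) (snd z)) \<in> borel_measurable (sa_space M)"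
proof -
  have "(\<lambda>z. kern M (fst z) (snd z)) \<in> sa_space M \<rightarrow>\<^sub>M subprob_algebra (state_space M)"
    using measurable_prob_algebraD[OF kern] by (simp add: case_prod_beta')
  then show ?thesis
    by (rule measurable_compose) (rule nn_integral_measurable_subprob_algebra[OF g])
qed

lemma expect_mono:
  assumes "\<And>y a. y \<in> states M \<Longrightarrow> a \<in> actions M \<Longrightarrow> f (y, a) \<le> g (y, a)"
  shows "expect t f \<le> expect t g"
  unfolding expect_def
proof (rule nn_integral_mono)
  fix \<omega> assume "\<omega> \<in> space (strategic_law M p x)"
  then have "\<omega> t \<in> space (sa_space M)"
    by (auto simp: strategic_law_eq space_PiM)
  then show "f (\<omega> t) \<le> g (\<omega> t)"
    using assms[of "fst (\<omega> t)" "snd (\<omega> t)"]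
    by (auto simp: sa_space_def space_pair_measure state_space_def action_space_def space_restrict_space)
qed

lemma measurable_at:
  assumes "f \<in> borel_measurable (sa_space M)"
  shows "(\<lambda>\<omega>. f (\<omega> t)) \<in> borel_measurable (strategic_law M p x)"
  using measurable_compose[OF measurable_component_singleton[of t UNIV "\<lambda>_. sa_space M"] assms]
  by (simp add: measurable_cong_sets[OF sets_strategic_law refl])

lemma expect_add:
  assumes "f \<in> borel_measurable (sa_space M)" "g \<in> borel_measurable (sa_space M)"
  shows "expect t (\<lambda>z. f z + g z) = expect t f + expect t g"
  unfolding expect_def using assms by (intro nn_integral_add measurable_at)

lemma expect_cmult:
  assumes "f \<in> borel_measurable (sa_space M)"
  shows "expect t (\<lambda>z. c * f z) = c * expect t f"
  unfolding expect_def using assms by (intro nn_integral_cmult measurable_at)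

lemma expect_const: "expect t (\<lambda>z. c) = c"
  using prob_space.emeasure_space_1[OF prob_space_strategic_law] by (simp add: expect_def)

definition stage_cost :: "nat \<Rightarrow> ennreal" where
  "stage_cost t = expect t (\<lambda>z. ennreal (cost M (fst z) (snd z)))"

lemma disc_cost_eq_suminf:
  assumes c: "(\<lambda>z. cost M (fst z) (snd z)) \<in> borel_measurable (sa_space M)" and "0 \<le> \<alpha>"
  shows "disc_cost M \<alpha> p x = (\<Sum>t. ennreal (\<alpha> ^ t) * stage_cost t)"
proof -
  have m: "(\<lambda>\<omega>. ennreal (cost M (fst (\<omega> t)) (snd (\<omega> t)))) \<in> borel_measurable (strategic_law M p x)" for t
    by (rule measurable_at[of "\<lambda>z. ennreal (cost M (fst z) (snd z))" t])
       (rule measurable_compose[OF c measurable_ennreal])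
  have "disc_cost M \<alpha> p x =
      (\<integral>\<^sup>+\<omega>. (\<Sum>t. ennreal (\<alpha> ^ t) * ennreal (cost M (fst (\<omega> t)) (snd (\<omega> t)))) \<partial>strategic_law M p x)"
    unfolding disc_cost_def using \<open>0 \<le> \<alpha>\<close> by (simp add: ennreal_mult')
  also have "\<dots> = (\<Sum>t. \<integral>\<^sup>+\<omega>. ennreal (\<alpha> ^ t) * ennreal (cost M (fst (\<omega> t)) (snd (\<omega> t))) \<partial>strategic_law M p x)"
    using m by (intro nn_integral_suminf borel_measurable_times_ennreal borel_measurable_const)
  also have "\<dots> = (\<Sum>t. ennreal (\<alpha> ^ t) * stage_cost t)"
    unfolding stage_cost_def expect_def using m by (intro suminf_cong nn_integral_cmult)
  finally show ?thesis .
qed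

lemma avg_cost_eq_limsup:
  assumes c: "(\<lambda>z. cost M (fst z) (snd z)) \<in> borel_measurable (sa_space M)"
  shows "avg_cost M p x = limsup (\<lambda>N. (\<Sum>t<N. stage_cost t) / of_nat N)"
proof -
  have m: "(\<lambda>\<omega>. ennreal (cost M (fst (\<omega> t)) (snd (\<omega> t)))) \<in> borel_measurable (strategic_law M p x)" for t
    by (rule measurable_at[of "\<lambda>z. ennreal (cost M (fst z) (snd z))" t])
       (rule measurable_compose[OF c measurable_ennreal])
  show ?thesis
    unfolding avg_cost_def stage_cost_def expect_def using m by (subst nn_integral_sum) auto
qed

end

lemma stationary_in_policies:
  assumes "\<phi> \<in> stationary_policies M"
  shows "stationary M \<phi> \<in> policies M"
  using assms unfolding policies_def stationary_def stationary_policies_def case_prod_beta'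
  by (auto intro!: measurable_compose[OF _ measurable_return_prob_space] measurable_compose[OF measurable_snd])

lemma (in mdp_run) expect_stationary:
  assumes p: "p = stationary M \<phi>" and \<phi> [measurable]: "\<phi> \<in> state_space M \<rightarrow>\<^sub>M action_space M"
    and f [measurable]: "f \<in> borel_measurable (sa_space M)"
  shows "expect t f = expect t (\<lambda>z. f (fst z, \<phi> (fst z)))"
proof -
  have m: "(\<lambda>y. f (y, \<phi> y)) \<in> borel_measurable (state_space M)"
    by (rule measurable_compose[OF _ f]) (simp add: sa_space_def)
  have "(\<integral>\<^sup>+a. f (y, a) \<partial>p t (restrict \<omega> {0..<t}, y)) = f (y, \<phi> y)"
    if \<omega>: "\<omega> \<in> space (strategic_law M p x)" and y: "y \<in> space (next_state M x t (restrict \<omega> {0..<t}))" for \<omega> y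
  proof -
    have y: "y \<in> space (state_space M)"
      using y sets_eq_imp_space_eq measurable_space[OF measurable_next_state[OF kern start] space_restrict_history[OF \<omega>, of t]]
      by (auto simp: space_prob_algebra)
    have "(\<lambda>a. f (y, a)) \<in> borel_measurable (action_space M)"
      using measurable_compose[OF measurable_Pair1'[OF y] f[unfolded sa_space_def]] .
    then show ?thesis
      using measurable_space[OF \<phi> y] by (simp add: p stationary_def nn_integral_return)
  qed
  then show ?thesis
    unfolding expect_policy[OF f] expect_state[OF m] by (intro nn_integral_cong) blast
qed

section \<open>K-convex functions on the line and on the integers\<close>

locale line_or_integers =
  fixes X :: "real set"
  assumes X_cases: "X = UNIV \<or> X = \<int>"
begin

lemma X_add: "x \<in> X \<Longrightarrow> y \<in> X \<Longrightarrow> x + y \<in> X"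
  and X_diff: "x \<in> X \<Longrightarrow> y \<in> X \<Longrightarrow> x - y \<in> X"
  and X_minus: "x \<in> X \<Longrightarrow> - x \<in> X"
  and X_int: "real_of_int i \<in> X"
  and X_0: "0 \<in> X"
  and X_1: "1 \<in> X"
  using X_cases by auto

lemma closed_X: "closed X"
  using X_cases closed_Ints by auto

lemma X_limit: "(\<And>n. y n \<in> X) \<Longrightarrow> y \<longlonglongrightarrow> z \<Longrightarrow> z \<in> X" for y :: "nat \<Rightarrow> real"
  using closed_X closed_sequentially by blast

lemma compact_X_Icc: "compact (X \<inter> {a..b})"
  by (rule closed_Int_compact[OF closed_X]) simp

text \<open>
  Writing the weights as quotients of distances and clearing denominators leaves an inequality
  between three ordered states, which suits the real line and the integers alike.
\<close>

lemma K_convex_on_ratio: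
  assumes "0 \<le> K"
  shows "K_convex_on X K f \<longleftrightarrow>
    (\<forall>x\<in>X. \<forall>z\<in>X. \<forall>y\<in>X. x \<le> z \<and> z \<le> y \<longrightarrow> (y - x) * f z \<le> (y - z) * f x + (z - x) * (f y + K))"
    (is "?l \<longleftrightarrow> ?r")
proof
  assume l: ?l
  show ?r
  proof (intro ballI impI, elim conjE)
    fix x z y assume X: "x \<in> X" "z \<in> X" "y \<in> X" and o: "x \<le> z" "z \<le> y"
    consider "z = x" | "z = y" | "x < z" "z < y" using o by linarith
    then show "(y - x) * f z \<le> (y - z) * f x + (z - x) * (f y + K)"
    proof cases
      case 3
      define l where "l = (z - x) / (y - x)"
      have l1: "0 < l" "l < 1" and ly: "l * (y - x) = z - x"
        using 3 by (simp_all add: l_def)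
      have zl: "z = (1 - l) * x + l * y" using ly by (simp add: algebra_simps)
      have "f z \<le> (1 - l) * f x + l * f y + l * K"
        using l X o l1 unfolding K_convex_on_def zl[symmetric] by (smt (verit) zl)
      then have "(y - x) * f z \<le> (y - x) * ((1 - l) * f x + l * f y + l * K)"
        using 3 by (intro mult_left_mono) auto
      also have "\<dots> = (y - x - l * (y - x)) * f x + (l * (y - x)) * (f y + K)"
        by (simp add: algebra_simps)
      finally show ?thesis unfolding ly by simp
    next
      case 2
      then show ?thesis using mult_nonneg_nonneg[OF assms, of "y - x"] o by (simp add: algebra_simps)
    qed simp
  qed
next
  assume r: ?r
  show ?l
    unfolding K_convex_on_def
  proof (intro ballI allI impI, elim conjE)
    fix x y l assume X: "x \<in> X" "y \<in> X" and l: "x \<le> y" "0 < l" "l < 1" "(1 - l) * x + l * y \<in> X"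
    define z where "z = (1 - l) * x + l * y"
    have z: "z = x + l * (y - x)" by (simp add: z_def algebra_simps)
    show "f ((1 - l) * x + l * y) \<le> (1 - l) * f x + l * f y + l * K"
    proof (cases "x = y")
      case True
      then show ?thesis using l assms by (simp add: algebra_simps)
    next
      case False
      then have d: "0 < y - x" using l by simp
      have "l * (y - x) \<le> 1 * (y - x)" using l d by (intro mult_right_mono) auto
      moreover have "0 \<le> l * (y - x)" using l d by simp
      ultimately have "x \<le> z" "z \<le> y" unfolding z by simp_all
      then have "(y - x) * f z \<le> (y - z) * f x + (z - x) * (f y + K)"
        using r X l unfolding z_def by blast
      also have "\<dots> = (y - x) * ((1 - l) * f x + l * f y + l * K)"
        unfolding z by (simp add: algebra_simps)
      finally show ?thesis using d unfolding z_def[symmetric] by simp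
    qed
  qed
qed

lemma K_convex_onD:
  assumes "0 \<le> K" "K_convex_on X K f" "x \<in> X" "z \<in> X" "y \<in> X" "x \<le> z" "z \<le> y"
  shows "(y - x) * f z \<le> (y - z) * f x + (z - x) * (f y + K)"
  using assms K_convex_on_ratio by blast

lemma K_convex_on_LIMSEQ:
  assumes "\<And>n. K_convex_on X K (f n)" "\<And>x. x \<in> X \<Longrightarrow> (\<lambda>n. f n x) \<longlonglongrightarrow> g x"
  shows "K_convex_on X K g"
  unfolding K_convex_on_def
proof (intro ballI allI impI, elim conjE)
  fix x y l :: real assume X: "x \<in> X" "y \<in> X" and l: "x \<le> y" "0 < l" "l < 1" "(1 - l) * x + l * y \<in> X"
  have lim: "(\<lambda>n. (1 - l) * f n x + l * f n y + l * K) \<longlonglongrightarrow> (1 - l) * g x + l * g y + l * K"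
    using assms(2) X by (intro tendsto_intros) auto
  show "g ((1 - l) * x + l * y) \<le> (1 - l) * g x + l * g y + l * K"
    by (rule LIMSEQ_le[OF assms(2)[OF l(4)] lim])
       (use assms(1) X l in \<open>auto simp: K_convex_on_def\<close>)
qed

lemma K_convex_on_add_linear:
  assumes "K_convex_on X K f"
  shows "K_convex_on X K (\<lambda>x. f x + c * x)"
  using assms unfolding K_convex_on_def by (fastforce simp: algebra_simps)

text \<open>
  A secant slope on \<open>[a, b]\<close> lies between those of the secants that reach one unit further out.
  Such secants have length at least one, so by nonnegativity their slopes are bounded by the outer
  end values.
\<close>

lemma convex_on_X_Lipschitz:
  assumes cv: "K_convex_on X 0 f" and nn: "\<And>x. x \<in> X \<Longrightarrow> 0 \<le> f x"
    and X: "a \<in> X" "b \<in> X" "x \<in> X" "y \<in> X" and o: "a \<le> x" "x \<le> y" "y \<le> b"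
  shows "\<bar>f y - f x\<bar> \<le> (y - x) * (f (a - 1) + f (b + 1))"
proof -
  note D = K_convex_onD[OF order_refl cv]
  have X': "a - 1 \<in> X" "b + 1 \<in> X" using X X_1 X_add X_diff by auto
  show ?thesis
  proof (cases "x = y")
    case False
    then have xy: "0 < y - x" using o by simp
    \<comment> \<open>the slope on \<open>[x, y]\<close> is at most the slope on \<open>[x, b + 1]\<close>, whose length is at least one\<close>
    have "(b + 1 - x) * f y \<le> (b + 1 - y) * f x + (y - x) * f (b + 1)"
      using D[of x y "b + 1"] X X' o by simp
    then have 1: "(b + 1 - x) * (f y - f x) \<le> (y - x) * (f (b + 1) - f x)"
      by (simp add: algebra_simps)
    have "f y - f x \<le> (y - x) * f (b + 1)"
    proof (cases "f y \<le> f x")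
      case True
      then show ?thesis using nn[OF X'(2)] xy by (smt (verit) mult_nonneg_nonneg)
    next
      case False
      have "1 * (f y - f x) \<le> (b + 1 - x) * (f y - f x)"
        using False o by (intro mult_right_mono) auto
      also have "\<dots> \<le> (y - x) * f (b + 1)"
        using 1 nn[OF X(3)] xy by (smt (verit) mult_left_mono)
      finally show ?thesis by simp
    qed
    moreover have "(y - (a - 1)) * f x \<le> (y - x) * f (a - 1) + (x - (a - 1)) * f y"
      using D[of "a - 1" x y] X X' o by simp
    then have 2: "(y - (a - 1)) * (f x - f y) \<le> (y - x) * (f (a - 1) - f y)"
      by (simp add: algebra_simps)
    have "f x - f y \<le> (y - x) * f (a - 1)"
    proof (cases "f x \<le> f y")
      case True
      then show ?thesis using nn[OF X'(1)] xy by (smt (verit) mult_nonneg_nonneg)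
    next
      case False
      have "1 * (f x - f y) \<le> (y - (a - 1)) * (f x - f y)"
        using False o by (intro mult_right_mono) auto
      also have "\<dots> \<le> (y - x) * f (a - 1)"
        using 2 nn[OF X(4)] xy by (smt (verit) mult_left_mono)
      finally show ?thesis by simp
    qed
    ultimately show ?thesis
      using mult_nonneg_nonneg[OF less_imp_le[OF xy] nn[OF X'(1)]]
        mult_nonneg_nonneg[OF less_imp_le[OF xy] nn[OF X'(2)]]
      unfolding distrib_left by linarith
  qed simp
qed

lemma locally_Lipschitz_tendsto:
  assumes lip: "\<And>k z. z \<in> X \<Longrightarrow> \<bar>z - y\<bar> \<le> 1 \<Longrightarrow> \<bar>G k z - G k y\<bar> \<le> C * \<bar>z - y\<bar>"
    and pt: "(\<lambda>k. G k y) \<longlonglongrightarrow> g" and z: "\<And>k. z k \<in> X" "z \<longlonglongrightarrow> y"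
  shows "(\<lambda>k. G k (z k)) \<longlonglongrightarrow> (g::real)"
proof -
  have d: "(\<lambda>k. C * \<bar>z k - y\<bar>) \<longlonglongrightarrow> C * \<bar>y - y\<bar>"
    by (intro tendsto_intros z)
  have "(\<lambda>k. G k (z k) - G k y) \<longlonglongrightarrow> 0"
  proof (rule Lim_null_comparison)
    have "eventually (\<lambda>k. \<bar>z k - y\<bar> < 1) sequentially"
      using tendstoD[OF z(2), of 1] by (simp add: dist_real_def)
    then show "eventually (\<lambda>k. norm (G k (z k) - G k y) \<le> C * \<bar>z k - y\<bar>) sequentially"
      by eventually_elim (use lip z in auto)
    show "(\<lambda>k. C * \<bar>z k - y\<bar>) \<longlonglongrightarrow> 0" using d by simp
  qed
  from tendsto_add[OF this pt] show ?thesis by simp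
qed

lemma locally_Lipschitz_continuous_on:
  assumes "\<And>y. y \<in> X \<Longrightarrow> \<exists>C. \<forall>z\<in>X. \<bar>z - y\<bar> \<le> 1 \<longrightarrow> \<bar>g z - g y\<bar> \<le> C * \<bar>z - y\<bar>"
  shows "continuous_on X (g :: real \<Rightarrow> real)"
  unfolding continuous_on_sequentially
proof (intro allI ballI impI, elim conjE)
  fix z :: "nat \<Rightarrow> real" and y assume "y \<in> X" "\<forall>n. z n \<in> X" "z \<longlonglongrightarrow> y"
  moreover obtain C where "\<forall>z\<in>X. \<bar>z - y\<bar> \<le> 1 \<longrightarrow> \<bar>g z - g y\<bar> \<le> C * \<bar>z - y\<bar>"
    using assms[OF \<open>y \<in> X\<close>] by blast
  ultimately show "(g \<circ> z) \<longlonglongrightarrow> g y"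
    using locally_Lipschitz_tendsto[of y "\<lambda>_. g" C "g y" z] by (simp add: comp_def)
qed

end


section \<open>One ordering decision with a setup cost\<close>

text \<open>
  The decision is described by the level after ordering. The proportional ordering cost is part of
  \<open>G\<close>, as \<open>cbar * y\<close>; the constant \<open>cbar * x\<close> that this adds is subtracted by the users.
\<close>

definition order_value :: "real set \<Rightarrow> real \<Rightarrow> (real \<Rightarrow> real) \<Rightarrow> real \<Rightarrow> real" where
  "order_value X K G x = Inf ((\<lambda>y. (if x < y then K else 0) + G y) ` {y \<in> X. x \<le> y})"

text \<open>
  All inequalities are weak: where ordering and waiting tie, both are admitted. This makes the
  notion stable under limits of \<open>G\<close>, \<open>s\<close> and \<open>S\<close>.
\<close>

definition sS_optimal :: "real set \<Rightarrow> real \<Rightarrow> (real \<Rightarrow> real) \<Rightarrow> real \<Rightarrow> real \<Rightarrow> bool" where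
  "sS_optimal X K G s S \<longleftrightarrow> s \<in> X \<and> S \<in> argmin_on X G \<and> s \<le> S \<and>
     (\<forall>x\<in>X. x < s \<longrightarrow> K + G S \<le> G x) \<and> (\<forall>x\<in>X. \<forall>y\<in>X. s \<le> x \<and> x \<le> y \<longrightarrow> G x \<le> K + G y)"

lemma order_value_eqI:
  assumes "y \<in> X" "x \<le> y" and "\<And>z. z \<in> X \<Longrightarrow> x \<le> z \<Longrightarrow> (if x < y then K else 0) + G y \<le> (if x < z then K else 0) + G z"
  shows "order_value X K G x = (if x < y then K else 0) + G y"
  unfolding order_value_def using assms by (intro cInf_eq_minimum) (auto simp: image_iff)

lemma order_value_sS:
  assumes o: "sS_optimal X K G s S" and K: "0 \<le> K" and x: "x \<in> X"
  shows "order_value X K G x = (if x < s then K + G S else G x)"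
proof (cases "x < s")
  case True
  then have "order_value X K G x = (if x < S then K else 0) + G S"
    by (intro order_value_eqI) (use o x K in \<open>auto simp: sS_optimal_def argmin_on_def\<close>)
  then show ?thesis using True o by (auto simp: sS_optimal_def)
next
  case False
  then have "order_value X K G x = (if x < x then K else 0) + G x"
    using o x K by (intro order_value_eqI) (auto simp: sS_optimal_def)
  then show ?thesis using False by simp
qed

text \<open>
  The function of the next lemma is any selection of order values. The proof follows an optimal
  order at the left end of a segment: if it reaches beyond the inner point, it is also available
  there; if it stops short, \<open>K\<close>-convexity is used on the shorter segment that starts at its target.
\<close>

lemma (in line_or_integers) K_convex_on_order_value:
  assumes K: "0 \<le> K" and G: "K_convex_on X K G"
    and g_le: "\<And>x. x \<in> X \<Longrightarrow> g x \<le> G x" "\<And>x y. x \<in> X \<Longrightarrow> y \<in> X \<Longrightarrow> x \<le> y \<Longrightarrow> g x \<le> K + G y"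
    and g_eq: "\<And>x. x \<in> X \<Longrightarrow> g x = G x \<or> (\<exists>y\<in>X. x \<le> y \<and> g x = K + G y)"
  shows "K_convex_on X K g"
proof -
  have mono: "g x \<le> K + g y" if "x \<in> X" "y \<in> X" "x \<le> y" for x y
    using g_eq[OF that(2)] g_le(2)[OF that(1)] that K by fastforce
  have no_order: "(y - x) * g z \<le> (y - z) * G x + (z - x) * (g y + K)"
    if X: "x \<in> X" "z \<in> X" "y \<in> X" and o: "x \<le> z" "z \<le> y" for x y z
    using g_eq[OF X(3)]
  proof
    assume "g y = G y"
    have "(y - x) * g z \<le> (y - x) * G z" using o g_le(1)[OF X(2)] by (intro mult_left_mono) auto
    also have "\<dots> \<le> (y - z) * G x + (z - x) * (g y + K)"
      using K_convex_onD[OF K G X o] \<open>g y = G y\<close> by simp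
    finally show ?thesis .
  next
    assume "\<exists>y'\<in>X. y \<le> y' \<and> g y = K + G y'"
    then obtain y' where y': "y' \<in> X" "y \<le> y'" "g y = K + G y'" by blast
    show ?thesis
    proof (cases "G x \<le> g y")
      case False
      have "g z \<le> g y" using g_le(2)[OF X(2) y'(1)] y' o by simp
      then have "(y - x) * g z \<le> (y - x) * g y" using o by (intro mult_left_mono) auto
      also have "\<dots> = (y - z) * g y + (z - x) * g y" by (simp add: algebra_simps)
      also have "\<dots> \<le> (y - z) * G x + (z - x) * (g y + K)"
        using False o K by (intro add_mono mult_left_mono) auto
      finally show ?thesis .
    next
      case True
      show ?thesis
      proof (cases "x = z")
        case True
        then show ?thesis using g_le(1)[OF X(2)] o by (simp add: mult_left_mono)
      next
        case False
        then have y'x: "0 < y' - x" using o y' by simp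
        have "(y' - x) * g z \<le> (y' - x) * G z" using y'x g_le(1)[OF X(2)] by (intro mult_left_mono) auto
        also have "\<dots> \<le> (y' - z) * G x + (z - x) * (g y)"
          using K_convex_onD[OF K G X(1,2) y'(1)] o y' by (simp add: add.commute)
        also have "\<dots> = (y' - x) * G x + (z - x) * (g y - G x)" by (simp add: algebra_simps)
        finally have "(y' - x) * (g z - G x) \<le> (z - x) * (g y - G x)" by (simp add: algebra_simps)
        moreover have "(y - x) * (g z - G x) \<le> (y' - x) * (g z - G x) \<or> g z \<le> G x"
          using y' by (metis diff_right_mono linorder_linear diff_ge_0_iff_ge mult_right_mono)
        ultimately have "(y - x) * (g z - G x) \<le> (z - x) * (g y - G x)"
          using True o mult_nonneg_nonneg[of "z - x" "g y - G x"] mult_nonneg_nonneg[of "y - x" "G x - g z"]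
          by (auto simp: algebra_simps)
        moreover have "0 \<le> (z - x) * K" using o K by simp
        ultimately show ?thesis by (simp add: algebra_simps)
      qed
    qed
  qed
  show ?thesis
    unfolding K_convex_on_ratio[OF K]
  proof (intro ballI impI, elim conjE)
    fix x z y assume X: "x \<in> X" "z \<in> X" "y \<in> X" and o: "x \<le> z" "z \<le> y"
    from g_eq[OF X(1)] show "(y - x) * g z \<le> (y - z) * g x + (z - x) * (g y + K)"
    proof
      assume "g x = G x"
      then show ?thesis using no_order[OF X o] by simp
    next
      assume "\<exists>x'\<in>X. x \<le> x' \<and> g x = K + G x'"
      then obtain x' where x': "x' \<in> X" "x \<le> x'" "g x = K + G x'" by blast
      have gxy: "g x \<le> g y + K" using mono[OF X(1,3)] o by simp
      show ?thesis
      proof (cases "z \<le> x'")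
        case True
        have "g z \<le> g x" using g_le(2)[OF X(2) x'(1) True] x' by simp
        then have "(y - x) * g z \<le> (y - x) * g x" using o by (intro mult_left_mono) auto
        also have "\<dots> = (y - z) * g x + (z - x) * g x" by (simp add: algebra_simps)
        also have "\<dots> \<le> (y - z) * g x + (z - x) * (g y + K)"
          using gxy o by (intro add_mono mult_left_mono) auto
        finally show ?thesis .
      next
        case False
        define A where "A = g x - K" 
        define B where "B = g y + K"
        have AB: "A \<le> B" using gxy K unfolding A_def B_def by simp
        have x'y: "0 < y - x'" "0 < z - x'" using False o by auto
        have h: "(y - x') * g z \<le> (y - z) * A + (z - x') * B"
          using no_order[OF x'(1) X(2,3)] x' False o unfolding A_def B_def by simp
        have "(y - x') * ((y - x) * g z) \<le> (y - x) * ((y - z) * A + (z - x') * B)"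
          using mult_left_mono[OF h, of "y - x"] o by (simp add: mult.left_commute)
        also have "\<dots> = (y - x') * ((y - z) * A + (z - x) * B) - (y - z) * (x' - x) * (B - A)"
          by (simp add: algebra_simps)
        also have "\<dots> \<le> (y - x') * ((y - z) * A + (z - x) * B)"
          using o x' AB by simp
        finally have "(y - x) * g z \<le> (y - z) * A + (z - x) * B"
          using x'y by simp
        also have "\<dots> \<le> (y - z) * g x + (z - x) * (g y + K)"
          unfolding A_def B_def using o K by (intro add_mono mult_left_mono) auto
        finally show ?thesis .
      qed
    qed
  qed
qed

text \<open>
  The quantities \<open>z0\<close>, \<open>B0\<close> and \<open>\<eta>\<close> are parameters of the locale, since a whole family of level
  costs will share them: they confine the optimal levels to one compact set
  (\<open>sS_optimal_range\<close>).
\<close>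

locale setup_cost_problem = line_or_integers +
  fixes K z0 B0 \<eta> :: real and G :: "real \<Rightarrow> real"
  assumes K: "0 \<le> K" and G_convex: "K_convex_on X K G" and G_cont: "continuous_on X G"
    and z0: "z0 \<in> X" and \<eta>: "0 < \<eta>"
    and G_low: "\<And>x y. x \<in> X \<Longrightarrow> y \<in> X \<Longrightarrow> x \<le> y \<Longrightarrow> y \<le> z0 \<Longrightarrow> \<eta> * (y - x) \<le> G x - G y"
    and G_high: "\<And>y. y \<in> X \<Longrightarrow> B0 < y \<Longrightarrow> G z0 < G y"
    and G_coercive: "\<And>c. \<exists>b. \<forall>y\<in>X. b \<le> y \<longrightarrow> c < G y"
begin

lemma inf_compact_G: "inf_compact_on X G"
  unfolding inf_compact_on_def
proof
  fix l
  obtain b where b: "\<forall>y\<in>X. b \<le> y \<longrightarrow> l < G y" using G_coercive by blast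
  define a where "a = min z0 (z0 - (l - G z0) / \<eta>)"
  have "a \<le> x" if "x \<in> X" "G x \<le> l" for x
  proof (cases "x \<le> z0")
    case True
    then have "\<eta> * (z0 - x) \<le> l - G z0" using G_low[of x z0] that z0 by simp
    then have "z0 - x \<le> (l - G z0) / \<eta>" using \<eta> by (simp add: field_simps)
    then show ?thesis unfolding a_def by simp
  qed (simp add: a_def)
  then have sub: "{u \<in> X. G u \<le> l} = {u \<in> X \<inter> {a..b}. G u \<le> l}"
    using b by force
  have "closed {u \<in> X \<inter> {a..b}. G u \<le> l}"
    using continuous_on_subset[OF G_cont, of "X \<inter> {a..b}"] compact_imp_closed[OF compact_X_Icc]
    by (intro continuous_on_closed_Collect_le) (auto intro: continuous_intros)
  moreover have "bounded {u \<in> X \<inter> {a..b}. G u \<le> l}"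
    by (rule bounded_subset[of "{a..b}"]) auto
  ultimately show "compact {u \<in> X. G u \<le> l}"
    unfolding sub by (simp add: compact_eq_bounded_closed)
qed

lemma minimizer_above:
  assumes x: "x \<in> X"
  obtains b where "b \<in> X" "x \<le> b" "\<And>y. y \<in> X \<Longrightarrow> x \<le> y \<Longrightarrow> G b \<le> G y"
proof -
  have "compact ({u \<in> X. G u \<le> G x} \<inter> {x..})"
    using inf_compact_G by (intro compact_Int_closed) (auto simp: inf_compact_on_def)
  moreover have "{u \<in> X. G u \<le> G x} \<inter> {x..} \<noteq> {}" using x by auto
  moreover have "continuous_on ({u \<in> X. G u \<le> G x} \<inter> {x..}) G"
    by (rule continuous_on_subset[OF G_cont]) auto
  ultimately obtain b where b: "b \<in> X" "x \<le> b" "G b \<le> G x"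
    and min: "\<And>y. y \<in> X \<Longrightarrow> x \<le> y \<Longrightarrow> G y \<le> G x \<Longrightarrow> G b \<le> G y"
    using continuous_attains_inf[of "{u \<in> X. G u \<le> G x} \<inter> {x..}" G] by auto
  have "G b \<le> G y" if "y \<in> X" "x \<le> y" for y
    using min[OF that] b(3) by linarith
  then show ?thesis using that b by blast
qed

lemma argmin_nonempty: "argmin_on X G \<noteq> {}"
proof -
  obtain b where b: "b \<in> X" "z0 \<le> b" "\<And>y. y \<in> X \<Longrightarrow> z0 \<le> y \<Longrightarrow> G b \<le> G y"
    using minimizer_above[OF z0] by blast
  have "G b \<le> G y" if y: "y \<in> X" for y
  proof (cases "z0 \<le> y")
    case False
    then have "0 \<le> \<eta> * (z0 - y)" using \<eta> by simp
    then show ?thesis using G_low[OF y z0] False b(3)[OF z0] by simp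
  qed (use b y in auto)
  then show ?thesis using b by (auto simp: argmin_on_def)
qed

lemma argmin_range:
  assumes "S \<in> argmin_on X G"
  shows "z0 \<le> S" "S \<le> B0"
proof -
  have S: "S \<in> X" "G S \<le> G z0" using assms z0 by (auto simp: argmin_on_def)
  show "S \<le> B0" using G_high[OF S(1)] S by force
  show "z0 \<le> S"
  proof (rule ccontr)
    assume "\<not> z0 \<le> S"
    then have "0 < \<eta> * (z0 - S)" "\<eta> * (z0 - S) \<le> G S - G z0" using \<eta> G_low[OF S(1) z0] by auto
    then show False using S by simp
  qed
qed

text \<open>
  From \<open>x\<close> up to \<open>z0\<close> the level cost drops at rate \<open>\<eta>\<close>, and the total drop to the minimum is
  at most \<open>K\<close> when waiting is still acceptable.
\<close>

lemma low_level_orders: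
  assumes "S \<in> argmin_on X G" "x \<in> X" "G x \<le> K + G S"
  shows "z0 - K / \<eta> \<le> x"
proof (cases "x \<le> z0")
  case True
  have "G S \<le> G z0" using assms z0 by (auto simp: argmin_on_def)
  then have "\<eta> * (z0 - x) \<le> K" using G_low[OF assms(2) z0 True] assms by simp
  then show ?thesis using \<eta> by (simp add: field_simps)
next
  case False
  then show ?thesis using K \<eta> by (smt (verit) divide_nonneg_pos)
qed

lemma sS_optimal_range:
  assumes "sS_optimal X K G s S"
  shows "z0 \<le> S" "S \<le> B0" "z0 - K / \<eta> \<le> s"
proof -
  have S: "S \<in> argmin_on X G" and s: "s \<in> X" "G s \<le> K + G S"
    using assms by (auto simp: sS_optimal_def argmin_on_def)
  show "z0 \<le> S" "S \<le> B0" using argmin_range[OF S] .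
  show "z0 - K / \<eta> \<le> s" using low_level_orders[OF S s] .
qed

text \<open>
  Scarf's argument. Below \<open>s\<close> an order up to \<open>S\<close> pays by the choice of \<open>s\<close>. Above \<open>s\<close> no order
  pays: between \<open>s\<close> and \<open>S\<close> by \<open>K\<close>-convexity on \<open>[s, S]\<close>, and to the right of \<open>S\<close> by \<open>K\<close>-convexity
  on \<open>[S, y]\<close>, where the left end is the global minimum.
\<close>

lemma sS_optimal_Inf:
  assumes S: "S \<in> argmin_on X G" and s: "s = Inf {x \<in> X. x \<le> S \<and> G x \<le> K + G S}"
  shows "sS_optimal X K G s S"
proof -
  define A where "A = {x \<in> X. x \<le> S \<and> G x \<le> K + G S}"
  have SX: "S \<in> X" and Smin: "\<And>y. y \<in> X \<Longrightarrow> G S \<le> G y" using S by (auto simp: argmin_on_def)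
  have SA: "S \<in> A" using SX K by (simp add: A_def)
  have bdd: "bdd_below A"
    using low_level_orders[OF S] by (intro bdd_belowI[of _ "z0 - K / \<eta>"]) (auto simp: A_def)
  have "closed A"
  proof -
    have "A = {x \<in> X. G x \<le> K + G S} \<inter> {..S}" by (auto simp: A_def)
    moreover have "closed {x \<in> X. G x \<le> K + G S}"
      using inf_compact_G by (auto simp: inf_compact_on_def intro: compact_imp_closed)
    ultimately show ?thesis by (simp add: closed_Int)
  qed
  then have sA: "s \<in> A"
    unfolding s A_def[symmetric] using SA bdd by (intro closed_contains_Inf) auto
  have below: "K + G S \<le> G x" if "x \<in> X" "x < s" for x
  proof (rule ccontr)
    assume "\<not> K + G S \<le> G x"
    then have "x \<in> A" using that sA by (auto simp: A_def)
    then have "s \<le> x" unfolding s A_def[symmetric] using bdd by (rule cInf_lower)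
    then show False using that by simp
  qed
  have above: "G x \<le> K + G y" if X: "x \<in> X" "y \<in> X" and o: "s \<le> x" "x \<le> y" for x y
  proof (cases "x \<le> S")
    case True
    \<comment> \<open>between \<open>s\<close> and \<open>S\<close> the level cost stays below the common bound of both end values plus \<open>K\<close>\<close>
    have sX: "s \<in> X" "G s \<le> K + G S" using sA by (auto simp: A_def)
    show ?thesis
    proof (cases "s = S")
      case True
      then show ?thesis using sX \<open>x \<le> S\<close> o Smin[OF X(2)] by simp
    next
      case False
      then have d: "0 < S - s" using True o by simp
      have "(S - s) * G x \<le> (S - x) * G s + (x - s) * (G S + K)"
        using K_convex_onD[OF K G_convex sX(1) X(1) SX o(1) True] .
      also have "\<dots> \<le> (S - x) * (K + G S) + (x - s) * (K + G S)"
        using sX True o by (intro add_mono[OF mult_left_mono mult_left_mono]) auto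
      also have "\<dots> = (S - s) * (K + G S)" by (simp add: algebra_simps)
      finally have "G x \<le> K + G S" using d by simp
      then show ?thesis using Smin[OF X(2)] by simp
    qed
  next
    case False
    then have d: "0 < y - S" using o by simp
    have "(y - S) * G x \<le> (y - x) * G S + (x - S) * (G y + K)"
      using K_convex_onD[OF K G_convex SX X] False o by simp
    also have "\<dots> \<le> (y - x) * (G y + K) + (x - S) * (G y + K)"
      using Smin[OF X(2)] K False o by (intro add_mono mult_left_mono) auto
    also have "\<dots> = (y - S) * (K + G y)" by (simp add: algebra_simps)
    finally show ?thesis using d by simp
  qed
  show ?thesis
    unfolding sS_optimal_def using sA S below above by (auto simp: A_def)
qed

lemma sS_optimal_exists: "\<exists>s S. sS_optimal X K G s S"
  using argmin_nonempty sS_optimal_Inf by blast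

end

text \<open>
  Continuous convergence allows moving levels to be inserted into the weak inequalities before
  passing to the limit.
\<close>

lemma (in line_or_integers) sS_optimal_limit:
  assumes opt: "\<And>k. sS_optimal X K (G k) (s k) (S k)"
    and lim: "s \<longlonglongrightarrow> s'" "S \<longlonglongrightarrow> S'"
    and cc: "\<And>y z. (\<And>k. y k \<in> X) \<Longrightarrow> z \<in> X \<Longrightarrow> y \<longlonglongrightarrow> z \<Longrightarrow> (\<lambda>k. G k (y k)) \<longlonglongrightarrow> H z"
  shows "sS_optimal X K H s' S'"
proof -
  have X: "\<And>k. s k \<in> X" "\<And>k. S k \<in> X" using opt by (auto simp: sS_optimal_def argmin_on_def)
  have X': "s' \<in> X" "S' \<in> X" using X_limit[OF X(1) lim(1)] X_limit[OF X(2) lim(2)] by auto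
  have pt: "(\<lambda>k. G k y) \<longlonglongrightarrow> H y" if "y \<in> X" for y using that cc[of "\<lambda>_. y"] by simp
  have GS: "(\<lambda>k. G k (S k)) \<longlonglongrightarrow> H S'" and Gs: "(\<lambda>k. G k (s k)) \<longlonglongrightarrow> H s'" using cc X X' lim by auto
  have "H S' \<le> H y" if "y \<in> X" for y
    by (rule LIMSEQ_le[OF GS pt[OF that]]) (use opt that in \<open>auto simp: sS_optimal_def argmin_on_def\<close>)
  moreover have "s' \<le> S'"
    by (rule LIMSEQ_le[OF lim]) (use opt in \<open>auto simp: sS_optimal_def\<close>)
  moreover have "K + H S' \<le> H x" if "x \<in> X" "x < s'" for x
  proof (rule tendsto_le[OF _ pt[OF that(1)]])
    show "(\<lambda>k. K + G k (S k)) \<longlonglongrightarrow> K + H S'" by (intro tendsto_intros GS)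
    show "eventually (\<lambda>k. K + G k (S k) \<le> G k x) sequentially"
      using order_tendstoD(1)[OF lim(1) that(2)] by eventually_elim (use opt that in \<open>auto simp: sS_optimal_def\<close>)
  qed simp
  moreover have "H x \<le> K + H y" if "x \<in> X" "y \<in> X" "s' \<le> x" "x \<le> y" for x y
  proof (cases "s' = x")
    case True
    \<comment> \<open>at the limit level itself compare along the levels \<open>max (s k) x\<close>, which tend to it\<close>
    have lims: "(\<lambda>k. max (s k) x) \<longlonglongrightarrow> x" "(\<lambda>k. max (s k) y) \<longlonglongrightarrow> y"
      using tendsto_max[OF lim(1) tendsto_const[of x]] tendsto_max[OF lim(1) tendsto_const[of y]] True that
      by (simp_all add: max_absorb2)
    have mX: "max (s k) x \<in> X" "max (s k) y \<in> X" for k using X that by (auto simp: max_def)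
    show ?thesis
    proof (rule LIMSEQ_le)
      show "(\<lambda>k. G k (max (s k) x)) \<longlonglongrightarrow> H x" using cc[OF mX(1) that(1) lims(1)] .
      show "(\<lambda>k. K + G k (max (s k) y)) \<longlonglongrightarrow> K + H y"
        by (intro tendsto_intros cc[OF mX(2) that(2) lims(2)])
      show "\<exists>N. \<forall>k\<ge>N. G k (max (s k) x) \<le> K + G k (max (s k) y)"
        using opt mX that by (auto simp: sS_optimal_def)
    qed
  next
    case False
    show ?thesis
    proof (rule tendsto_le[OF _ _ pt[OF that(1)]])
      show "(\<lambda>k. K + G k y) \<longlonglongrightarrow> K + H y" by (intro tendsto_intros pt that)
      show "eventually (\<lambda>k. G k x \<le> K + G k y) sequentially"
        using order_tendstoD(2)[OF lim(1), of x] False that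
        by (auto elim!: eventually_mono) (use opt that in \<open>auto simp: sS_optimal_def\<close>)
    qed simp
  qed
  ultimately show ?thesis
    unfolding sS_optimal_def using X' by (auto simp: argmin_on_def)
qed

text \<open>
  The levels have a convergent subsequence, and by the preceding lemma its limits describe the order
  value of the limit cost; so they determine the only possible limit \<open>V\<close>.
\<close>

lemma (in line_or_integers) order_value_limit:
  assumes K: "0 \<le> K" and opt: "\<And>k. sS_optimal X K (G k) (s k) (S k)"
    and bd: "\<And>k. c \<le> s k" "\<And>k. S k \<le> d"
    and cc: "\<And>y z. (\<And>k. y k \<in> X) \<Longrightarrow> z \<in> X \<Longrightarrow> y \<longlonglongrightarrow> z \<Longrightarrow> (\<lambda>k. G k (y k)) \<longlonglongrightarrow> H z"
    and x: "x \<in> X" and V: "(\<lambda>k. order_value X K (G k) x) \<longlonglongrightarrow> V"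
  shows "V = order_value X K H x"
proof -
  have sle: "s k \<le> S k" for k using opt by (auto simp: sS_optimal_def)
  have mem: "(s k, S k) \<in> {c..d} \<times> {c..d}" for k
    using bd[of k] sle[of k] by simp
  have "seq_compact ({c..d} \<times> {c..d})" by (intro compact_imp_seq_compact compact_Times) auto
  then obtain l r where r: "strict_mono r" and l: "((\<lambda>k. (s k, S k)) \<circ> r) \<longlonglongrightarrow> l"
    by (rule seq_compactE[of _ "\<lambda>k. (s k, S k)"]) (use mem in blast)
  obtain s' S' where l': "l = (s', S')" by (cases l)
  have l2: "(\<lambda>k. (s (r k), S (r k))) \<longlonglongrightarrow> (s', S')"
    using l unfolding l' comp_def .
  have ls: "(\<lambda>k. s (r k)) \<longlonglongrightarrow> s'" using tendsto_fst[OF l2] by simp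
  have lS: "(\<lambda>k. S (r k)) \<longlonglongrightarrow> S'" using tendsto_snd[OF l2] by simp
  have cc': "(\<lambda>k. G (r k) (y k)) \<longlonglongrightarrow> H z" if y: "\<And>k. y k \<in> X" "z \<in> X" "y \<longlonglongrightarrow> z" for y z
  proof -
    \<comment> \<open>fill the gaps of the subsequence with the limit point\<close>
    define y' where "y' n = (if n \<in> range r then y (inv r n) else z)" for n
    have inj: "inj r" using r by (simp add: strict_mono_imp_inj_on)
    have "y' \<longlonglongrightarrow> z"
    proof (rule LIMSEQ_I)
      fix e :: real assume "0 < e"
      then obtain N where N: "\<And>n. n \<ge> N \<Longrightarrow> norm (y n - z) < e" using LIMSEQ_D[OF y(3)] by blast
      have "norm (y' n - z) < e" if "n \<ge> r N" for n
      proof (cases "n \<in> range r")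
        case True
        then obtain k where k: "n = r k" by blast
        then have "N \<le> k" using that r by (simp add: strict_mono_less_eq)
        then show ?thesis using N k inj by (simp add: y'_def)
      qed (use \<open>0 < e\<close> in \<open>simp add: y'_def\<close>)
      then show "\<exists>no. \<forall>n\<ge>no. norm (y' n - z) < e" by blast
    qed
    moreover have "y' k \<in> X" for k using y by (simp add: y'_def)
    ultimately have "(\<lambda>k. G k (y' k)) \<longlonglongrightarrow> H z" using y(2) by (intro cc)
    from LIMSEQ_subseq_LIMSEQ[OF this r] show ?thesis
      using inj by (simp add: comp_def y'_def)
  qed
  have opt': "sS_optimal X K H s' S'"
    by (rule sS_optimal_limit[of K "\<lambda>k. G (r k)"]) (use opt ls lS cc' in auto)
  have X: "s' \<in> X" "S' \<in> X" using opt' by (auto simp: sS_optimal_def argmin_on_def)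
  have Vr: "(\<lambda>k. order_value X K (G (r k)) x) \<longlonglongrightarrow> V" using LIMSEQ_subseq_LIMSEQ[OF V r] by (simp add: comp_def)
  have GS: "(\<lambda>k. K + G (r k) (S (r k))) \<longlonglongrightarrow> K + H S'"
    by (intro tendsto_intros cc') (use X opt lS in \<open>auto simp: sS_optimal_def argmin_on_def\<close>)
  have Gx: "(\<lambda>k. G (r k) x) \<longlonglongrightarrow> H x" using cc'[of "\<lambda>_. x"] x by simp
  note val = order_value_sS[OF opt K x]
  consider "x < s'" | "s' < x" | "x = s'" by linarith
  then show ?thesis
  proof cases
    case 1
    have "(\<lambda>k. order_value X K (G (r k)) x) \<longlonglongrightarrow> K + H S'"
      by (rule Lim_transform_eventually[OF GS])
         (use order_tendstoD(1)[OF ls 1] in eventually_elim, simp add: val)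
    then show ?thesis using LIMSEQ_unique[OF Vr] 1 by (simp add: order_value_sS[OF opt' K x])
  next
    case 2
    have "(\<lambda>k. order_value X K (G (r k)) x) \<longlonglongrightarrow> H x"
      by (rule Lim_transform_eventually[OF Gx])
         (use order_tendstoD(2)[OF ls 2] in eventually_elim, simp add: val)
    then show ?thesis using LIMSEQ_unique[OF Vr] 2 by (simp add: order_value_sS[OF opt' K x])
  next
    case 3
    \<comment> \<open>both alternatives agree in the limit, as \<open>H s' \<le> K + H S'\<close>\<close>
    have "H x \<le> K + H S'" using opt' X 3 by (auto simp: sS_optimal_def)
    moreover have "min (H x) (K + H S') \<le> V"
      by (rule LIMSEQ_le[OF tendsto_min[OF Gx GS] Vr]) (auto simp: val)
    moreover have "V \<le> H x"
    proof (rule LIMSEQ_le[OF Vr Gx])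
      show "\<exists>N. \<forall>n\<ge>N. order_value X K (G (r n)) x \<le> G (r n) x"
        using opt x unfolding val by (auto simp: sS_optimal_def)
    qed
    ultimately show ?thesis using 3 order_value_sS[OF opt' K x] by simp
  qed
qed

section \<open>The inventory model: expected holding cost and transition law\<close>

text \<open>
  The decision process depends on the demand sequence only through the demand of one period.
\<close>

locale inventory_demand = inventory +
  fixes dem :: "'a \<Rightarrow> real"
  assumes dem_eq: "dem = D 1"
begin

sublocale line_or_integers X
  by standard (rule X_cases)

lemma dem_measurable [measurable]: "dem \<in> borel_measurable P"
  using indep_vars_def2[of "\<lambda>_. borel" D "{1..}"] D_indep dem_eq by auto

lemma dem_nonneg: "\<omega> \<in> space P \<Longrightarrow> 0 \<le> dem \<omega>"
  and dem_X: "\<omega> \<in> space P \<Longrightarrow> dem \<omega> \<in> X"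
  and integrable_h: "x \<in> X \<Longrightarrow> integrable P (\<lambda>\<omega>. h (x - dem \<omega>))"
  and dem_pos: "prob {\<omega> \<in> space P. 0 < dem \<omega>} > 0"
  using D_nonneg[of 1] D_in_X[of 1] h_D_integrable D_pos unfolding dem_eq by auto

lemma shift_X: "x \<in> X \<Longrightarrow> \<omega> \<in> space P \<Longrightarrow> x - dem \<omega> \<in> X"
  using X_diff dem_X by blast

definition e :: "real \<Rightarrow> real" where
  "e x = (\<integral>\<omega>. h (x - dem \<omega>) \<partial>P)"

lemma e_nonneg: "x \<in> X \<Longrightarrow> 0 \<le> e x"
  unfolding e_def by (intro integral_nonneg_AE AE_I2) (use h_nonneg shift_X in auto)

lemma e_convex: "K_convex_on X 0 e"
  unfolding K_convex_on_def
proof (intro ballI allI impI, elim conjE)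
  fix x y l :: real assume X: "x \<in> X" "y \<in> X" and l: "x \<le> y" "0 < l" "l < 1" "(1 - l) * x + l * y \<in> X"
  have "e ((1 - l) * x + l * y) \<le> (\<integral>\<omega>. (1 - l) * h (x - dem \<omega>) + l * h (y - dem \<omega>) \<partial>P)"
    unfolding e_def
  proof (rule integral_mono)
    fix \<omega> assume \<omega>: "\<omega> \<in> space P"
    have eq: "(1 - l) * x + l * y - dem \<omega> = (1 - l) * (x - dem \<omega>) + l * (y - dem \<omega>)"
      by (simp add: algebra_simps)
    have "h ((1 - l) * (x - dem \<omega>) + l * (y - dem \<omega>)) \<le> (1 - l) * h (x - dem \<omega>) + l * h (y - dem \<omega>) + l * 0"
      using h_convex[unfolded K_convex_on_def, rule_format, of "x - dem \<omega>" "y - dem \<omega>" l]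
        shift_X[OF X(1) \<omega>] shift_X[OF X(2) \<omega>] shift_X[OF l(4) \<omega>] l eq by auto
    then show "h ((1 - l) * x + l * y - dem \<omega>) \<le> (1 - l) * h (x - dem \<omega>) + l * h (y - dem \<omega>)"
      unfolding eq by simp
  qed (use integrable_h X l in auto)
  also have "\<dots> = (1 - l) * e x + l * e y"
    unfolding e_def using integrable_h X by simp
  finally show "e ((1 - l) * x + l * y) \<le> (1 - l) * e x + l * e y + l * 0" by simp
qed

lemma convex_imp_continuous_on_X:
  assumes "K_convex_on X 0 f" "\<And>x. x \<in> X \<Longrightarrow> 0 \<le> f x"
  shows "continuous_on X f"
proof (rule locally_Lipschitz_continuous_on)
  fix y assume y: "y \<in> X"
  have X: "y - 1 \<in> X" "y + 1 \<in> X" using y X_1 X_add X_diff by auto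
  have "\<bar>f z - f y\<bar> \<le> (f (y - 1 - 1) + f (y + 1 + 1)) * \<bar>z - y\<bar>" if z: "z \<in> X" "\<bar>z - y\<bar> \<le> 1" for z
  proof (cases "z \<le> y")
    case True
    then show ?thesis
      using convex_on_X_Lipschitz[OF assms X z(1) y] z by (simp add: mult.commute abs_minus_commute)
  next
    case False
    then show ?thesis
      using convex_on_X_Lipschitz[OF assms X y z(1)] z by (simp add: mult.commute)
  qed
  then show "\<exists>C. \<forall>z\<in>X. \<bar>z - y\<bar> \<le> 1 \<longrightarrow> \<bar>f z - f y\<bar> \<le> C * \<bar>z - y\<bar>" by blast
qed

lemma e_cont: "continuous_on X e"
  using convex_imp_continuous_on_X[OF e_convex e_nonneg] .

lemma h_cont: "continuous_on X h"
  using convex_imp_continuous_on_X[OF h_convex h_nonneg] .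

lemma h_large: "\<exists>b. \<forall>x\<in>X. b \<le> \<bar>x\<bar> \<longrightarrow> c \<le> h x"
proof -
  have "eventually (\<lambda>x. x \<in> X \<longrightarrow> c \<le> h x) at_infinity"
    using h_at_top unfolding filterlim_at_top eventually_inf_principal by blast
  then show ?thesis unfolding eventually_at_infinity by auto
qed

text \<open>With probability above one half the demand stays below a fixed bound, and then \<open>h\<close> is large.\<close>

lemma e_coercive: "\<exists>b. \<forall>y\<in>X. b \<le> y \<longrightarrow> c < e y"
proof -
  have "(\<lambda>n. measure P {\<omega> \<in> space P. dem \<omega> \<le> real n}) \<longlonglongrightarrow> measure P (\<Union>n. {\<omega> \<in> space P. dem \<omega> \<le> real n})"
    by (rule finite_Lim_measure_incseq) (auto simp: incseq_def intro: order_trans)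
  moreover have "(\<Union>n. {\<omega> \<in> space P. dem \<omega> \<le> real n}) = space P"
    using real_arch_simple by auto
  ultimately have "(\<lambda>n. measure P {\<omega> \<in> space P. dem \<omega> \<le> real n}) \<longlonglongrightarrow> 1"
    by (simp add: prob_space)
  then have "eventually (\<lambda>n. 1 / 2 < measure P {\<omega> \<in> space P. dem \<omega> \<le> real n}) sequentially"
    by (rule order_tendstoD) simp
  then obtain n where n: "1 / 2 < measure P {\<omega> \<in> space P. dem \<omega> \<le> real n}"
    by (auto simp: eventually_sequentially)
  obtain b where b: "\<And>x. x \<in> X \<Longrightarrow> b \<le> \<bar>x\<bar> \<Longrightarrow> 2 * (\<bar>c\<bar> + 1) \<le> h x" using h_large by blast
  have "c < e y" if y: "y \<in> X" "\<bar>b\<bar> + real n \<le> y" for y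
  proof -
    let ?A = "{\<omega> \<in> space P. dem \<omega> \<le> real n}"
    have "2 * (\<bar>c\<bar> + 1) * measure P ?A = (\<integral>\<omega>. 2 * (\<bar>c\<bar> + 1) * indicator ?A \<omega> \<partial>P)"
      by simp
    also have "\<dots> \<le> e y"
      unfolding e_def
    proof (rule integral_mono)
      fix \<omega> assume \<omega>: "\<omega> \<in> space P"
      show "2 * (\<bar>c\<bar> + 1) * indicator ?A \<omega> \<le> h (y - dem \<omega>)"
        using b[OF shift_X[OF y(1) \<omega>]] h_nonneg[OF shift_X[OF y(1) \<omega>]] y \<omega>
        by (auto simp: indicator_def)
    next
      have "?A \<in> sets P" by measurable
      then show "integrable P (\<lambda>\<omega>. 2 * (\<bar>c\<bar> + 1) * indicator ?A \<omega>)"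
        by (intro integrable_mult_right) (auto simp: emeasure_eq_measure)
    next
      show "integrable P (\<lambda>\<omega>. h (y - dem \<omega>))" by (rule integrable_h[OF y(1)])
    qed
    finally have "2 * (\<bar>c\<bar> + 1) * measure P ?A \<le> e y" .
    moreover have "2 * (\<bar>c\<bar> + 1) * (1 / 2) < 2 * (\<bar>c\<bar> + 1) * measure P ?A"
      using n by (intro mult_strict_left_mono) auto
    ultimately show ?thesis by simp
  qed
  then show ?thesis by blast
qed

text \<open>
  As \<open>h\<close> is convex and unbounded on the left, it grows at least linearly there. Hence a finite
  expectation of \<open>h (- dem)\<close> makes the demand integrable.
\<close>

lemma integrable_dem: "integrable P dem"
proof -
  obtain b where b: "\<And>x. x \<in> X \<Longrightarrow> b \<le> \<bar>x\<bar> \<Longrightarrow> 1 \<le> h x" using h_large by blast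
  define x0 where "x0 = real_of_int (- \<lceil>\<bar>b\<bar> + 1\<rceil>)"
  have x0: "x0 \<in> X" "x0 < 0" "1 \<le> h x0"
  proof -
    show "x0 \<in> X" unfolding x0_def by (rule X_int)
    have "\<bar>b\<bar> + 1 \<le> - x0" unfolding x0_def by simp
    then show "x0 < 0" "1 \<le> h x0" using b[OF \<open>x0 \<in> X\<close>] by auto
  qed
  have bound: "dem \<omega> \<le> - x0 + (- x0) * h (0 - dem \<omega>)" if \<omega>: "\<omega> \<in> space P" for \<omega>
  proof (cases "- dem \<omega> \<le> x0")
    case True
    have "(0 - (- dem \<omega>)) * h x0 \<le> (0 - x0) * h (- dem \<omega>) + (x0 - (- dem \<omega>)) * (h 0 + 0)"
      using K_convex_onD[OF order_refl h_convex X_minus[OF dem_X[OF \<omega>]] x0(1) X_0 True] x0 by simp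
    then have "dem \<omega> * h x0 \<le> (- x0) * h (- dem \<omega>)" by (simp add: h_zero)
    moreover have "dem \<omega> * 1 \<le> dem \<omega> * h x0" using dem_nonneg[OF \<omega>] x0 by (intro mult_left_mono)
    ultimately show ?thesis using x0 by simp
  next
    case False
    moreover have "0 \<le> (- x0) * h (0 - dem \<omega>)" using x0 h_nonneg[OF shift_X[OF X_0 \<omega>]] by (intro mult_nonneg_nonneg) auto
    ultimately show ?thesis by linarith
  qed
  show ?thesis
  proof (rule Bochner_Integration.integrable_bound)
    show "integrable P (\<lambda>\<omega>. - x0 + (- x0) * h (0 - dem \<omega>))"
      using integrable_h[OF X_0] by auto
    show "AE \<omega> in P. norm (dem \<omega>) \<le> norm (- x0 + (- x0) * h (0 - dem \<omega>))"
      using bound dem_nonneg by (intro AE_I2) force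
  qed simp
qed

definition mean :: real where "mean = (\<integral>\<omega>. dem \<omega> \<partial>P)"

lemma mean_nonneg: "0 \<le> mean"
  unfolding mean_def by (intro integral_nonneg_AE AE_I2 dem_nonneg)

definition lap :: real where "lap = (\<integral>\<omega>. exp (- dem \<omega>) \<partial>P)"

lemma integrable_exp: "integrable P (\<lambda>\<omega>. exp (- dem \<omega>))"
  by (rule integrable_const_bound[of _ 1]) (use dem_nonneg in auto)

lemma lap_nonneg: "0 \<le> lap"
  unfolding lap_def by (rule integral_nonneg_AE) simp

text \<open>
  Demand is positive with positive probability, so the exponential of the stock level decreases
  strictly in expectation. This replaces estimates of the time until the stock falls below a level.
\<close>

lemma lap_less_1: "lap < 1"
proof -
  have "(\<integral>\<omega>. exp (- dem \<omega>) \<partial>P) < (\<integral>\<omega>. 1 \<partial>P)"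
  proof (rule integral_less_AE[where A = "{\<omega> \<in> space P. 0 < dem \<omega>}"])
    show "emeasure P {\<omega> \<in> space P. 0 < dem \<omega>} \<noteq> 0" using dem_pos by (simp add: emeasure_eq_measure)
    show "AE \<omega> in P. exp (- dem \<omega>) \<le> 1" using dem_nonneg by (intro AE_I2) simp
  qed (use integrable_exp in auto)
  then show ?thesis by (simp add: lap_def prob_space)
qed

abbreviation MM :: "(real, real) mdp" where "MM \<equiv> inventory_mdp P dem X K cbar h"

lemma MM_simps [simp]:
  "states MM = X" "actions MM = X \<inter> {0..}"
  "cost MM x a = (if a > 0 then K else 0) + cbar * a + e (x + a)"
  "kern MM x a = distr P (restrict_space borel X) (\<lambda>\<omega>. x + a - dem \<omega>)"
  by (simp_all add: inventory_mdp_def e_def)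

lemma state_space_MM: "state_space MM = restrict_space borel X"
  and action_space_MM: "action_space MM = restrict_space borel (X \<inter> {0..})"
  by (simp_all add: state_space_def action_space_def)

lemma kern_MM: "(\<lambda>(x, a). kern MM x a) \<in> sa_space MM \<rightarrow>\<^sub>M prob_algebra (state_space MM)"
  using kern_measurable unfolding dem_eq[symmetric] .

lemma measurable_continuous_on_X:
  "continuous_on X f \<Longrightarrow> f \<in> borel_measurable (state_space MM)"
  unfolding state_space_MM by (rule borel_measurable_continuous_on_restrict)

lemma level_measurable: "(\<lambda>z. fst z + snd z) \<in> sa_space MM \<rightarrow>\<^sub>M state_space MM"
proof -
  have 1: "(\<lambda>z. fst z) \<in> borel_measurable (sa_space MM)"
    unfolding sa_space_def state_space_MM action_space_MM
    by (rule measurable_compose[OF measurable_fst]) (simp add: measurable_restrict_space1)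
  have 2: "(\<lambda>z. snd z) \<in> borel_measurable (sa_space MM)"
    unfolding sa_space_def state_space_MM action_space_MM
    by (rule measurable_compose[OF measurable_snd]) (simp add: measurable_restrict_space1)
  show ?thesis
    unfolding state_space_MM
  proof (rule measurable_restrict_space2)
    show "(\<lambda>z. fst z + snd z) \<in> space (sa_space MM) \<rightarrow> X"
      using X_add by (auto simp: sa_space_def state_space_MM action_space_MM space_pair_measure space_restrict_space)
  qed (use 1 2 in measurable)
qed

lemma cost_measurable: "(\<lambda>z. cost MM (fst z) (snd z)) \<in> borel_measurable (sa_space MM)"
proof -
  have 2 [measurable]: "(\<lambda>z. snd z) \<in> borel_measurable (sa_space MM)"
    unfolding sa_space_def state_space_MM action_space_MM
    by (rule measurable_compose[OF measurable_snd]) (simp add: measurable_restrict_space1)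
  have [measurable]: "(\<lambda>z. e (fst z + snd z)) \<in> borel_measurable (sa_space MM)"
    using measurable_compose[OF level_measurable measurable_continuous_on_X[OF e_cont]] .
  show ?thesis unfolding MM_simps by measurable
qed

lemma cost_nonneg: "x \<in> X \<Longrightarrow> a \<in> X \<Longrightarrow> 0 \<le> a \<Longrightarrow> 0 \<le> cost MM x a"
  using K_nonneg cbar_pos e_nonneg[OF X_add] by simp

lemma shift_measurable:
  "x \<in> X \<Longrightarrow> (\<lambda>\<omega>. x - dem \<omega>) \<in> P \<rightarrow>\<^sub>M state_space MM"
  unfolding state_space_MM by (rule measurable_restrict_space2) (use shift_X in auto)

lemma nn_integral_kern:
  assumes "x \<in> X" "a \<in> X" "g \<in> borel_measurable (state_space MM)"
  shows "(\<integral>\<^sup>+y. g y \<partial>kern MM x a) = (\<integral>\<^sup>+\<omega>. g (x + a - dem \<omega>) \<partial>P)"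
  unfolding MM_simps state_space_MM[symmetric]
  by (rule nn_integral_distr[OF shift_measurable[OF X_add[OF assms(1,2)]]]) (use assms(3) in simp)

lemma borel_measurable_shift:
  "continuous_on X f \<Longrightarrow> x \<in> X \<Longrightarrow> (\<lambda>\<omega>. f (x - dem \<omega>)) \<in> borel_measurable P"
  using measurable_compose[OF shift_measurable measurable_continuous_on_X] .

lemma nn_integral_kern_h:
  assumes "x \<in> X" "a \<in> X"
  shows "(\<integral>\<^sup>+y. ennreal (h y) \<partial>kern MM x a) = ennreal (e (x + a))"
proof -
  have "(\<integral>\<^sup>+y. ennreal (h y) \<partial>kern MM x a) = (\<integral>\<^sup>+\<omega>. ennreal (h (x + a - dem \<omega>)) \<partial>P)"
    using measurable_continuous_on_X[OF h_cont] assms by (intro nn_integral_kern) auto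
  also have "\<dots> = ennreal (e (x + a))"
    unfolding e_def using integrable_h[OF X_add[OF assms]] h_nonneg[OF shift_X[OF X_add[OF assms]]]
    by (intro nn_integral_eq_integral AE_I2) auto
  finally show ?thesis .
qed

text \<open>
  Lower semicontinuity of the setup cost at the action \<open>0\<close> is the only delicate point of
  inf-compactness; boundedness of the sublevel sets comes from \<open>cbar > 0\<close>. The transition law is
  weakly continuous by dominated convergence.
\<close>

lemma assumption_W_MM: "assumption_W MM"
  unfolding assumption_W_def
proof (intro conjI)
  show "\<exists>b. \<forall>x\<in>states MM. \<forall>a\<in>actions MM. b \<le> cost MM x a"
    using cost_nonneg by (intro exI[of _ 0]) auto
  show "KK_inf_compact_on (states MM) (actions MM) (cost MM)"
    unfolding KK_inf_compact_on_def inf_compact_on_def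
  proof (intro allI impI, elim conjE)
    fix C l assume C: "C \<noteq> {}" "C \<subseteq> states MM" "compact C"
    have CX: "C \<subseteq> X" using C(2) by simp
    define c where "c x a = (if a > 0 then K else 0) + cbar * a + e (x + a)" for x a :: real
    define T where "T = {u \<in> C \<times> (X \<inter> {0..}). c (fst u) (snd u) \<le> l}"
    have "T \<subseteq> C \<times> {0..l / cbar}"
    proof
      fix u assume u: "u \<in> T"
      have "0 \<le> e (fst u + snd u)" using u CX by (intro e_nonneg X_add) (auto simp: T_def)
      then have "cbar * snd u \<le> c (fst u) (snd u)" using K_nonneg by (simp add: c_def)
      then have "cbar * snd u \<le> l" using u by (simp add: T_def)
      then have "snd u \<le> l / cbar" using cbar_pos by (simp add: field_simps)
      then show "u \<in> C \<times> {0..l / cbar}" using u by (auto simp: T_def)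
    qed
    then have "bounded T"
      by (rule bounded_subset[rotated]) (intro bounded_Times compact_imp_bounded C(3) compact_Icc)
    moreover have "closed T"
      unfolding closed_sequential_limits
    proof (intro allI impI, elim conjE)
      fix u l' assume u: "\<forall>n. u n \<in> T" and lim: "u \<longlonglongrightarrow> l'"
      obtain x a where l': "l' = (x, a)" by (cases l')
      have lx: "(\<lambda>n. fst (u n)) \<longlonglongrightarrow> x" using tendsto_fst[OF lim] unfolding l' fst_conv .
      have la: "(\<lambda>n. snd (u n)) \<longlonglongrightarrow> a" using tendsto_snd[OF lim] unfolding l' snd_conv .
      have ux: "fst (u n) \<in> C" "snd (u n) \<in> X" "0 \<le> snd (u n)" "c (fst (u n)) (snd (u n)) \<le> l" for n
        using u[rule_format, of n] by (auto simp: T_def)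
      have xC: "x \<in> C" using closed_sequentially[OF compact_imp_closed[OF C(3)] ux(1) lx] .
      have aX: "a \<in> X" using X_limit[OF ux(2) la] .
      have a0: "0 \<le> a" by (rule LIMSEQ_le_const[OF la]) (use ux(3) in blast)
      have "\<forall>n. fst (u n) + snd (u n) \<in> X" using X_add ux(1,2) CX by blast
      moreover have "x + a \<in> X" using X_add xC aX CX by blast
      ultimately have le: "(\<lambda>n. e (fst (u n) + snd (u n))) \<longlonglongrightarrow> e (x + a)"
        using e_cont[unfolded continuous_on_sequentially, rule_format, of "x + a" "\<lambda>n. fst (u n) + snd (u n)"]
          tendsto_add[OF lx la] unfolding comp_def by blast
      have "c x a \<le> l"
      proof (cases "0 < a")
        case True
        have "(\<lambda>n. K + cbar * snd (u n) + e (fst (u n) + snd (u n))) \<longlonglongrightarrow> K + cbar * a + e (x + a)"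
          by (intro tendsto_intros la le)
        moreover have "eventually (\<lambda>n. K + cbar * snd (u n) + e (fst (u n) + snd (u n)) \<le> l) sequentially"
          using order_tendstoD(1)[OF la True]
        proof eventually_elim
          case (elim n)
          then show ?case using ux(4)[of n] by (simp add: c_def)
        qed
        ultimately have "K + cbar * a + e (x + a) \<le> l" by (rule tendsto_upperbound) simp
        then show ?thesis using True by (simp add: c_def)
      next
        case False
        have "(\<lambda>n. cbar * snd (u n) + e (fst (u n) + snd (u n))) \<longlonglongrightarrow> cbar * a + e (x + a)"
          by (intro tendsto_intros la le)
        moreover have "cbar * snd (u n) + e (fst (u n) + snd (u n)) \<le> l" for n
          using ux(4)[of n] K_nonneg by (simp add: c_def split: if_splits)
        ultimately have "cbar * a + e (x + a) \<le> l" by (intro LIMSEQ_le_const2) auto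
        then show ?thesis using False by (simp add: c_def)
      qed
      then show "l' \<in> T" using xC aX a0 by (simp add: l' T_def)
    qed
    ultimately have "compact T" by (simp add: compact_eq_bounded_closed)
    moreover have "{u \<in> C \<times> actions MM. (case u of (x, a) \<Rightarrow> cost MM x a) \<le> l} = T"
      by (auto simp: T_def c_def)
    ultimately show "compact {u \<in> C \<times> actions MM. (case u of (x, a) \<Rightarrow> cost MM x a) \<le> l}" by simp
  qed
  show "\<forall>f::real \<Rightarrow> real. bounded (f ` states MM) \<and> continuous_on (states MM) f \<longrightarrow>
      continuous_on (states MM \<times> actions MM) (\<lambda>(x, a). \<integral>y. f y \<partial>kern MM x a)"
  proof (intro allI impI, elim conjE)
    fix f :: "real \<Rightarrow> real" assume "bounded (f ` states MM)" "continuous_on (states MM) f"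
    then have f: "bounded (f ` X)" "continuous_on X f" by simp_all
    obtain B where B: "\<And>x. x \<in> X \<Longrightarrow> \<bar>f x\<bar> \<le> B" using f(1) unfolding bounded_iff by auto
    have int: "(\<integral>y. f y \<partial>kern MM x a) = (\<integral>\<omega>. f (x + a - dem \<omega>) \<partial>P)" if "x \<in> X" "a \<in> X" for x a
      unfolding MM_simps state_space_MM[symmetric]
      using shift_measurable[OF X_add[OF that]] measurable_continuous_on_X[OF f(2)] by (rule integral_distr)
    show "continuous_on (states MM \<times> actions MM) (\<lambda>(x, a). \<integral>y. f y \<partial>kern MM x a)"
      unfolding continuous_on_sequentially
    proof (intro allI ballI impI, elim conjE)
      fix u l' assume l'X: "l' \<in> states MM \<times> actions MM" and uX: "\<forall>n. u n \<in> states MM \<times> actions MM"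
        and lim: "u \<longlonglongrightarrow> l'"
      obtain x a where l': "l' = (x, a)" by (cases l')
      have xa: "x \<in> X" "a \<in> X" using l'X l' by auto
      have ux: "fst (u n) \<in> X" "snd (u n) \<in> X" for n using uX[rule_format, of n] by auto
      have lx: "(\<lambda>n. fst (u n) + snd (u n)) \<longlonglongrightarrow> x + a"
        using tendsto_add[OF tendsto_fst[OF lim] tendsto_snd[OF lim]] by (simp add: l')
      have "(\<lambda>n. \<integral>\<omega>. f (fst (u n) + snd (u n) - dem \<omega>) \<partial>P) \<longlonglongrightarrow> (\<integral>\<omega>. f (x + a - dem \<omega>) \<partial>P)"
      proof (rule integral_dominated_convergence[where w = "\<lambda>_. B"])
        show "AE \<omega> in P. (\<lambda>n. f (fst (u n) + snd (u n) - dem \<omega>)) \<longlonglongrightarrow> f (x + a - dem \<omega>)"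
        proof (rule AE_I2)
          fix \<omega> assume \<omega>: "\<omega> \<in> space P"
          have "(\<lambda>n. fst (u n) + snd (u n) - dem \<omega>) \<longlonglongrightarrow> x + a - dem \<omega>"
            by (intro tendsto_intros lx)
          then show "(\<lambda>n. f (fst (u n) + snd (u n) - dem \<omega>)) \<longlonglongrightarrow> f (x + a - dem \<omega>)"
            using f(2)[unfolded continuous_on_sequentially, rule_format, of "x + a - dem \<omega>" "\<lambda>n. fst (u n) + snd (u n) - dem \<omega>"]
              shift_X[OF X_add[OF xa] \<omega>] shift_X[OF X_add[OF ux] \<omega>] by (auto simp: comp_def)
        qed
        show "AE \<omega> in P. norm (f (fst (u n) + snd (u n) - dem \<omega>)) \<le> B" for n
          using B shift_X[OF X_add[OF ux]] by (intro AE_I2) simp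
      qed (use borel_measurable_shift[OF f(2)] X_add[OF ux] X_add[OF xa] in auto)
      then show "((\<lambda>(x, a). \<integral>y. f y \<partial>kern MM x a) \<circ> u) \<longlonglongrightarrow> (\<lambda>(x, a). \<integral>y. f y \<partial>kern MM x a) l'"
        unfolding comp_def case_prod_beta l' fst_conv snd_conv
        using int[OF xa] int[OF ux] by simp
    qed
  qed
qed

end

section \<open>The optimality operator and its invariant class of functions\<close>

text \<open>
  The state \<open>z0\<close> and the slope \<open>\<kappa>\<close> express that \<open>a0\<close> exceeds the critical discount factor; see
  \<open>inventory_low_exists\<close>.
\<close>

locale inventory_low = inventory_demand +
  fixes a0 z0 \<kappa> :: real
  assumes a0: "0 \<le> a0" "a0 < 1" and z0: "z0 \<in> X"
    and \<kappa>: "(1 - a0) * cbar < \<kappa>"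
    and h_low: "\<And>x y. x \<in> X \<Longrightarrow> y \<in> X \<Longrightarrow> x \<le> y \<Longrightarrow> y \<le> z0 \<Longrightarrow> \<kappa> * (y - x) \<le> h x - h y"
begin

lemma \<kappa>_pos: "0 < \<kappa>"
proof -
  have "0 < (1 - a0) * cbar" using a0 cbar_pos by simp
  then show ?thesis using \<kappa> by simp
qed

definition \<eta> :: real where "\<eta> = \<kappa> - (1 - a0) * cbar"

lemma \<eta>_pos: "0 < \<eta>"
  using \<kappa> by (simp add: \<eta>_def)

text \<open>
  A common lower bound for all reorder levels, by \<open>sS_optimal_range\<close>; it is rounded down to lie in
  \<open>X\<close>.
\<close>

definition L :: real where "L = real_of_int \<lfloor>z0 - K / \<eta>\<rfloor>"

lemma L_X: "L \<in> X" and L_le: "L \<le> z0 - K / \<eta>"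
  unfolding L_def using X_int by auto

text \<open>
  A Lyapunov function for the stock without orders: one period of demand decreases it in expectation
  by at least one, as long as the stock is above \<open>L\<close> (\<open>lyap_drift\<close>).
\<close>

definition lyap :: "real \<Rightarrow> real" where "lyap y = exp (y - L) / (1 - lap)"

lemma lyap_pos: "0 < lyap y"
  using lap_less_1 by (simp add: lyap_def)

lemma lyap_mono: "x \<le> y \<Longrightarrow> lyap x \<le> lyap y"
  using lap_less_1 by (simp add: lyap_def divide_right_mono)

lemma lyap_shift: "lyap (y - d) = lyap y * exp (- d)"
proof -
  have "exp (y - d - L) = exp (y - L) * exp (- d)" by (simp flip: exp_add)
  then show ?thesis by (simp add: lyap_def)
qed

lemma integrable_lyap: "integrable P (\<lambda>\<omega>. lyap (y - dem \<omega>))"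
  unfolding lyap_shift using integrable_exp by simp

lemma integral_lyap: "(\<integral>\<omega>. lyap (y - dem \<omega>) \<partial>P) = lap * lyap y"
  unfolding lyap_shift lap_def by simp

lemma lyap_drift: "L \<le> y \<Longrightarrow> 1 + lap * lyap y \<le> lyap y"
proof -
  assume "L \<le> y"
  then have "1 \<le> exp (y - L)" by simp
  also have "exp (y - L) = (1 - lap) * lyap y" using lap_less_1 by (simp add: lyap_def)
  finally show ?thesis by (simp add: algebra_simps)
qed

text \<open>
  A Lipschitz constant of \<open>e\<close> on \<open>[L - 1, b]\<close>. One unit below \<open>L\<close> is included because the smaller
  of two states at distance at most one may already lie below the reorder level of the other.
\<close>

definition slope :: "real \<Rightarrow> real" where "slope b = e (L - 2) + e (b + 1)"

lemma slope_nonneg: "b \<in> X \<Longrightarrow> 0 \<le> slope b"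
  unfolding slope_def using e_nonneg[of "L - 2"] e_nonneg[of "b + 1"] X_add[OF _ X_1, of b] X_diff[OF L_X X_int[of 2]]
  by simp

lemma e_Lipschitz:
  assumes "x \<in> X" "y \<in> X" "b \<in> X" "L - 1 \<le> x" "x \<le> y" "y \<le> b"
  shows "\<bar>e y - e x\<bar> \<le> (y - x) * slope b"
proof -
  have "\<bar>e y - e x\<bar> \<le> (y - x) * (e (L - 1 - 1) + e (b + 1))"
    using assms X_diff[OF L_X X_1] by (intro convex_on_X_Lipschitz[OF e_convex e_nonneg]) auto
  then show ?thesis by (simp add: slope_def)
qed

text \<open>
  The last condition bounds the cost difference of two nearby starting states by \<open>cbar\<close> for the order
  that merges them and \<open>slope b\<close> for each of the at most \<open>lyap y\<close> expected periods before. The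
  bound \<open>b\<close> is kept apart from \<open>y\<close> so that it does not change when the stock falls.
\<close>

definition regular :: "(real \<Rightarrow> real) \<Rightarrow> bool" where
  "regular f \<longleftrightarrow>
    (\<forall>x\<in>X. 0 \<le> f x) \<and> K_convex_on X K f \<and>
    (\<forall>x\<in>X. \<forall>y\<in>X. x \<le> y \<longrightarrow> f x \<le> f y + K + cbar * (y - x)) \<and>
    (\<forall>x\<in>X. \<forall>y\<in>X. x \<le> y \<and> y \<le> z0 \<longrightarrow> cbar * (y - x) \<le> f x - f y) \<and>
    (\<forall>b\<in>X. \<forall>x\<in>X. \<forall>y\<in>X. x \<le> y \<and> y \<le> b \<and> y \<le> x + 1 \<longrightarrow>
       \<bar>f y - f x\<bar> \<le> (y - x) * (cbar + slope b * lyap y))"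

lemma regularD:
  assumes "regular f"
  shows regular_nonneg: "x \<in> X \<Longrightarrow> 0 \<le> f x"
    and regular_convex: "K_convex_on X K f"
    and regular_order: "x \<in> X \<Longrightarrow> y \<in> X \<Longrightarrow> x \<le> y \<Longrightarrow> f x \<le> f y + K + cbar * (y - x)"
    and regular_low: "x \<in> X \<Longrightarrow> y \<in> X \<Longrightarrow> x \<le> y \<Longrightarrow> y \<le> z0 \<Longrightarrow> cbar * (y - x) \<le> f x - f y"
    and regular_step: "b \<in> X \<Longrightarrow> x \<in> X \<Longrightarrow> y \<in> X \<Longrightarrow> x \<le> y \<Longrightarrow> y \<le> b \<Longrightarrow> y \<le> x + 1 \<Longrightarrow>
       \<bar>f y - f x\<bar> \<le> (y - x) * (cbar + slope b * lyap y)"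
  using assms unfolding regular_def by blast+

definition lip :: "real \<Rightarrow> real" where "lip b = cbar + slope b * lyap b"

lemma lip_nonneg: "b \<in> X \<Longrightarrow> 0 \<le> lip b"
  unfolding lip_def using cbar_pos slope_nonneg[of b] lyap_pos[of b] by simp

lemma regular_Lipschitz_1:
  assumes f: "regular f" and X: "x \<in> X" "y \<in> X" "b \<in> X" and o: "x \<le> y" "y \<le> b" "y \<le> x + 1"
  shows "\<bar>f y - f x\<bar> \<le> (y - x) * lip b"
proof -
  have "\<bar>f y - f x\<bar> \<le> (y - x) * (cbar + slope b * lyap y)" using regular_step[OF f X(3,1,2) o] .
  also have "\<dots> \<le> (y - x) * lip b"
    unfolding lip_def using slope_nonneg[OF X(3)] lyap_mono[OF o(2)] o
    by (intro mult_left_mono add_left_mono) auto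
  finally show ?thesis .
qed

text \<open>Chaining unit steps removes the restriction on the distance.\<close>

lemma regular_Lipschitz:
  assumes f: "regular f" and X: "x \<in> X" "y \<in> X" "b \<in> X" and o: "x \<le> y" "y \<le> b"
  shows "\<bar>f y - f x\<bar> \<le> (y - x) * lip b"
proof -
  have "\<bar>f y - f x\<bar> \<le> (y - x) * lip b" if "y - x \<le> real n" "x \<in> X" "x \<le> y" for n x
    using that
  proof (induction n arbitrary: x)
    case 0
    then show ?case by simp
  next
    case (Suc n)
    show ?case
    proof (cases "y \<le> x + 1")
      case True
      then show ?thesis using regular_Lipschitz_1[OF f Suc.prems(2) X(2,3) Suc.prems(3) o(2)] by simp
    next
      case False
      have x1: "x + 1 \<in> X" using X_add[OF Suc.prems(2) X_1] .
      have "\<bar>f y - f (x + 1)\<bar> \<le> (y - (x + 1)) * lip b" using Suc.prems False x1 by (intro Suc.IH) auto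
      moreover have "\<bar>f (x + 1) - f x\<bar> \<le> (x + 1 - x) * lip b"
        using False o by (intro regular_Lipschitz_1[OF f Suc.prems(2) x1 X(3)]) auto
      ultimately show ?thesis by (simp add: algebra_simps)
    qed
  qed
  moreover obtain n where "y - x \<le> real n" using real_arch_simple by blast
  ultimately show ?thesis using X o by blast
qed

lemma regular_continuous:
  assumes f: "regular f"
  shows "continuous_on X f"
proof (rule locally_Lipschitz_continuous_on)
  fix y assume y: "y \<in> X"
  have y1: "y + 1 \<in> X" using X_add[OF y X_1] .
  have "\<bar>f z - f y\<bar> \<le> lip (y + 1) * \<bar>z - y\<bar>" if "z \<in> X" "\<bar>z - y\<bar> \<le> 1" for z
  proof (cases "z \<le> y")
    case True
    then show ?thesis
      using regular_Lipschitz[OF f that(1) y y1] by (simp add: abs_minus_commute mult.commute)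
  next
    case False
    then show ?thesis
      using regular_Lipschitz[OF f y that(1) y1] that by (simp add: mult.commute)
  qed
  then show "\<exists>C. \<forall>z\<in>X. \<bar>z - y\<bar> \<le> 1 \<longrightarrow> \<bar>f z - f y\<bar> \<le> C * \<bar>z - y\<bar>" by blast
qed

definition Ef :: "(real \<Rightarrow> real) \<Rightarrow> real \<Rightarrow> real" where
  "Ef f x = (\<integral>\<omega>. f (x - dem \<omega>) \<partial>P)"

lemma regular_shift_le:
  assumes "regular f" "x \<in> X" "\<omega> \<in> space P"
  shows "f (x - dem \<omega>) \<le> f x + K + cbar * dem \<omega>"
  using regular_order[OF assms(1) shift_X[OF assms(2,3)] assms(2)] dem_nonneg[OF assms(3)] by simp

lemma regular_integrable:
  assumes f: "regular f" and x: "x \<in> X"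
  shows "integrable P (\<lambda>\<omega>. f (x - dem \<omega>))"
proof (rule Bochner_Integration.integrable_bound)
  show "integrable P (\<lambda>\<omega>. f x + K + cbar * dem \<omega>)"
    using integrable_dem by auto
  show "(\<lambda>\<omega>. f (x - dem \<omega>)) \<in> borel_measurable P"
    using borel_measurable_shift[OF regular_continuous[OF f] x] .
  show "AE \<omega> in P. norm (f (x - dem \<omega>)) \<le> norm (f x + K + cbar * dem \<omega>)"
  proof (rule AE_I2)
    fix \<omega> assume \<omega>: "\<omega> \<in> space P"
    show "norm (f (x - dem \<omega>)) \<le> norm (f x + K + cbar * dem \<omega>)"
      using regular_shift_le[OF f x \<omega>] regular_nonneg[OF f shift_X[OF x \<omega>]] by simp
  qed
qed

lemma Ef_nonneg: "regular f \<Longrightarrow> x \<in> X \<Longrightarrow> 0 \<le> Ef f x"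
  unfolding Ef_def by (intro integral_nonneg_AE AE_I2 regular_nonneg shift_X)

lemma Ef_le:
  assumes f: "regular f" and x: "x \<in> X"
  shows "Ef f x \<le> f x + K + cbar * mean"
proof -
  have "Ef f x \<le> (\<integral>\<omega>. f x + K + cbar * dem \<omega> \<partial>P)"
    unfolding Ef_def using integrable_dem by (intro integral_mono regular_integrable f x regular_shift_le) auto
  also have "\<dots> = f x + K + cbar * mean" using integrable_dem by (simp add: mean_def prob_space)
  finally show ?thesis .
qed

lemma Ef_mono:
  assumes "regular f" "regular g" "x \<in> X" "\<And>y. y \<in> X \<Longrightarrow> f y \<le> g y"
  shows "Ef f x \<le> Ef g x"
  unfolding Ef_def using assms by (intro integral_mono regular_integrable) (auto intro: shift_X)

lemma Ef_order:
  assumes f: "regular f" and X: "x \<in> X" "y \<in> X" "x \<le> y"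
  shows "Ef f x \<le> Ef f y + K + cbar * (y - x)"
proof -
  have "Ef f x \<le> (\<integral>\<omega>. f (y - dem \<omega>) + (K + cbar * (y - x)) \<partial>P)"
    unfolding Ef_def
  proof (rule integral_mono)
    fix \<omega> assume \<omega>: "\<omega> \<in> space P"
    show "f (x - dem \<omega>) \<le> f (y - dem \<omega>) + (K + cbar * (y - x))"
      using regular_order[OF f shift_X[OF X(1) \<omega>] shift_X[OF X(2) \<omega>]] X by simp
  qed (use regular_integrable[OF f] X in auto)
  also have "\<dots> = Ef f y + K + cbar * (y - x)"
    using regular_integrable[OF f X(2)] by (simp add: Ef_def prob_space)
  finally show ?thesis .
qed

lemma Ef_low:
  assumes f: "regular f" and X: "x \<in> X" "y \<in> X" "x \<le> y" "y \<le> z0"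
  shows "cbar * (y - x) \<le> Ef f x - Ef f y"
proof -
  have "(\<integral>\<omega>. f (y - dem \<omega>) + cbar * (y - x) \<partial>P) \<le> Ef f x"
    unfolding Ef_def
  proof (rule integral_mono)
    fix \<omega> assume \<omega>: "\<omega> \<in> space P"
    show "f (y - dem \<omega>) + cbar * (y - x) \<le> f (x - dem \<omega>)"
      using regular_low[OF f shift_X[OF X(1) \<omega>] shift_X[OF X(2) \<omega>]] X dem_nonneg[OF \<omega>] by simp
  qed (use regular_integrable[OF f] X in auto)
  then show ?thesis
    using regular_integrable[OF f X(2)] by (simp add: Ef_def prob_space)
qed

lemma Ef_convex:
  assumes f: "regular f"
  shows "K_convex_on X K (Ef f)"
  unfolding K_convex_on_def
proof (intro ballI allI impI, elim conjE)
  fix x y l :: real assume X: "x \<in> X" "y \<in> X" and l: "x \<le> y" "0 < l" "l < 1" "(1 - l) * x + l * y \<in> X"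
  have "Ef f ((1 - l) * x + l * y) \<le> (\<integral>\<omega>. (1 - l) * f (x - dem \<omega>) + l * f (y - dem \<omega>) + l * K \<partial>P)"
    unfolding Ef_def
  proof (rule integral_mono)
    fix \<omega> assume \<omega>: "\<omega> \<in> space P"
    have eq: "(1 - l) * x + l * y - dem \<omega> = (1 - l) * (x - dem \<omega>) + l * (y - dem \<omega>)"
      by (simp add: algebra_simps)
    show "f ((1 - l) * x + l * y - dem \<omega>) \<le> (1 - l) * f (x - dem \<omega>) + l * f (y - dem \<omega>) + l * K"
      using regular_convex[OF f, unfolded K_convex_on_def, rule_format, of "x - dem \<omega>" "y - dem \<omega>" l]
        shift_X[OF X(1) \<omega>] shift_X[OF X(2) \<omega>] shift_X[OF l(4) \<omega>] l unfolding eq by auto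
  qed (use regular_integrable[OF f] X l in auto)
  also have "\<dots> = (1 - l) * Ef f x + l * Ef f y + l * K"
    unfolding Ef_def using regular_integrable[OF f X(1)] regular_integrable[OF f X(2)] by (simp add: prob_space)
  finally show "Ef f ((1 - l) * x + l * y) \<le> (1 - l) * Ef f x + l * Ef f y + l * K" .
qed

lemma Ef_step:
  assumes f: "regular f" and X: "b \<in> X" "x \<in> X" "y \<in> X" and o: "x \<le> y" "y \<le> b" "y \<le> x + 1"
  shows "\<bar>Ef f y - Ef f x\<bar> \<le> (y - x) * (cbar + slope b * (lap * lyap y))"
proof -
  have "\<bar>Ef f y - Ef f x\<bar> = \<bar>\<integral>\<omega>. f (y - dem \<omega>) - f (x - dem \<omega>) \<partial>P\<bar>"
    unfolding Ef_def using regular_integrable[OF f] X by simp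
  also have "\<dots> \<le> (\<integral>\<omega>. \<bar>f (y - dem \<omega>) - f (x - dem \<omega>)\<bar> \<partial>P)"
    by (rule integral_abs_bound)
  also have "\<dots> \<le> (\<integral>\<omega>. (y - x) * (cbar + slope b * lyap (y - dem \<omega>)) \<partial>P)"
  proof (rule integral_mono)
    fix \<omega> assume \<omega>: "\<omega> \<in> space P"
    show "\<bar>f (y - dem \<omega>) - f (x - dem \<omega>)\<bar> \<le> (y - x) * (cbar + slope b * lyap (y - dem \<omega>))"
      using regular_step[OF f X(1) shift_X[OF X(2) \<omega>] shift_X[OF X(3) \<omega>]] o dem_nonneg[OF \<omega>] by simp
  qed (use regular_integrable[OF f] integrable_lyap X in auto)
  also have "\<dots> = (y - x) * (cbar + slope b * (lap * lyap y))"
    using integrable_lyap by (simp add: integral_lyap prob_space)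
  finally show ?thesis .
qed

lemma Ef_Lipschitz:
  assumes f: "regular f" and X: "b \<in> X" "x \<in> X" "y \<in> X" and o: "x \<le> y" "y \<le> b" "y \<le> x + 1"
  shows "\<bar>Ef f y - Ef f x\<bar> \<le> (y - x) * lip b"
proof -
  have "lap * lyap y \<le> 1 * lyap b"
    using lap_less_1 lap_nonneg lyap_mono[OF o(2)] lyap_pos by (intro mult_mono) (auto intro: less_imp_le)
  then have "(y - x) * (cbar + slope b * (lap * lyap y)) \<le> (y - x) * lip b"
    unfolding lip_def using slope_nonneg[OF X(1)] o by (intro mult_left_mono add_left_mono) auto
  then show ?thesis using Ef_step[OF assms] by simp
qed

definition Gf :: "real \<Rightarrow> (real \<Rightarrow> real) \<Rightarrow> real \<Rightarrow> real" where
  "Gf \<alpha> f y = cbar * y + e y + \<alpha> * Ef f y"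

definition bellman :: "real \<Rightarrow> (real \<Rightarrow> real) \<Rightarrow> real \<Rightarrow> real" where
  "bellman \<alpha> f x = order_value X K (Gf \<alpha> f) x - cbar * x"

text \<open>
  Beyond this level the holding cost alone outweighs the gain from a higher state, whatever the
  discount factor; see \<open>Gf_high\<close>.
\<close>

definition B0 :: real where
  "B0 = (SOME b. \<forall>y\<in>X. b < y \<longrightarrow> e z0 + K < e y)"

lemma B0: "y \<in> X \<Longrightarrow> B0 < y \<Longrightarrow> e z0 + K < e y"
proof -
  have "\<exists>b. \<forall>y\<in>X. b < y \<longrightarrow> e z0 + K < e y"
    using e_coercive[of "e z0 + K"] less_imp_le by blast
  from someI_ex[OF this] show "y \<in> X \<Longrightarrow> B0 < y \<Longrightarrow> e z0 + K < e y" unfolding B0_def by blast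
qed

lemma e_low:
  assumes X: "x \<in> X" "y \<in> X" "x \<le> y" "y \<le> z0"
  shows "\<kappa> * (y - x) \<le> e x - e y"
proof -
  have "(\<integral>\<omega>. h (y - dem \<omega>) + \<kappa> * (y - x) \<partial>P) \<le> e x"
    unfolding e_def
  proof (rule integral_mono)
    fix \<omega> assume \<omega>: "\<omega> \<in> space P"
    show "h (y - dem \<omega>) + \<kappa> * (y - x) \<le> h (x - dem \<omega>)"
      using h_low[OF shift_X[OF X(1) \<omega>] shift_X[OF X(2) \<omega>]] X dem_nonneg[OF \<omega>] by simp
  qed (use integrable_h X in auto)
  then show ?thesis using integrable_h[OF X(2)] by (simp add: e_def prob_space)
qed

lemma Gf_high:
  assumes f: "regular f" and \<alpha>: "0 \<le> \<alpha>" "\<alpha> \<le> 1" and X: "x \<in> X" "y \<in> X" "x \<le> y"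
  shows "e y - e x - K \<le> Gf \<alpha> f y - Gf \<alpha> f x"
proof -
  have c: "0 \<le> K + cbar * (y - x)" using K_nonneg cbar_pos X by simp
  have "\<alpha> * (Ef f x - Ef f y) \<le> \<alpha> * (K + cbar * (y - x))"
    using Ef_order[OF f X] \<alpha> by (intro mult_left_mono) auto
  also have "\<dots> \<le> 1 * (K + cbar * (y - x))" using \<alpha> c by (intro mult_right_mono) auto
  finally show ?thesis by (simp add: Gf_def algebra_simps)
qed

lemma Gf_Lipschitz:
  assumes f: "regular f" and \<alpha>: "0 \<le> \<alpha>" "\<alpha> \<le> 1" and X: "y \<in> X" "z \<in> X" "\<bar>z - y\<bar> \<le> 1"
  shows "\<bar>Gf \<alpha> f z - Gf \<alpha> f y\<bar> \<le> (cbar + (e (y - 2) + e (y + 2)) + lip (y + 1)) * \<bar>z - y\<bar>"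
proof -
  have *: "\<bar>Gf \<alpha> f v - Gf \<alpha> f u\<bar> \<le> (cbar + (e (y - 2) + e (y + 2)) + lip (y + 1)) * (v - u)"
    if uv: "u \<in> X" "v \<in> X" "u \<le> v" "v \<le> u + 1" "y - 1 \<le> u" "v \<le> y + 1" for u v
  proof -
    have y': "y - 1 \<in> X" "y + 1 \<in> X" using X_add[OF X(1) X_1] X_diff[OF X(1) X_1] by auto
    have 1: "\<bar>e v - e u\<bar> \<le> (v - u) * (e (y - 1 - 1) + e (y + 1 + 1))"
      using convex_on_X_Lipschitz[OF e_convex e_nonneg y' uv(1,2,5,3,6)] by simp
    have 2: "\<bar>Ef f v - Ef f u\<bar> \<le> (v - u) * lip (y + 1)"
      using Ef_Lipschitz[OF f y'(2) uv(1,2,3,6,4)] .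
    have "\<bar>\<alpha> * (Ef f v - Ef f u)\<bar> \<le> 1 * \<bar>Ef f v - Ef f u\<bar>"
      unfolding abs_mult using \<alpha> by (intro mult_right_mono) auto
    moreover have "\<bar>Gf \<alpha> f v - Gf \<alpha> f u\<bar> \<le> \<bar>cbar * (v - u)\<bar> + \<bar>e v - e u\<bar> + \<bar>\<alpha> * (Ef f v - Ef f u)\<bar>"
    proof -
      have "Gf \<alpha> f v - Gf \<alpha> f u = cbar * (v - u) + (e v - e u) + \<alpha> * (Ef f v - Ef f u)"
        by (simp add: Gf_def algebra_simps)
      then show ?thesis
        using abs_triangle_ineq[of "cbar * (v - u) + (e v - e u)" "\<alpha> * (Ef f v - Ef f u)"]
          abs_triangle_ineq[of "cbar * (v - u)" "e v - e u"] by linarith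
    qed
    moreover have "\<bar>cbar * (v - u)\<bar> = cbar * (v - u)" using cbar_pos uv by simp
    ultimately have "\<bar>Gf \<alpha> f v - Gf \<alpha> f u\<bar> \<le> cbar * (v - u) + (v - u) * (e (y - 1 - 1) + e (y + 1 + 1)) + (v - u) * lip (y + 1)"
      using 1 2 by linarith
    then show ?thesis by (simp add: algebra_simps)
  qed
  show ?thesis
  proof (cases "z \<le> y")
    case True
    then show ?thesis using *[of z y] X by (simp add: abs_minus_commute)
  next
    case False
    then show ?thesis using *[of y z] X by simp
  qed
qed

text \<open>
  On the left, raising the level by one unit costs \<open>cbar\<close> and saves at least \<open>\<kappa>\<close> of holding cost
  and \<open>\<alpha> cbar\<close> of later ordering cost; the net saving is at least \<open>\<eta>\<close> because \<open>\<alpha> \<ge> a0\<close>.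
\<close>

lemma Gf_problem:
  assumes f: "regular f" and \<alpha>: "a0 \<le> \<alpha>" "\<alpha> \<le> 1"
  shows "setup_cost_problem X K z0 B0 \<eta> (Gf \<alpha> f)"
proof unfold_locales
  have \<alpha>0: "0 \<le> \<alpha>" using a0 \<alpha> by simp
  show "K_convex_on X K (Gf \<alpha> f)"
    unfolding K_convex_on_def
  proof (intro ballI allI impI, elim conjE)
    fix x y l :: real assume X: "x \<in> X" "y \<in> X" and l: "x \<le> y" "0 < l" "l < 1" "(1 - l) * x + l * y \<in> X"
    let ?z = "(1 - l) * x + l * y"
    have 1: "e ?z \<le> (1 - l) * e x + l * e y + l * 0"
      using e_convex X l unfolding K_convex_on_def by blast
    have "Ef f ?z \<le> (1 - l) * Ef f x + l * Ef f y + l * K"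
      using Ef_convex[OF f] X l unfolding K_convex_on_def by blast
    then have "\<alpha> * Ef f ?z \<le> \<alpha> * ((1 - l) * Ef f x + l * Ef f y + l * K)"
      using \<alpha>0 by (rule mult_left_mono)
    moreover have "\<alpha> * (l * K) \<le> 1 * (l * K)"
      using \<alpha> l K_nonneg by (intro mult_right_mono) auto
    ultimately show "Gf \<alpha> f ?z \<le> (1 - l) * Gf \<alpha> f x + l * Gf \<alpha> f y + l * K"
      using 1 by (simp add: Gf_def algebra_simps)
  qed
  show "continuous_on X (Gf \<alpha> f)"
    by (rule locally_Lipschitz_continuous_on) (use Gf_Lipschitz[OF f \<alpha>0 \<alpha>(2)] in blast)
  show "\<eta> * (y - x) \<le> Gf \<alpha> f x - Gf \<alpha> f y" if X: "x \<in> X" "y \<in> X" "x \<le> y" "y \<le> z0" for x y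
  proof -
    have "a0 * (cbar * (y - x)) \<le> \<alpha> * (Ef f x - Ef f y)"
      using \<alpha> a0 Ef_low[OF f X] cbar_pos X by (intro mult_mono) auto
    then show ?thesis using e_low[OF X] by (simp add: Gf_def \<eta>_def algebra_simps)
  qed
  show "Gf \<alpha> f z0 < Gf \<alpha> f y" if y: "y \<in> X" "B0 < y" for y
  proof -
    have "e z0 < e y" "e z0 + K < e y" using B0[OF y] K_nonneg by auto
    moreover have "z0 \<le> y"
    proof (rule ccontr)
      assume "\<not> z0 \<le> y"
      then have c: "y \<le> z0" by simp
      \<comment> \<open>otherwise \<open>z0\<close> itself would lie above \<open>B0\<close>\<close>
      have "e z0 + K < e z0" using B0[OF z0] c y by simp
      then show False using K_nonneg by simp
    qed
    ultimately show ?thesis using Gf_high[OF f \<alpha>0 \<alpha>(2) z0 y(1)] by simp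
  qed
  show "\<exists>b. \<forall>y\<in>X. b \<le> y \<longrightarrow> c < Gf \<alpha> f y" for c
  proof -
    obtain b where b: "\<forall>y\<in>X. b \<le> y \<longrightarrow> c - Gf \<alpha> f z0 + K + e z0 < e y" using e_coercive by blast
    have "c < Gf \<alpha> f y" if "y \<in> X" "max b z0 \<le> y" for y
      using b Gf_high[OF f \<alpha>0 \<alpha>(2) z0 that(1)] that by force
    then show ?thesis by blast
  qed
qed (use K_nonneg z0 \<eta>_pos in auto)

lemma bellman_policy:
  assumes f: "regular f" and \<alpha>: "a0 \<le> \<alpha>" "\<alpha> \<le> 1"
  obtains s S where "sS_optimal X K (Gf \<alpha> f) s S" "z0 \<le> S" "S \<le> B0" "L \<le> s"
proof -
  interpret G: setup_cost_problem X K z0 B0 \<eta> "Gf \<alpha> f" by (rule Gf_problem[OF assms])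
  obtain s S where "sS_optimal X K (Gf \<alpha> f) s S" using G.sS_optimal_exists by blast
  then show ?thesis using that G.sS_optimal_range L_le by fastforce
qed

lemma bellman_eq:
  assumes "sS_optimal X K (Gf \<alpha> f) s S" "x \<in> X"
  shows "bellman \<alpha> f x = (if x < s then K + Gf \<alpha> f S else Gf \<alpha> f x) - cbar * x"
  using order_value_sS[OF assms(1) K_nonneg assms(2)] by (simp add: bellman_def)

lemma bellman_le:
  assumes f: "regular f" and \<alpha>: "a0 \<le> \<alpha>" "\<alpha> \<le> 1" and x: "x \<in> X"
  shows "bellman \<alpha> f x \<le> Gf \<alpha> f x - cbar * x"
    and "y \<in> X \<Longrightarrow> x \<le> y \<Longrightarrow> bellman \<alpha> f x \<le> K + Gf \<alpha> f y - cbar * x"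
proof -
  obtain s S where o: "sS_optimal X K (Gf \<alpha> f) s S" using bellman_policy[OF f \<alpha>] by blast
  show "bellman \<alpha> f x \<le> Gf \<alpha> f x - cbar * x"
    "y \<in> X \<Longrightarrow> x \<le> y \<Longrightarrow> bellman \<alpha> f x \<le> K + Gf \<alpha> f y - cbar * x"
    using o x unfolding bellman_eq[OF o x] by (auto simp: sS_optimal_def argmin_on_def)
qed

lemma bellman_attained:
  assumes f: "regular f" and \<alpha>: "a0 \<le> \<alpha>" "\<alpha> \<le> 1" and x: "x \<in> X"
  obtains "bellman \<alpha> f x = Gf \<alpha> f x - cbar * x"
    | y where "y \<in> X" "x < y" "bellman \<alpha> f x = K + Gf \<alpha> f y - cbar * x"
proof -
  obtain s S where o: "sS_optimal X K (Gf \<alpha> f) s S" using bellman_policy[OF f \<alpha>] by blast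
  have "S \<in> X" "s \<le> S" using o by (auto simp: sS_optimal_def argmin_on_def)
  then show ?thesis
    using bellman_eq[OF o x] that by (cases "x < s") auto
qed

lemma bellman_mono:
  assumes f: "regular f" "regular g" and \<alpha>: "a0 \<le> \<alpha>" "\<alpha> \<le> 1" and x: "x \<in> X"
    and le: "\<And>y. y \<in> X \<Longrightarrow> f y \<le> g y"
  shows "bellman \<alpha> f x \<le> bellman \<alpha> g x"
proof -
  have G: "Gf \<alpha> f y \<le> Gf \<alpha> g y" if "y \<in> X" for y
    unfolding Gf_def using Ef_mono[OF f that le] \<alpha> a0 by (intro add_left_mono mult_left_mono) auto
  show ?thesis
    using f(2) \<alpha> x
  proof (cases rule: bellman_attained)
    case 1
    then show ?thesis using bellman_le(1)[OF f(1) \<alpha> x] G[OF x] by simp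
  next
    case (2 y)
    then show ?thesis using bellman_le(2)[OF f(1) \<alpha> x 2(1)] G[OF 2(1)] by simp
  qed
qed

text \<open>
  For the Lipschitz bound consider \<open>x < y\<close> and imitate at one state what is optimal at the other. If
  the imitated state does not order, both wait, and the induction hypothesis applies after one period
  at the expense of \<open>slope b\<close>. If it orders up to a level above both states, the costs differ by
  \<open>cbar (y - x)\<close>. If \<open>x\<close> orders up to \<open>S < y\<close>, then waiting at \<open>y\<close> is compared with waiting at \<open>S\<close>.
\<close>

lemma regular_bellman:
  assumes f: "regular f" and \<alpha>: "a0 \<le> \<alpha>" "\<alpha> \<le> 1"
  shows "regular (bellman \<alpha> f)"
proof -
  let ?G = "Gf \<alpha> f" and ?g = "bellman \<alpha> f"
  have \<alpha>0: "0 \<le> \<alpha>" using a0 \<alpha> by simp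
  interpret G: setup_cost_problem X K z0 B0 \<eta> ?G by (rule Gf_problem[OF f \<alpha>])
  obtain s S where o: "sS_optimal X K ?G s S" and sS: "z0 \<le> S" "S \<le> B0" "L \<le> s"
    using bellman_policy[OF f \<alpha>] by blast
  have SX: "S \<in> X" and sX: "s \<in> X" "s \<le> S" using o by (auto simp: sS_optimal_def argmin_on_def)
  note eq = bellman_eq[OF o] and le = bellman_le[OF f \<alpha>]
  have G_nonneg: "0 \<le> ?G y - cbar * x" if "x \<in> X" "y \<in> X" "x \<le> y" for x y
  proof -
    have "cbar * x \<le> cbar * y" using cbar_pos that by (intro mult_left_mono) auto
    then show ?thesis
      using e_nonneg[OF that(2)] mult_nonneg_nonneg[OF \<alpha>0 Ef_nonneg[OF f that(2)]]
      unfolding Gf_def by linarith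
  qed
  have nonneg: "0 \<le> ?g x" if x: "x \<in> X" for x
    using f \<alpha> x
  proof (cases rule: bellman_attained)
    case 1
    then show ?thesis using G_nonneg[OF x x] by simp
  next
    case (2 y)
    then show ?thesis using G_nonneg[OF x 2(1)] K_nonneg by simp
  qed
  have convex: "K_convex_on X K ?g"
  proof -
    have "K_convex_on X K (\<lambda>x. ?g x + cbar * x)"
    proof (rule K_convex_on_order_value[OF K_nonneg G.G_convex])
      fix x assume x: "x \<in> X"
      show "?g x + cbar * x \<le> ?G x" using le(1)[OF x] by simp
      show "?g x + cbar * x \<le> K + ?G y" if "y \<in> X" "x \<le> y" for y using le(2)[OF x that] by simp
      show "?g x + cbar * x = ?G x \<or> (\<exists>y\<in>X. x \<le> y \<and> ?g x + cbar * x = K + ?G y)"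
        using f \<alpha> x
      proof (cases rule: bellman_attained)
        case 1
        then show ?thesis by simp
      next
        case (2 y)
        then show ?thesis by (intro disjI2 bexI[of _ y]) auto
      qed
    qed
    from K_convex_on_add_linear[OF this, of "- cbar"] show ?thesis by simp
  qed
  have order: "?g x \<le> ?g y + K + cbar * (y - x)" if xy: "x \<in> X" "y \<in> X" "x \<le> y" for x y
    using f \<alpha> xy(2)
  proof (cases rule: bellman_attained)
    case 1
    then show ?thesis using le(2)[OF xy] by (simp add: algebra_simps)
  next
    case (2 y')
    then show ?thesis using le(2)[OF xy(1) 2(1)] xy K_nonneg by (simp add: algebra_simps)
  qed
  have low: "cbar * (y - x) \<le> ?g x - ?g y" if xy: "x \<in> X" "y \<in> X" "x \<le> y" "y \<le> z0" for x y
  proof (cases "x < s")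
    case True
    then show ?thesis using le(2)[OF xy(2) SX] sS xy by (simp add: eq[OF xy(1)] algebra_simps)
  next
    case False
    have "0 \<le> \<eta> * (y - x)" using \<eta>_pos xy by simp
    then show ?thesis using G.G_low[OF xy] le(1)[OF xy(2)] False by (simp add: eq[OF xy(1)] algebra_simps)
  qed
  have step: "\<bar>?g y - ?g x\<bar> \<le> (y - x) * (cbar + slope b * lyap y)"
    if b: "b \<in> X" and xy: "x \<in> X" "y \<in> X" and o': "x \<le> y" "y \<le> b" "y \<le> x + 1" for b x y
  proof -
    have slope: "0 \<le> slope b" by (rule slope_nonneg[OF b])
    have slope_lyap: "0 \<le> slope b * lyap y" using slope lyap_pos[of y] by simp
    \<comment> \<open>without ordering, the drift of \<open>lyap\<close> pays for the slope of the expected holding cost\<close>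
    have no_order: "\<bar>(e v - e u) + \<alpha> * (Ef f v - Ef f u)\<bar> \<le> (v - u) * (cbar + slope b * lyap v)"
      if uv: "u \<in> X" "v \<in> X" "u \<le> v" "v \<le> b" "v \<le> u + 1" "L - 1 \<le> u" "L \<le> v" for u v
    proof -
      have 1: "\<bar>e v - e u\<bar> \<le> (v - u) * slope b"
        using e_Lipschitz[OF uv(1,2) b] uv by simp
      have 2: "\<bar>Ef f v - Ef f u\<bar> \<le> (v - u) * (cbar + slope b * (lap * lyap v))"
        using Ef_step[OF f b uv(1-5)] .
      have 3: "\<bar>\<alpha> * (Ef f v - Ef f u)\<bar> \<le> 1 * \<bar>Ef f v - Ef f u\<bar>"
        unfolding abs_mult using \<alpha> \<alpha>0 by (intro mult_right_mono) auto
      have "(v - u) * (slope b * (1 + lap * lyap v)) \<le> (v - u) * (slope b * lyap v)"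
        using lyap_drift[OF uv(7)] slope uv by (intro mult_left_mono) auto
      then show ?thesis using 1 2 3 by (simp add: algebra_simps)
    qed
    have "?g y - ?g x \<le> (y - x) * (cbar + slope b * lyap y)"
    proof (cases "x < s")
      case False
      have "?g y - ?g x \<le> (e y - e x) + \<alpha> * (Ef f y - Ef f x)"
        using le(1)[OF xy(2)] False by (simp add: eq[OF xy(1)] Gf_def algebra_simps)
      then show ?thesis using no_order[OF xy o'] False sS o' by simp
    next
      case True
      show ?thesis
      proof (cases "y \<le> S")
        case True
        have "?g y \<le> K + ?G S - cbar * y" using le(2)[OF xy(2) SX True] .
        then have "?g y - ?g x \<le> - (cbar * (y - x))" using \<open>x < s\<close> by (simp add: eq[OF xy(1)] algebra_simps)
        also have "\<dots> \<le> 0" using cbar_pos o' by simp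
        also have "0 \<le> (y - x) * (cbar + slope b * lyap y)"
          using o' cbar_pos slope_lyap by simp
        finally show ?thesis .
      next
        case False
        have "cbar * (y - S) - cbar * (y - x) \<le> 0" using cbar_pos \<open>x < s\<close> sX by (simp add: algebra_simps)
        then have "?g y - ?g x \<le> (e y - e S) + \<alpha> * (Ef f y - Ef f S)"
          using le(1)[OF xy(2)] K_nonneg \<open>x < s\<close> by (simp add: eq[OF xy(1)] Gf_def algebra_simps)
        also have "\<dots> \<le> (y - S) * (cbar + slope b * lyap y)"
          using no_order[OF SX xy(2)] False o' sS sX \<open>x < s\<close> by simp
        also have "\<dots> \<le> (y - x) * (cbar + slope b * lyap y)"
          using \<open>x < s\<close> sX cbar_pos slope_lyap by (intro mult_right_mono) auto
        finally show ?thesis .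
      qed
    qed
    moreover have "?g x - ?g y \<le> (y - x) * (cbar + slope b * lyap y)"
    proof (cases "y < s")
      case False
      have "?g x - ?g y \<le> - ((e y - e x) + \<alpha> * (Ef f y - Ef f x))"
        using le(1)[OF xy(1)] False by (simp add: eq[OF xy(2)] Gf_def algebra_simps)
      then show ?thesis using no_order[OF xy o'] False sS o' by simp
    next
      case True
      have "?g x - ?g y \<le> (y - x) * cbar"
        using True o' by (simp add: eq[OF xy(1)] eq[OF xy(2)] algebra_simps)
      also have "\<dots> \<le> (y - x) * (cbar + slope b * lyap y)"
        using slope_lyap o' by (intro mult_left_mono) auto
      finally show ?thesis .
    qed
    ultimately show ?thesis by simp
  qed
  show ?thesis
    unfolding regular_def using nonneg convex order low step by blast
qed

end

section \<open>Limits of regular functions and value iteration\<close>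

context inventory_low
begin

lemma regular_limit:
  assumes f: "\<And>n. regular (f n)" and lim: "\<And>x. x \<in> X \<Longrightarrow> (\<lambda>n. f n x) \<longlonglongrightarrow> g x"
  shows "regular g"
  unfolding regular_def
proof (intro conjI ballI impI; (elim conjE)?)
  show "K_convex_on X K g"
    using regular_convex[OF f] lim by (rule K_convex_on_LIMSEQ)
next
  fix x assume "x \<in> X"
  then show "0 \<le> g x" using lim regular_nonneg[OF f] by (intro LIMSEQ_le_const[OF lim]) auto
next
  fix x y assume X: "x \<in> X" "y \<in> X" "x \<le> y"
  have "(\<lambda>n. f n y + K + cbar * (y - x)) \<longlonglongrightarrow> g y + K + cbar * (y - x)" by (intro tendsto_intros lim X)
  then show "g x \<le> g y + K + cbar * (y - x)"
    by (rule LIMSEQ_le[OF lim[OF X(1)]]) (use regular_order[OF f X] in blast)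
next
  fix x y assume X: "x \<in> X" "y \<in> X" "x \<le> y" "y \<le> z0"
  have "(\<lambda>n. f n x - f n y) \<longlonglongrightarrow> g x - g y" by (intro tendsto_intros lim X)
  then show "cbar * (y - x) \<le> g x - g y"
    by (rule LIMSEQ_le_const) (use regular_low[OF f X] in blast)
next
  fix b x y assume X: "b \<in> X" "x \<in> X" "y \<in> X" "x \<le> y" "y \<le> b" "y \<le> x + 1"
  have "(\<lambda>n. \<bar>f n y - f n x\<bar>) \<longlonglongrightarrow> \<bar>g y - g x\<bar>" by (intro tendsto_intros lim X)
  then show "\<bar>g y - g x\<bar> \<le> (y - x) * (cbar + slope b * lyap y)"
    by (rule LIMSEQ_le_const2) (use regular_step[OF f X] in blast)
qed

lemma Ef_limit:
  assumes f: "\<And>n. regular (f n)" and lim: "\<And>x. x \<in> X \<Longrightarrow> (\<lambda>n. f n x) \<longlonglongrightarrow> g x" and y: "y \<in> X"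
  shows "(\<lambda>n. Ef (f n) y) \<longlonglongrightarrow> Ef g y"
proof -
  obtain B where B: "\<And>n. \<bar>f n y\<bar> \<le> B"
    using convergent_imp_Bseq[of "\<lambda>n. f n y"] lim[OF y] unfolding convergent_def Bseq_def by auto
  show ?thesis
    unfolding Ef_def
  proof (rule integral_dominated_convergence[where w = "\<lambda>\<omega>. B + K + cbar * dem \<omega>"])
    show "(\<lambda>\<omega>. g (y - dem \<omega>)) \<in> borel_measurable P"
      using borel_measurable_shift[OF regular_continuous[OF regular_limit[OF f lim]] y] .
    show "(\<lambda>\<omega>. f n (y - dem \<omega>)) \<in> borel_measurable P" for n
      using borel_measurable_shift[OF regular_continuous[OF f] y] .
    show "integrable P (\<lambda>\<omega>. B + K + cbar * dem \<omega>)" using integrable_dem by auto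
    show "AE \<omega> in P. (\<lambda>n. f n (y - dem \<omega>)) \<longlonglongrightarrow> g (y - dem \<omega>)"
      using lim shift_X[OF y] by (intro AE_I2) blast
    show "AE \<omega> in P. norm (f n (y - dem \<omega>)) \<le> B + K + cbar * dem \<omega>" for n
    proof (rule AE_I2)
      fix \<omega> assume \<omega>: "\<omega> \<in> space P"
      show "norm (f n (y - dem \<omega>)) \<le> B + K + cbar * dem \<omega>"
        using regular_shift_le[OF f y \<omega>, of n] regular_nonneg[OF f shift_X[OF y \<omega>], of n] B[of n] by simp
    qed
  qed
qed

lemma Gf_limit:
  assumes f: "\<And>n. regular (f n)" and lim: "\<And>x. x \<in> X \<Longrightarrow> (\<lambda>n. f n x) \<longlonglongrightarrow> g x"
    and \<alpha>: "\<And>n. 0 \<le> \<alpha> n" "\<And>n. \<alpha> n \<le> 1" "\<alpha> \<longlonglongrightarrow> \<beta>"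
    and y: "\<And>n. y n \<in> X" "z \<in> X" "y \<longlonglongrightarrow> z"
  shows "(\<lambda>n. Gf (\<alpha> n) (f n) (y n)) \<longlonglongrightarrow> Gf \<beta> g z"
proof (rule locally_Lipschitz_tendsto[OF Gf_Lipschitz[OF f \<alpha>(1,2) y(2)] _ y(1,3)])
  show "(\<lambda>n. Gf (\<alpha> n) (f n) z) \<longlonglongrightarrow> Gf \<beta> g z"
    unfolding Gf_def by (intro tendsto_intros \<alpha> Ef_limit f lim y)
qed

text \<open>
  The optimality equation passes to limits, in the discount factor, the function and an additive
  constant at the same time. Value iteration and the vanishing discount limit are both instances.
\<close>

lemma bellman_limit:
  assumes f: "\<And>n. regular (f n)" and lim: "\<And>x. x \<in> X \<Longrightarrow> (\<lambda>n. f n x) \<longlonglongrightarrow> f' x"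
    and \<alpha>: "\<And>n. a0 \<le> \<alpha> n" "\<And>n. \<alpha> n \<le> 1" "\<alpha> \<longlonglongrightarrow> \<beta>"
    and eq: "\<And>n. m n + g n = bellman (\<alpha> n) (f n) x" and x: "x \<in> X"
    and mg: "m \<longlonglongrightarrow> m'" "g \<longlonglongrightarrow> g'"
  shows "m' + g' = bellman \<beta> f' x"
proof -
  have "\<exists>s S. sS_optimal X K (Gf (\<alpha> n) (f n)) s S \<and> S \<le> B0 \<and> L \<le> s" for n
    using bellman_policy[OF f \<alpha>(1,2)] by metis
  then obtain s S where o: "\<And>n. sS_optimal X K (Gf (\<alpha> n) (f n)) (s n) (S n)"
    and bd: "\<And>n. L \<le> s n" "\<And>n. S n \<le> B0" by metis
  have \<alpha>0: "0 \<le> \<alpha> n" for n using \<alpha>(1)[of n] a0 by simp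
  have V: "(\<lambda>n. order_value X K (Gf (\<alpha> n) (f n)) x) \<longlonglongrightarrow> m' + g' + cbar * x"
  proof -
    have "(\<lambda>n. m n + g n + cbar * x) \<longlonglongrightarrow> m' + g' + cbar * x" by (intro tendsto_intros mg)
    then show ?thesis unfolding eq bellman_def by simp
  qed
  have "m' + g' + cbar * x = order_value X K (Gf \<beta> f') x"
    by (rule order_value_limit[OF K_nonneg o bd Gf_limit[OF f lim \<alpha>0 \<alpha>(2,3)] x V])
  then show ?thesis by (simp add: bellman_def)
qed

text \<open>
  Value iteration starts from the part of the ordering cost that is unavoidable from below \<open>z0\<close>,
  not from \<open>0\<close>: with this choice all iterates belong to the regular class.
\<close>

definition f0 :: "real \<Rightarrow> real" where "f0 x = cbar * max 0 (z0 - x)"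

lemma regular_f0: "regular f0"
proof -
  have sl: "0 \<le> slope b * lyap y" if "b \<in> X" for b y
    using slope_nonneg[OF that] lyap_pos[of y] by simp
  have lin: "\<bar>f0 y - f0 x\<bar> \<le> (y - x) * cbar" if "x \<le> y" for x y :: real
  proof -
    have "\<bar>f0 y - f0 x\<bar> = cbar * \<bar>max 0 (z0 - y) - max 0 (z0 - x)\<bar>"
      using cbar_pos by (simp add: f0_def abs_mult flip: right_diff_distrib)
    also have "\<dots> \<le> cbar * (y - x)" using cbar_pos that by (intro mult_left_mono) auto
    finally show ?thesis by (simp add: mult.commute)
  qed
  show ?thesis
    unfolding regular_def
  proof (intro conjI ballI impI; (elim conjE)?)
    show "K_convex_on X K f0"
      unfolding K_convex_on_def
    proof (intro ballI allI impI, elim conjE)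
      fix x y l :: real assume l: "0 < l" "l < 1"
      have m: "max 0 (z0 - ((1 - l) * x + l * y)) \<le> (1 - l) * max 0 (z0 - x) + l * max 0 (z0 - y)"
      proof (rule max.boundedI)
        have "(1 - l) * (z0 - x) + l * (z0 - y) \<le> (1 - l) * max 0 (z0 - x) + l * max 0 (z0 - y)"
          using l by (intro add_mono mult_left_mono) auto
        then show "z0 - ((1 - l) * x + l * y) \<le> (1 - l) * max 0 (z0 - x) + l * max 0 (z0 - y)"
          by (simp add: algebra_simps)
      qed (use l in simp)
      have "f0 ((1 - l) * x + l * y) \<le> cbar * ((1 - l) * max 0 (z0 - x) + l * max 0 (z0 - y))"
        unfolding f0_def using m cbar_pos by (intro mult_left_mono) auto
      also have "\<dots> = (1 - l) * f0 x + l * f0 y" by (simp add: f0_def algebra_simps)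
      finally show "f0 ((1 - l) * x + l * y) \<le> (1 - l) * f0 x + l * f0 y + l * K"
        using mult_nonneg_nonneg[OF less_imp_le[OF l(1)] K_nonneg] by simp
    qed
  next
    fix x y :: real assume "x \<le> y"
    then show "f0 x \<le> f0 y + K + cbar * (y - x)" using lin[of x y] K_nonneg by (simp add: mult.commute)
  next
    fix x y :: real assume "x \<le> y" "y \<le> z0"
    then show "cbar * (y - x) \<le> f0 x - f0 y" by (simp add: f0_def algebra_simps)
  next
    fix b x y :: real assume "b \<in> X" "x \<le> y"
    then show "\<bar>f0 y - f0 x\<bar> \<le> (y - x) * (cbar + slope b * lyap y)"
      using lin[of x y] mult_nonneg_nonneg[OF _ sl[of b y], of "y - x"] by (simp add: algebra_simps)
  qed (use cbar_pos in \<open>simp add: f0_def\<close>)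
qed

text \<open>
  An order up to \<open>y < z0\<close> leaves the shortage \<open>z0 - y\<close>. Its holding cost and the discounted cost of
  removing it later are together at least \<open>(\<kappa> + a0 cbar) (z0 - y)\<close>, which exceeds \<open>cbar (z0 - y)\<close>.
\<close>

lemma f0_le_bellman:
  assumes \<alpha>: "a0 \<le> \<alpha>" "\<alpha> \<le> 1" and x: "x \<in> X"
  shows "f0 x \<le> bellman \<alpha> f0 x"
proof -
  have *: "f0 x \<le> Gf \<alpha> f0 y - cbar * x" if y: "y \<in> X" "x \<le> y" for y
  proof -
    have cxy: "0 \<le> cbar * (y - x)" using cbar_pos y by simp
    have nn: "0 \<le> e y" "0 \<le> \<alpha> * Ef f0 y"
      using e_nonneg[OF y(1)] Ef_nonneg[OF regular_f0 y(1)] \<alpha> a0 by auto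
    show ?thesis
    proof (cases "y \<le> z0")
      case False
      have "f0 x \<le> cbar * (y - x)"
        unfolding f0_def using cbar_pos y False by (intro mult_left_mono) auto
      then show ?thesis using nn by (simp add: Gf_def algebra_simps)
    next
      case True
      have "0 \<le> e z0" by (rule e_nonneg[OF z0])
      then have 1: "\<kappa> * (z0 - y) \<le> e y" using e_low[OF y(1) z0 True] by simp
      have "0 \<le> Ef f0 z0" by (rule Ef_nonneg[OF regular_f0 z0])
      then have "cbar * (z0 - y) \<le> Ef f0 y" using Ef_low[OF regular_f0 y(1) z0 True] by simp
      then have 2: "a0 * (cbar * (z0 - y)) \<le> \<alpha> * Ef f0 y"
        using \<alpha> a0 cbar_pos True by (intro mult_mono) auto
      have 3: "0 \<le> \<eta> * (z0 - y)" using \<eta>_pos True by simp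
      have "f0 x = cbar * (z0 - x)" using True y by (simp add: f0_def)
      then show ?thesis using 1 2 3 by (simp add: Gf_def \<eta>_def algebra_simps)
    qed
  qed
  show ?thesis
    using regular_f0 \<alpha> x
  proof (cases rule: bellman_attained)
    case 1
    then show ?thesis using *[OF x] by simp
  next
    case (2 y)
    then show ?thesis using *[of y] K_nonneg by simp
  qed
qed

definition vi :: "real \<Rightarrow> nat \<Rightarrow> real \<Rightarrow> real" where
  "vi \<alpha> n = (bellman \<alpha> ^^ n) f0"

lemma vi_simps [simp]: "vi \<alpha> 0 = f0" "vi \<alpha> (Suc n) = bellman \<alpha> (vi \<alpha> n)"
  by (simp_all add: vi_def)

lemma regular_vi: "a0 \<le> \<alpha> \<Longrightarrow> \<alpha> \<le> 1 \<Longrightarrow> regular (vi \<alpha> n)"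
  by (induction n) (auto intro: regular_f0 regular_bellman)

lemma vi_Suc:
  assumes "a0 \<le> \<alpha>" "\<alpha> \<le> 1"
  shows "x \<in> X \<Longrightarrow> vi \<alpha> n x \<le> vi \<alpha> (Suc n) x"
proof (induction n arbitrary: x)
  case 0
  then show ?case using f0_le_bellman[OF assms] by simp
next
  case (Suc n)
  show ?case
    unfolding vi_simps(2)[of _ "Suc n"] vi_simps(2)[of _ n]
    by (rule bellman_mono) (use assms Suc regular_vi[OF assms] regular_bellman in auto)
qed

definition base_cost :: "real \<Rightarrow> real" where "base_cost x = K + cbar * mean + e x"

lemma base_cost_nonneg: "x \<in> X \<Longrightarrow> 0 \<le> base_cost x"
  using K_nonneg cbar_pos mean_nonneg e_nonneg by (simp add: base_cost_def)

text \<open>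
  Waiting at \<open>x\<close> and returning to \<open>x\<close> in the next period costs at most \<open>base_cost x\<close> per period.
\<close>

lemma bellman_le_base_cost:
  assumes f: "regular f" and \<alpha>: "a0 \<le> \<alpha>" "\<alpha> \<le> 1" and x: "x \<in> X"
  shows "bellman \<alpha> f x \<le> base_cost x + \<alpha> * f x"
proof -
  have "bellman \<alpha> f x \<le> e x + \<alpha> * Ef f x" using bellman_le(1)[OF assms] by (simp add: Gf_def)
  also have "\<alpha> * Ef f x \<le> \<alpha> * (f x + K + cbar * mean)"
    using Ef_le[OF f x] \<alpha> a0 by (intro mult_left_mono) auto
  also have "\<dots> \<le> \<alpha> * f x + (K + cbar * mean)"
    using mult_right_mono[OF \<alpha>(2), of "K + cbar * mean"] K_nonneg cbar_pos mean_nonneg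
    by (simp add: algebra_simps)
  finally show ?thesis by (simp add: base_cost_def)
qed

lemma vi_bound:
  assumes \<alpha>: "a0 \<le> \<alpha>" "\<alpha> < 1" and x: "x \<in> X"
  shows "vi \<alpha> n x \<le> f0 x + base_cost x / (1 - \<alpha>)"
proof (induction n)
  case 0
  then show ?case using base_cost_nonneg[OF x] \<alpha> by simp
next
  case (Suc n)
  have \<alpha>1: "\<alpha> \<le> 1" "0 \<le> \<alpha>" using \<alpha> a0 by auto
  have "vi \<alpha> (Suc n) x \<le> base_cost x + \<alpha> * vi \<alpha> n x"
    using bellman_le_base_cost[OF regular_vi[OF \<alpha>(1) \<alpha>1(1)] \<alpha>(1) \<alpha>1(1) x] by simp
  also have "\<dots> \<le> base_cost x + \<alpha> * (f0 x + base_cost x / (1 - \<alpha>))"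
    using Suc \<alpha>1 by (intro add_left_mono mult_left_mono)
  also have "\<dots> \<le> f0 x + base_cost x / (1 - \<alpha>)"
  proof -
    have "\<alpha> * f0 x \<le> 1 * f0 x" using \<alpha>1 regular_nonneg[OF regular_f0 x] by (intro mult_right_mono)
    moreover have "base_cost x + \<alpha> * (base_cost x / (1 - \<alpha>)) = base_cost x / (1 - \<alpha>)"
      using \<alpha> by (simp add: field_simps)
    ultimately show ?thesis by (simp add: distrib_left)
  qed
  finally show ?case .
qed

definition v :: "real \<Rightarrow> real \<Rightarrow> real" where "v \<alpha> x = (SUP n. vi \<alpha> n x)"

lemma vi_tendsto:
  assumes \<alpha>: "a0 \<le> \<alpha>" "\<alpha> < 1" and x: "x \<in> X"
  shows "(\<lambda>n. vi \<alpha> n x) \<longlonglongrightarrow> v \<alpha> x"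
  unfolding v_def
proof (rule LIMSEQ_incseq_SUP)
  show "bdd_above (range (\<lambda>n. vi \<alpha> n x))" using vi_bound[OF assms] by (rule bdd_aboveI2)
  show "incseq (\<lambda>n. vi \<alpha> n x)" using vi_Suc[of \<alpha> x] \<alpha> x by (intro incseq_SucI) auto
qed

lemma regular_v:
  assumes \<alpha>: "a0 \<le> \<alpha>" "\<alpha> < 1"
  shows "regular (v \<alpha>)"
proof (rule regular_limit[of "vi \<alpha>"])
  show "regular (vi \<alpha> n)" for n using regular_vi[of \<alpha> n] \<alpha> by simp
qed (rule vi_tendsto[OF \<alpha>])

lemma v_fixed_point:
  assumes \<alpha>: "a0 \<le> \<alpha>" "\<alpha> < 1" and x: "x \<in> X"
  shows "bellman \<alpha> (v \<alpha>) x = v \<alpha> x"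
proof -
  have "0 + v \<alpha> x = bellman \<alpha> (v \<alpha>) x"
  proof (rule bellman_limit[of "vi \<alpha>" "v \<alpha>" "\<lambda>_. \<alpha>" \<alpha> "\<lambda>_. 0" "\<lambda>n. vi \<alpha> (Suc n) x"])
    show "regular (vi \<alpha> n)" for n using regular_vi[of \<alpha> n] \<alpha> by simp
    show "(\<lambda>n. vi \<alpha> (Suc n) x) \<longlonglongrightarrow> v \<alpha> x" using vi_tendsto[OF assms] by (rule LIMSEQ_Suc)
  qed (use \<alpha> x vi_tendsto[OF \<alpha>] in auto)
  then show ?thesis by simp
qed

lemma v_le_base_cost:
  assumes \<alpha>: "a0 \<le> \<alpha>" "\<alpha> < 1" and x: "x \<in> X"
  shows "(1 - \<alpha>) * v \<alpha> x \<le> base_cost x"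
  using bellman_le_base_cost[OF regular_v[OF \<alpha>] \<alpha>(1) _ x] v_fixed_point[OF assms] \<alpha>
  by (simp add: algebra_simps)

end


section \<open>Discounted cost of policies\<close>

context mdp_run
begin

text \<open>
  The constant \<open>w\<close> allows one induction to serve both criteria: it is \<open>0\<close> for discounted costs, and
  for average costs it is the constant of the optimality equation, with \<open>\<alpha> = 1\<close>. Values in
  \<^typ>\<open>ennreal\<close> permit supersolutions that are infinite on part of the state space.
\<close>

lemma stationary_supersolution:
  assumes p: "p = stationary M \<phi>" and \<phi>: "\<phi> \<in> stationary_policies M"
    and c: "(\<lambda>z. cost M (fst z) (snd z)) \<in> borel_measurable (sa_space M)"
    and V: "V \<in> borel_measurable (state_space M)" and \<alpha>: "0 \<le> \<alpha>"
    and super: "\<And>y. y \<in> states M \<Longrightarrow>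
      ennreal (cost M y (\<phi> y)) + ennreal \<alpha> * (\<integral>\<^sup>+y'. V y' \<partial>kern M y (\<phi> y)) \<le> w + V y"
  shows "(\<Sum>t<n. ennreal (\<alpha> ^ t) * stage_cost t) + ennreal (\<alpha> ^ n) * expect n (\<lambda>z. V (fst z))
    \<le> V x + (\<Sum>t<n. ennreal (\<alpha> ^ t) * w)"
proof (induction n)
  case 0
  show ?case using expect_state_0[OF V] by simp
next
  case (Suc n)
  have \<phi>': "\<phi> \<in> state_space M \<rightarrow>\<^sub>M action_space M" using \<phi> by (simp add: stationary_policies_def)
  have c': "(\<lambda>z. ennreal (cost M (fst z) (snd z))) \<in> borel_measurable (sa_space M)"
    using measurable_compose[OF c measurable_ennreal] .
  note k = measurable_kern_integral[OF V]
  have V': "(\<lambda>z. V (fst z)) \<in> borel_measurable (sa_space M)"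
    unfolding sa_space_def using measurable_compose[OF measurable_fst V] .
  let ?F = "\<lambda>z. ennreal (cost M (fst z) (snd z)) + ennreal \<alpha> * (\<integral>\<^sup>+y. V y \<partial>kern M (fst z) (snd z))"
  have F: "?F \<in> borel_measurable (sa_space M)"
    using c' k by (intro borel_measurable_add borel_measurable_times_ennreal borel_measurable_const)
  have "stage_cost n + ennreal \<alpha> * expect (Suc n) (\<lambda>z. V (fst z)) = expect n ?F"
    unfolding expect_state_Suc[OF V] stage_cost_def
    using c' k by (simp add: expect_add expect_cmult borel_measurable_times_ennreal)
  also have "\<dots> = expect n (\<lambda>z. ?F (fst z, \<phi> (fst z)))"
    by (rule expect_stationary[OF p \<phi>' F])
  also have "\<dots> \<le> expect n (\<lambda>z. w + V (fst z))"
    by (rule expect_mono) (use super in simp)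
  also have "\<dots> = w + expect n (\<lambda>z. V (fst z))"
    using V' by (simp add: expect_add expect_const)
  finally have step: "stage_cost n + ennreal \<alpha> * expect (Suc n) (\<lambda>z. V (fst z)) \<le> w + expect n (\<lambda>z. V (fst z))" .
  have "(\<Sum>t<Suc n. ennreal (\<alpha> ^ t) * stage_cost t) + ennreal (\<alpha> ^ Suc n) * expect (Suc n) (\<lambda>z. V (fst z))
      = (\<Sum>t<n. ennreal (\<alpha> ^ t) * stage_cost t)
        + ennreal (\<alpha> ^ n) * (stage_cost n + ennreal \<alpha> * expect (Suc n) (\<lambda>z. V (fst z)))"
    using \<alpha> by (simp add: distrib_left ennreal_mult' mult_ac add_ac)
  also have "\<dots> \<le> (\<Sum>t<n. ennreal (\<alpha> ^ t) * stage_cost t) + ennreal (\<alpha> ^ n) * (w + expect n (\<lambda>z. V (fst z)))"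
    using step by (intro add_left_mono mult_left_mono) auto
  also have "\<dots> = ((\<Sum>t<n. ennreal (\<alpha> ^ t) * stage_cost t) + ennreal (\<alpha> ^ n) * expect n (\<lambda>z. V (fst z)))
      + ennreal (\<alpha> ^ n) * w"
    by (simp add: distrib_left add_ac)
  also have "\<dots> \<le> (V x + (\<Sum>t<n. ennreal (\<alpha> ^ t) * w)) + ennreal (\<alpha> ^ n) * w"
    using Suc by (rule add_right_mono)
  finally show ?case by (simp add: add_ac)
qed

lemma stationary_disc_cost_le:
  assumes "p = stationary M \<phi>" "\<phi> \<in> stationary_policies M"
    and c: "(\<lambda>z. cost M (fst z) (snd z)) \<in> borel_measurable (sa_space M)"
    and "V \<in> borel_measurable (state_space M)" and \<alpha>: "0 \<le> \<alpha>"
    and "\<And>y. y \<in> states M \<Longrightarrow>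
      ennreal (cost M y (\<phi> y)) + ennreal \<alpha> * (\<integral>\<^sup>+y'. V y' \<partial>kern M y (\<phi> y)) \<le> V y"
  shows "disc_cost M \<alpha> p x \<le> V x"
  unfolding disc_cost_eq_suminf[OF c \<alpha>]
proof (rule suminf_le_const)
  fix n
  have "(\<Sum>t<n. ennreal (\<alpha> ^ t) * stage_cost t)
      \<le> (\<Sum>t<n. ennreal (\<alpha> ^ t) * stage_cost t) + ennreal (\<alpha> ^ n) * expect n (\<lambda>z. V (fst z))"
    by simp
  also have "\<dots> \<le> V x + (\<Sum>t<n. ennreal (\<alpha> ^ t) * 0)"
    by (rule stationary_supersolution[OF assms(1,2) c assms(4) \<alpha>]) (use assms(6) in simp)
  finally show "(\<Sum>t<n. ennreal (\<alpha> ^ t) * stage_cost t) \<le> V x" by simp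
qed simp

lemma stationary_expect_0:
  assumes p: "p = stationary M \<phi>" and \<phi>: "\<phi> \<in> stationary_policies M"
    and f: "f \<in> borel_measurable (sa_space M)"
  shows "expect 0 f = f (x, \<phi> x)"
proof -
  have \<phi>': "\<phi> \<in> state_space M \<rightarrow>\<^sub>M action_space M" using \<phi> by (simp add: stationary_policies_def)
  have "(\<lambda>y. f (y, \<phi> y)) \<in> borel_measurable (state_space M)"
    by (rule measurable_compose[OF _ f]) (use \<phi>' in \<open>simp add: sa_space_def\<close>)
  from expect_state_0[OF this] show ?thesis
    using expect_stationary[OF p \<phi>' f, of 0] by simp
qed

end

context inventory_demand
begin

lemma sS_policy_stationary:
  assumes "s \<in> X" "S \<in> X" "s \<le> S"
  shows "sS_policy s S \<in> stationary_policies MM"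
proof -
  have "(\<lambda>x. x) \<in> borel_measurable (restrict_space borel X)"
    by (rule measurable_restrict_space1) simp
  then have "sS_policy s S \<in> borel_measurable (restrict_space borel X)"
    unfolding sS_policy_def by measurable
  moreover have "sS_policy s S \<in> space (restrict_space borel X) \<rightarrow> X \<inter> {0..}"
    using assms X_0 by (auto simp: sS_policy_def space_restrict_space intro: X_diff)
  ultimately show ?thesis
    unfolding stationary_policies_def state_space_MM action_space_MM
    by (intro measurable_restrict_space2) auto
qed

lemma mdp_run_MM: "p \<in> policies MM \<Longrightarrow> x \<in> X \<Longrightarrow> mdp_run MM p x"
  by unfold_locales (use kern_MM in \<open>simp_all del: MM_simps(4)\<close>)

lemma stationary_action:
  assumes "\<phi> \<in> stationary_policies MM" "x \<in> X"
  shows "\<phi> x \<in> X" "0 \<le> \<phi> x"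
proof -
  have "\<phi> x \<in> space (action_space MM)"
    using assms(2)
    by (intro measurable_space[OF assms(1)[unfolded stationary_policies_def]])
       (simp add: state_space_MM space_restrict_space)
  then show "\<phi> x \<in> X" "0 \<le> \<phi> x" by (auto simp: action_space_MM space_restrict_space)
qed

text \<open>
  Keeping the level \<open>x\<close> costs the setup cost and the mean demand in every period. The value
  \<open>\<infinity>\<close> above \<open>x\<close> makes the bound for this policy a supersolution on the whole state space.
\<close>

lemma disc_value_le:
  assumes \<alpha>: "0 \<le> \<alpha>" "\<alpha> < 1" and x: "x \<in> X"
  shows "disc_value MM \<alpha> x \<le> ennreal (K + (K + cbar * mean + e x) / (1 - \<alpha>))"
proof -
  define C where "C = (K + cbar * mean + e x) / (1 - \<alpha>)"
  have C: "0 \<le> C" "C = K + cbar * mean + e x + \<alpha> * C"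
    unfolding C_def using \<alpha> K_nonneg cbar_pos mean_nonneg e_nonneg[OF x] by (auto simp: field_simps)
  define V where "V y = (if y \<le> x then ennreal (K + cbar * (x - y) + C) else \<infinity>)" for y
  have st: "sS_policy x x \<in> stationary_policies MM" using sS_policy_stationary x by simp
  then have pol: "stationary MM (sS_policy x x) \<in> policies MM" by (rule stationary_in_policies)
  interpret R: mdp_run MM "stationary MM (sS_policy x x)" x using mdp_run_MM[OF pol x] .
  have V: "V \<in> borel_measurable (state_space MM)"
  proof -
    have "(\<lambda>x. x) \<in> borel_measurable (state_space MM)"
      unfolding state_space_MM by (rule measurable_restrict_space1) simp
    then show ?thesis unfolding V_def by measurable
  qed
  have "disc_cost MM \<alpha> (stationary MM (sS_policy x x)) x \<le> V x"
  proof (rule R.stationary_disc_cost_le[OF refl st cost_measurable V \<alpha>(1)])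
    fix y assume "y \<in> states MM"
    then have y: "y \<in> X" by simp
    show "ennreal (cost MM y (sS_policy x x y)) + ennreal \<alpha> * (\<integral>\<^sup>+y'. V y' \<partial>kern MM y (sS_policy x x y)) \<le> V y"
    proof (cases "y \<le> x")
      case True
      have lev: "y + sS_policy x x y = x" and act: "sS_policy x x y = x - y" using True by (auto simp: sS_policy_def)
      have aX: "x - y \<in> X" using X_diff x y by blast
      have "(\<integral>\<^sup>+y'. V y' \<partial>kern MM y (sS_policy x x y)) = (\<integral>\<^sup>+\<omega>. V (y + sS_policy x x y - dem \<omega>) \<partial>P)"
        using y aX V unfolding act by (rule nn_integral_kern)
      also have "\<dots> = (\<integral>\<^sup>+\<omega>. ennreal (K + cbar * dem \<omega> + C) \<partial>P)"
        unfolding lev by (intro nn_integral_cong) (simp add: V_def dem_nonneg)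
      also have "\<dots> = ennreal (\<integral>\<omega>. K + cbar * dem \<omega> + C \<partial>P)"
        using integrable_dem K_nonneg C cbar_pos dem_nonneg by (intro nn_integral_eq_integral AE_I2) auto
      also have "(\<integral>\<omega>. K + cbar * dem \<omega> + C \<partial>P) = K + cbar * mean + C"
        using integrable_dem by (simp add: mean_def prob_space)
      finally have int: "(\<integral>\<^sup>+y'. V y' \<partial>kern MM y (sS_policy x x y)) = ennreal (K + cbar * mean + C)" .
      have Km: "0 \<le> K + cbar * mean" using K_nonneg cbar_pos mean_nonneg by simp
      have c0: "0 \<le> cost MM y (sS_policy x x y)" using cost_nonneg[OF y aX] True unfolding act by simp
      have "ennreal (cost MM y (sS_policy x x y)) + ennreal \<alpha> * (\<integral>\<^sup>+y'. V y' \<partial>kern MM y (sS_policy x x y))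
          = ennreal (cost MM y (sS_policy x x y) + \<alpha> * (K + cbar * mean + C))"
        unfolding int using c0 \<alpha> C Km by (simp add: ennreal_mult'' ennreal_plus del: MM_simps)
      also have "\<dots> \<le> ennreal (K + cbar * (x - y) + C)"
      proof (rule ennreal_leI)
        have "\<alpha> * (K + cbar * mean) \<le> 1 * (K + cbar * mean)" using \<alpha> Km by (intro mult_right_mono) auto
        moreover have "cost MM y (sS_policy x x y) \<le> K + cbar * (x - y) + e x"
          unfolding MM_simps lev act using K_nonneg by simp
        ultimately show "cost MM y (sS_policy x x y) + \<alpha> * (K + cbar * mean + C) \<le> K + cbar * (x - y) + C"
          using C(2) by (simp add: distrib_left del: MM_simps)
      qed
      finally show ?thesis using True by (simp add: V_def)
    qed (simp add: V_def)
  qed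
  also have "V x = ennreal (K + C)" by (simp add: V_def)
  finally show ?thesis
    unfolding disc_value_def C_def using pol by (rule INF_lower2[rotated])
qed

end

context inventory_low
begin

lemma cost_Gf:
  "cost MM y a + \<alpha> * Ef f (y + a) = (if a > 0 then K else 0) + Gf \<alpha> f (y + a) - cbar * y"
  by (simp add: Gf_def algebra_simps)

lemma nn_integral_kern_regular:
  assumes f: "regular f" and y: "y \<in> X" "a \<in> X"
  shows "(\<integral>\<^sup>+y'. ennreal (f y') \<partial>kern MM y a) = ennreal (Ef f (y + a))"
proof -
  have "(\<integral>\<^sup>+y'. ennreal (f y') \<partial>kern MM y a) = (\<integral>\<^sup>+\<omega>. ennreal (f (y + a - dem \<omega>)) \<partial>P)"
    using measurable_continuous_on_X[OF regular_continuous[OF f]] y by (intro nn_integral_kern) auto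
  also have "\<dots> = ennreal (Ef f (y + a))"
    unfolding Ef_def using regular_integrable[OF f X_add[OF y]] regular_nonneg[OF f shift_X[OF X_add[OF y]]]
    by (intro nn_integral_eq_integral AE_I2) auto
  finally show ?thesis .
qed

lemma one_step:
  assumes f: "regular f" and y: "y \<in> X" "a \<in> X" "0 \<le> a" and \<alpha>: "0 \<le> \<alpha>"
  shows "ennreal (cost MM y a) + ennreal \<alpha> * (\<integral>\<^sup>+y'. ennreal (f y') \<partial>kern MM y a)
    = ennreal ((if a > 0 then K else 0) + Gf \<alpha> f (y + a) - cbar * y)"
  unfolding nn_integral_kern_regular[OF f y(1,2)] cost_Gf[symmetric]
  using cost_nonneg[OF y] Ef_nonneg[OF f X_add[OF y(1,2)]] \<alpha>
  by (simp add: ennreal_mult'' ennreal_plus del: MM_simps)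

lemma bellman_le_step:
  assumes f: "regular f" and \<alpha>: "a0 \<le> \<alpha>" "\<alpha> \<le> 1" and y: "y \<in> X" "a \<in> X" "0 \<le> a"
  shows "bellman \<alpha> f y \<le> (if a > 0 then K else 0) + Gf \<alpha> f (y + a) - cbar * y"
  using bellman_le(1)[OF f \<alpha> y(1)] bellman_le(2)[OF f \<alpha> y(1) X_add[OF y(1,2)]] y by (cases "a > 0") auto

text \<open>
  Under any policy the cost of the first \<open>j\<close> steps plus the remaining value iterate increases
  with \<open>j\<close>: one application of the optimality operator is at most one actual step.
\<close>

lemma run_lower:
  assumes p: "p \<in> policies MM" and x: "x \<in> X" and \<alpha>: "a0 \<le> \<alpha>" "\<alpha> < 1" and "j \<le> n"
  shows "(\<Sum>t<j. ennreal (\<alpha> ^ t) * mdp_run.stage_cost MM p x t)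
      + ennreal (\<alpha> ^ j) * mdp_run.expect MM p x j (\<lambda>z. ennreal (vi \<alpha> (n - j) (fst z)))
    \<le> (\<Sum>t<n. ennreal (\<alpha> ^ t) * mdp_run.stage_cost MM p x t)
      + ennreal (\<alpha> ^ n) * mdp_run.expect MM p x n (\<lambda>z. ennreal (f0 (fst z)))"
  using \<open>j \<le> n\<close>
proof (induction rule: inc_induct)
  case base
  then show ?case by simp
next
  case (step j)
  interpret R: mdp_run MM p x using mdp_run_MM[OF p x] .
  have \<alpha>': "\<alpha> \<le> 1" "0 \<le> \<alpha>" using \<alpha> a0 by auto
  let ?f = "vi \<alpha> (n - Suc j)"
  have f: "regular ?f" by (rule regular_vi[OF \<alpha>(1) \<alpha>'(1)])
  have eq: "vi \<alpha> (n - j) = bellman \<alpha> ?f"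
    using step.hyps by (metis Suc_diff_Suc vi_simps(2))
  have fm: "(\<lambda>y. ennreal (?f y)) \<in> borel_measurable (state_space MM)"
    using measurable_continuous_on_X[OF regular_continuous[OF f]] by simp
  have c': "(\<lambda>z. ennreal (cost MM (fst z) (snd z))) \<in> borel_measurable (sa_space MM)"
    using measurable_compose[OF cost_measurable measurable_ennreal] .
  note k = R.measurable_kern_integral[OF fm]
  have "R.expect j (\<lambda>z. ennreal (vi \<alpha> (n - j) (fst z)))
      \<le> R.expect j (\<lambda>z. ennreal (cost MM (fst z) (snd z)) + ennreal \<alpha> * (\<integral>\<^sup>+y. ennreal (?f y) \<partial>kern MM (fst z) (snd z)))"
  proof (rule R.expect_mono)
    fix y a assume "y \<in> states MM" "a \<in> actions MM"
    then have y: "y \<in> X" "a \<in> X" "0 \<le> a" by auto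
    show "ennreal (vi \<alpha> (n - j) (fst (y, a))) \<le> ennreal (cost MM (fst (y, a)) (snd (y, a)))
        + ennreal \<alpha> * (\<integral>\<^sup>+y. ennreal (?f y) \<partial>kern MM (fst (y, a)) (snd (y, a)))"
      unfolding fst_conv snd_conv eq one_step[OF f y \<alpha>'(2)]
      by (intro ennreal_leI bellman_le_step[OF f \<alpha>(1) \<alpha>'(1) y])
  qed
  also have "\<dots> = R.stage_cost j + ennreal \<alpha> * R.expect (Suc j) (\<lambda>z. ennreal (?f (fst z)))"
    unfolding R.expect_state_Suc[OF fm] R.stage_cost_def
    using c' k by (simp add: R.expect_add R.expect_cmult borel_measurable_times_ennreal del: MM_simps)
  finally have "ennreal (\<alpha> ^ j) * R.expect j (\<lambda>z. ennreal (vi \<alpha> (n - j) (fst z)))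
      \<le> ennreal (\<alpha> ^ j) * (R.stage_cost j + ennreal \<alpha> * R.expect (Suc j) (\<lambda>z. ennreal (?f (fst z))))"
    by (intro mult_left_mono) auto
  also have "\<dots> = ennreal (\<alpha> ^ j) * R.stage_cost j + ennreal (\<alpha> ^ Suc j) * R.expect (Suc j) (\<lambda>z. ennreal (?f (fst z)))"
    using \<alpha>' by (simp add: distrib_left ennreal_mult' mult_ac)
  finally have "(\<Sum>t<j. ennreal (\<alpha> ^ t) * R.stage_cost t)
        + ennreal (\<alpha> ^ j) * R.expect j (\<lambda>z. ennreal (vi \<alpha> (n - j) (fst z)))
      \<le> (\<Sum>t<Suc j. ennreal (\<alpha> ^ t) * R.stage_cost t) + ennreal (\<alpha> ^ Suc j) * R.expect (Suc j) (\<lambda>z. ennreal (?f (fst z)))"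
    by (simp add: add.assoc add_left_mono)
  then show ?case using step.IH by (rule order_trans)
qed

text \<open>
  The starting function of the value iteration is dominated by a multiple of \<open>h\<close>, hence it is
  negligible in the long run along every policy of finite discounted cost.
\<close>

lemma f0_le_h: "x \<in> X \<Longrightarrow> f0 x \<le> cbar / \<kappa> * h x"
proof -
  assume x: "x \<in> X"
  have "\<kappa> * max 0 (z0 - x) \<le> h x"
    using h_low[OF x z0] h_nonneg[OF z0] h_nonneg[OF x] by (cases "x \<le> z0") auto
  then have "cbar / \<kappa> * (\<kappa> * max 0 (z0 - x)) \<le> cbar / \<kappa> * h x"
    using cbar_pos \<kappa>_pos by (intro mult_left_mono) auto
  then show ?thesis using \<kappa>_pos by (simp add: f0_def)
qed

lemma run_tail:
  assumes p: "p \<in> policies MM" and x: "x \<in> X" and \<alpha>: "a0 \<le> \<alpha>" "\<alpha> < 1"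
    and fin: "disc_cost MM \<alpha> p x < \<infinity>"
  shows "(\<lambda>n. ennreal (\<alpha> ^ n) * mdp_run.expect MM p x n (\<lambda>z. ennreal (f0 (fst z)))) \<longlonglongrightarrow> 0"
proof -
  interpret R: mdp_run MM p x using mdp_run_MM[OF p x] .
  have \<alpha>0: "0 \<le> \<alpha>" using \<alpha> a0 by simp
  let ?r = "\<lambda>t. ennreal (\<alpha> ^ t) * R.stage_cost t"
  have sum: "(\<Sum>t. ?r t) < \<infinity>" using fin unfolding R.disc_cost_eq_suminf[OF cost_measurable \<alpha>0] .
  have r_fin: "?r t < \<infinity>" for t
  proof -
    have "?r t \<le> (\<Sum>t. ?r t)" using sum_le_suminf[of ?r "{t}"] by simp
    then show ?thesis using sum by (rule le_less_trans)
  qed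
  have r_eq: "ennreal (enn2real (?r t)) = ?r t" for t using r_fin by (simp add: ennreal_enn2real)
  have "summable (\<lambda>t. enn2real (?r t))"
    by (rule summable_suminf_not_top) (use sum in \<open>simp_all add: r_eq\<close>)
  then have "(\<lambda>t. enn2real (?r t)) \<longlonglongrightarrow> 0" by (rule summable_LIMSEQ_zero)
  from tendsto_ennrealI[OF tendsto_mult_right_zero[OF this, of "cbar / \<kappa> * \<alpha>"]]
  have lim: "(\<lambda>t. ennreal (cbar / \<kappa> * \<alpha> * enn2real (?r t))) \<longlonglongrightarrow> 0" by simp
  have "ennreal (cbar / \<kappa> * \<alpha> * enn2real (?r t)) = ennreal (cbar / \<kappa> * \<alpha>) * ?r t" for t
    using cbar_pos \<kappa>_pos \<alpha>0 r_eq[of t] by (subst ennreal_mult) auto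
  note lim = lim[unfolded this]
  have hm: "(\<lambda>y. ennreal (h y)) \<in> borel_measurable (state_space MM)"
    using measurable_continuous_on_X[OF h_cont] by simp
  have h_le: "R.expect (Suc t) (\<lambda>z. ennreal (h (fst z))) \<le> R.stage_cost t" for t
    unfolding R.expect_state_Suc[OF hm] R.stage_cost_def
  proof (rule R.expect_mono)
    fix y a assume "y \<in> states MM" "a \<in> actions MM"
    then have y: "y \<in> X" "a \<in> X" "0 \<le> a" by auto
    show "(\<integral>\<^sup>+y. ennreal (h y) \<partial>kern MM (fst (y, a)) (snd (y, a))) \<le> ennreal (cost MM (fst (y, a)) (snd (y, a)))"
      unfolding fst_conv snd_conv nn_integral_kern_h[OF y(1,2)] MM_simps(3)
      using K_nonneg cbar_pos y by (intro ennreal_leI) simp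
  qed
  have hm': "(\<lambda>z. ennreal (h (fst z))) \<in> borel_measurable (sa_space MM)"
    unfolding sa_space_def using measurable_compose[OF measurable_fst hm] .
  have f0_le: "R.expect (Suc t) (\<lambda>z. ennreal (f0 (fst z))) \<le> ennreal (cbar / \<kappa>) * R.stage_cost t" for t
  proof -
    have "R.expect (Suc t) (\<lambda>z. ennreal (f0 (fst z))) \<le> R.expect (Suc t) (\<lambda>z. ennreal (cbar / \<kappa>) * ennreal (h (fst z)))"
    proof (rule R.expect_mono)
      fix y a assume "y \<in> states MM"
      then have y: "y \<in> X" by simp
      have "ennreal (f0 y) \<le> ennreal (cbar / \<kappa> * h y)" by (rule ennreal_leI[OF f0_le_h[OF y]])
      also have "\<dots> = ennreal (cbar / \<kappa>) * ennreal (h y)" using cbar_pos \<kappa>_pos by (intro ennreal_mult') simp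
      finally show "ennreal (f0 (fst (y, a))) \<le> ennreal (cbar / \<kappa>) * ennreal (h (fst (y, a)))" by simp
    qed
    also have "\<dots> = ennreal (cbar / \<kappa>) * R.expect (Suc t) (\<lambda>z. ennreal (h (fst z)))"
      by (rule R.expect_cmult[OF hm'])
    also have "\<dots> \<le> ennreal (cbar / \<kappa>) * R.stage_cost t" by (intro mult_left_mono h_le) simp
    finally show ?thesis .
  qed
  have "ennreal (\<alpha> ^ Suc t) * R.expect (Suc t) (\<lambda>z. ennreal (f0 (fst z))) \<le> ennreal (cbar / \<kappa> * \<alpha>) * ?r t" for t
  proof -
    have "ennreal (\<alpha> ^ Suc t) * R.expect (Suc t) (\<lambda>z. ennreal (f0 (fst z)))
        \<le> ennreal (\<alpha> ^ Suc t) * (ennreal (cbar / \<kappa>) * R.stage_cost t)"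
      by (intro mult_left_mono f0_le) simp
    also have "\<dots> = ennreal (\<alpha> ^ Suc t * (cbar / \<kappa>)) * R.stage_cost t"
      using \<alpha>0 by (subst ennreal_mult') (auto simp: mult_ac)
    also have "\<alpha> ^ Suc t * (cbar / \<kappa>) = cbar / \<kappa> * \<alpha> * \<alpha> ^ t" by simp
    also have "ennreal (cbar / \<kappa> * \<alpha> * \<alpha> ^ t) * R.stage_cost t = ennreal (cbar / \<kappa> * \<alpha>) * ?r t"
      using cbar_pos \<kappa>_pos \<alpha>0 by (subst ennreal_mult') (auto simp: mult.assoc)
    finally show ?thesis .
  qed
  then have "(\<lambda>t. ennreal (\<alpha> ^ Suc t) * R.expect (Suc t) (\<lambda>z. ennreal (f0 (fst z)))) \<longlonglongrightarrow> 0"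
    by (intro tendsto_sandwich[OF _ _ tendsto_const lim] always_eventually) auto
  then show ?thesis by (rule LIMSEQ_imp_Suc)
qed

lemma run_limit:
  assumes p: "p \<in> policies MM" and x: "x \<in> X" and \<alpha>: "a0 \<le> \<alpha>" "\<alpha> < 1"
    and fin: "disc_cost MM \<alpha> p x < \<infinity>"
  shows "(\<lambda>n. (\<Sum>t<n. ennreal (\<alpha> ^ t) * mdp_run.stage_cost MM p x t)
      + ennreal (\<alpha> ^ n) * mdp_run.expect MM p x n (\<lambda>z. ennreal (f0 (fst z)))) \<longlonglongrightarrow> disc_cost MM \<alpha> p x"
proof -
  interpret R: mdp_run MM p x using mdp_run_MM[OF p x] .
  have \<alpha>0: "0 \<le> \<alpha>" using \<alpha> a0 by simp
  have "(\<lambda>n. \<Sum>t<n. ennreal (\<alpha> ^ t) * R.stage_cost t) \<longlonglongrightarrow> disc_cost MM \<alpha> p x"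
    unfolding R.disc_cost_eq_suminf[OF cost_measurable \<alpha>0] by (rule summable_LIMSEQ) simp
  from tendsto_add[OF this run_tail[OF assms]] show ?thesis by simp
qed

lemma v_le_disc_cost:
  assumes p: "p \<in> policies MM" and x: "x \<in> X" and \<alpha>: "a0 \<le> \<alpha>" "\<alpha> < 1"
  shows "ennreal (v \<alpha> x) \<le> disc_cost MM \<alpha> p x"
proof (cases "disc_cost MM \<alpha> p x < \<infinity>")
  case True
  interpret R: mdp_run MM p x using mdp_run_MM[OF p x] .
  have vm: "(\<lambda>y. ennreal (vi \<alpha> n y)) \<in> borel_measurable (state_space MM)" for n
    using measurable_continuous_on_X[OF regular_continuous[OF regular_vi]] \<alpha> by simp
  have "ennreal (vi \<alpha> n x) \<le> (\<Sum>t<n. ennreal (\<alpha> ^ t) * R.stage_cost t)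
      + ennreal (\<alpha> ^ n) * R.expect n (\<lambda>z. ennreal (f0 (fst z)))" for n
    using run_lower[OF p x \<alpha>, of 0 n] R.expect_state_0[OF vm] by simp
  then show ?thesis
    by (intro LIMSEQ_le[OF tendsto_ennrealI[OF vi_tendsto[OF \<alpha> x]] run_limit[OF p x \<alpha> True]]) auto
qed (simp add: not_less top_unique)

text \<open>
  Comparison after one step instead of at the start. It shows that the action of an optimal
  stationary policy attains the minimum in the optimality equation, without a decomposition of the
  trajectory measure at time \<open>1\<close>.
\<close>

lemma stationary_first_step:
  assumes \<phi>: "\<phi> \<in> stationary_policies MM" and x: "x \<in> X" and \<alpha>: "a0 \<le> \<alpha>" "\<alpha> < 1"
    and fin: "disc_cost MM \<alpha> (stationary MM \<phi>) x < \<infinity>"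
  shows "ennreal ((if \<phi> x > 0 then K else 0) + Gf \<alpha> (v \<alpha>) (x + \<phi> x) - cbar * x)
    \<le> disc_cost MM \<alpha> (stationary MM \<phi>) x"
proof -
  let ?p = "stationary MM \<phi>"
  have p: "?p \<in> policies MM" using \<phi> by (rule stationary_in_policies)
  interpret R: mdp_run MM ?p x using mdp_run_MM[OF p x] .
  have \<alpha>': "\<alpha> \<le> 1" "0 \<le> \<alpha>" using \<alpha> a0 by auto
  note act = stationary_action[OF \<phi> x]
  note c' = measurable_compose[OF cost_measurable measurable_ennreal]
  let ?T = "\<lambda>n. (\<Sum>t<n. ennreal (\<alpha> ^ t) * R.stage_cost t) + ennreal (\<alpha> ^ n) * R.expect n (\<lambda>z. ennreal (f0 (fst z)))"
  have "ennreal ((if \<phi> x > 0 then K else 0) + Gf \<alpha> (vi \<alpha> n) (x + \<phi> x) - cbar * x) \<le> ?T (Suc n)" for n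
  proof -
    have f: "regular (vi \<alpha> n)" using regular_vi \<alpha>(1) \<alpha>'(1) by blast
    have fm: "(\<lambda>y. ennreal (vi \<alpha> n y)) \<in> borel_measurable (state_space MM)"
      using measurable_continuous_on_X[OF regular_continuous[OF f]] by simp
    have "R.expect (Suc 0) (\<lambda>z. ennreal (vi \<alpha> n (fst z))) = (\<integral>\<^sup>+y. ennreal (vi \<alpha> n y) \<partial>kern MM x (\<phi> x))"
      unfolding R.expect_state_Suc[OF fm]
      by (subst R.stationary_expect_0[OF refl \<phi> R.measurable_kern_integral[OF fm]]) simp
    moreover have "R.stage_cost 0 = ennreal (cost MM x (\<phi> x))"
      unfolding R.stage_cost_def by (subst R.stationary_expect_0[OF refl \<phi> c']) simp
    ultimately have "ennreal (cost MM x (\<phi> x)) + ennreal \<alpha> * (\<integral>\<^sup>+y. ennreal (vi \<alpha> n y) \<partial>kern MM x (\<phi> x)) \<le> ?T (Suc n)"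
      using run_lower[OF p x \<alpha>, of 1 "Suc n"] by (simp del: MM_simps)
    then show ?thesis unfolding one_step[OF f x act \<alpha>'(2)] .
  qed
  moreover have "(\<lambda>n. ?T (Suc n)) \<longlonglongrightarrow> disc_cost MM \<alpha> ?p x"
    using run_limit[OF p x \<alpha> fin] by (rule LIMSEQ_Suc)
  moreover have "(\<lambda>n. Gf \<alpha> (vi \<alpha> n) (x + \<phi> x)) \<longlonglongrightarrow> Gf \<alpha> (v \<alpha>) (x + \<phi> x)"
    using regular_vi[OF \<alpha>(1) \<alpha>'(1)] vi_tendsto[OF \<alpha>] X_add[OF x act(1)] \<alpha>' by (intro Gf_limit) auto
  then have "(\<lambda>n. ennreal ((if \<phi> x > 0 then K else 0) + Gf \<alpha> (vi \<alpha> n) (x + \<phi> x) - cbar * x))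
      \<longlonglongrightarrow> ennreal ((if \<phi> x > 0 then K else 0) + Gf \<alpha> (v \<alpha>) (x + \<phi> x) - cbar * x)"
    by (intro tendsto_ennrealI tendsto_intros)
  ultimately show ?thesis by (intro LIMSEQ_le) auto
qed

lemma sS_policy_value:
  assumes o: "sS_optimal X K G s S" and x: "x \<in> X"
  shows "(if sS_policy s S x > 0 then K else 0) + G (x + sS_policy s S x) = order_value X K G x"
  using o unfolding order_value_sS[OF o K_nonneg x] by (auto simp: sS_policy_def sS_optimal_def)

lemma sS_policy_disc_cost_le:
  assumes o: "sS_optimal X K (Gf \<alpha> (v \<alpha>)) s S" and x: "x \<in> X" and \<alpha>: "a0 \<le> \<alpha>" "\<alpha> < 1"
  shows "disc_cost MM \<alpha> (stationary MM (sS_policy s S)) x \<le> ennreal (v \<alpha> x)"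
proof -
  have st: "sS_policy s S \<in> stationary_policies MM"
    using o by (intro sS_policy_stationary) (auto simp: sS_optimal_def argmin_on_def)
  then have p: "stationary MM (sS_policy s S) \<in> policies MM" by (rule stationary_in_policies)
  interpret R: mdp_run MM "stationary MM (sS_policy s S)" x using mdp_run_MM[OF p x] .
  have \<alpha>0: "0 \<le> \<alpha>" using \<alpha> a0 by simp
  have vm: "(\<lambda>y. ennreal (v \<alpha> y)) \<in> borel_measurable (state_space MM)"
    using measurable_continuous_on_X[OF regular_continuous[OF regular_v[OF \<alpha>]]] by simp
  show ?thesis
  proof (rule R.stationary_disc_cost_le[OF refl st cost_measurable vm \<alpha>0])
    fix y assume "y \<in> states MM"
    then have y: "y \<in> X" by simp
    show "ennreal (cost MM y (sS_policy s S y))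
        + ennreal \<alpha> * (\<integral>\<^sup>+y'. ennreal (v \<alpha> y') \<partial>kern MM y (sS_policy s S y)) \<le> ennreal (v \<alpha> y)"
      unfolding one_step[OF regular_v[OF \<alpha>] y stationary_action[OF st y] \<alpha>0] sS_policy_value[OF o y]
      using v_fixed_point[OF \<alpha> y] by (simp add: bellman_def)
  qed
qed

lemma disc_value_eq:
  assumes \<alpha>: "a0 \<le> \<alpha>" "\<alpha> < 1" and x: "x \<in> X"
  shows "disc_value MM \<alpha> x = ennreal (v \<alpha> x)"
proof (rule antisym)
  obtain s S where o: "sS_optimal X K (Gf \<alpha> (v \<alpha>)) s S"
    using bellman_policy[OF regular_v[OF \<alpha>] \<alpha>(1)] \<alpha> by (metis less_imp_le)
  have "stationary MM (sS_policy s S) \<in> policies MM"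
    using o by (intro stationary_in_policies sS_policy_stationary) (auto simp: sS_optimal_def argmin_on_def)
  then show "disc_value MM \<alpha> x \<le> ennreal (v \<alpha> x)"
    unfolding disc_value_def using sS_policy_disc_cost_le[OF o x \<alpha>]
    by (rule INF_lower2[of "stationary MM (sS_policy s S)"])
  show "ennreal (v \<alpha> x) \<le> disc_value MM \<alpha> x"
    unfolding disc_value_def using v_le_disc_cost[OF _ x \<alpha>] by (rule INF_greatest)
qed

lemma disc_optimal_sS:
  assumes o: "sS_optimal X K (Gf \<alpha> (v \<alpha>)) s S" and \<alpha>: "a0 \<le> \<alpha>" "\<alpha> < 1"
  shows "disc_optimal MM \<alpha> (stationary MM (sS_policy s S))"
  unfolding disc_optimal_def
proof (intro conjI ballI)
  show p: "stationary MM (sS_policy s S) \<in> policies MM"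
    using o by (intro stationary_in_policies sS_policy_stationary) (auto simp: sS_optimal_def argmin_on_def)
  fix x assume "x \<in> states MM"
  then have x: "x \<in> X" by simp
  show "disc_cost MM \<alpha> (stationary MM (sS_policy s S)) x = disc_value MM \<alpha> x"
    unfolding disc_value_eq[OF \<alpha> x]
    using sS_policy_disc_cost_le[OF o x \<alpha>] v_le_disc_cost[OF p x \<alpha>] by (rule antisym)
qed

text \<open>
  Conversely, the levels of an optimal \<open>(s, S)\<close> policy solve the one-step problem: from below \<open>s\<close>
  the policy orders up to \<open>S\<close> at every state, so \<open>S\<close> beats every other level.
\<close>

lemma disc_optimal_sS_imp:
  assumes opt: "disc_optimal MM \<alpha> (stationary MM (sS_policy s S))" and X: "s \<in> X" "S \<in> X" "s \<le> S"
    and \<alpha>: "a0 \<le> \<alpha>" "\<alpha> < 1"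
  shows "sS_optimal X K (Gf \<alpha> (v \<alpha>)) s S"
proof -
  let ?G = "Gf \<alpha> (v \<alpha>)"
  have st: "sS_policy s S \<in> stationary_policies MM" by (rule sS_policy_stationary[OF X])
  have le: "(if sS_policy s S x > 0 then K else 0) + ?G (x + sS_policy s S x) - cbar * x \<le> bellman \<alpha> (v \<alpha>) x"
    if x: "x \<in> X" for x
  proof -
    have "disc_cost MM \<alpha> (stationary MM (sS_policy s S)) x = ennreal (v \<alpha> x)"
      using opt x disc_value_eq[OF \<alpha> x] by (simp add: disc_optimal_def)
    then show ?thesis
      using stationary_first_step[OF st x \<alpha>] regular_nonneg[OF regular_v[OF \<alpha>] x] v_fixed_point[OF \<alpha> x]
      by simp
  qed
  note b = bellman_le[OF regular_v[OF \<alpha>] \<alpha>(1) less_imp_le[OF \<alpha>(2)]]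
  have below: "K + ?G S \<le> cbar * x + bellman \<alpha> (v \<alpha>) x" if "x \<in> X" "x < s" for x
    using le[OF that(1)] that X by (simp add: sS_policy_def)
  have above: "?G x \<le> cbar * x + bellman \<alpha> (v \<alpha>) x" if "x \<in> X" "s \<le> x" for x
    using le[OF that(1)] that by (simp add: sS_policy_def)
  have "?G S \<le> ?G y" if y: "y \<in> X" for y
  proof -
    have x: "min s y - 1 \<in> X" "min s y - 1 < s" "min s y - 1 \<le> y"
      using X y X_diff[OF _ X_1] by (auto simp: min_def)
    show ?thesis using below[OF x(1,2)] b(2)[OF x(1) y x(3)] by simp
  qed
  moreover have "K + ?G S \<le> ?G x" if "x \<in> X" "x < s" for x
    using below[OF that] b(1)[OF that(1)] by simp
  moreover have "?G x \<le> K + ?G y" if "x \<in> X" "y \<in> X" "s \<le> x" "x \<le> y" for x y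
    using above[OF that(1,3)] b(2)[OF that(1,2,4)] by simp
  ultimately show ?thesis using X by (auto simp: sS_optimal_def argmin_on_def)
qed

end

section \<open>Relative value functions and the vanishing discount limit\<close>

context inventory_low
begin

lemma regular_diff_const:
  assumes f: "regular f" and c: "\<And>x. x \<in> X \<Longrightarrow> c \<le> f x"
  shows "regular (\<lambda>x. f x - c)"
  unfolding regular_def
proof (intro conjI)
  show "K_convex_on X K (\<lambda>x. f x - c)"
    using regular_convex[OF f] unfolding K_convex_on_def by (fastforce simp: algebra_simps)
  show "\<forall>x\<in>X. 0 \<le> f x - c" using c by simp
  show "\<forall>x\<in>X. \<forall>y\<in>X. x \<le> y \<longrightarrow> f x - c \<le> f y - c + K + cbar * (y - x)"
    using regular_order[OF f] by fastforce
  show "\<forall>x\<in>X. \<forall>y\<in>X. x \<le> y \<and> y \<le> z0 \<longrightarrow> cbar * (y - x) \<le> f x - c - (f y - c)"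
    using regular_low[OF f] by simp
  show "\<forall>b\<in>X. \<forall>x\<in>X. \<forall>y\<in>X. x \<le> y \<and> y \<le> b \<and> y \<le> x + 1 \<longrightarrow>
      \<bar>f y - c - (f x - c)\<bar> \<le> (y - x) * (cbar + slope b * lyap y)"
    using regular_step[OF f] by simp
qed

definition m :: "real \<Rightarrow> real" where "m \<alpha> = Inf (v \<alpha> ` X)"

definition u :: "real \<Rightarrow> real \<Rightarrow> real" where "u \<alpha> x = v \<alpha> x - m \<alpha>"

context
  fixes \<alpha> :: real
  assumes \<alpha>: "a0 \<le> \<alpha>" "\<alpha> < 1"
begin

lemma m_le: "x \<in> X \<Longrightarrow> m \<alpha> \<le> v \<alpha> x"
  unfolding m_def using regular_nonneg[OF regular_v[OF \<alpha>]] by (intro cInf_lower bdd_belowI2[of _ 0]) auto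

lemma m_nonneg: "0 \<le> m \<alpha>"
  unfolding m_def using regular_nonneg[OF regular_v[OF \<alpha>]] X_0 by (intro cInf_greatest) auto

lemma m_approx: "0 < \<epsilon> \<Longrightarrow> \<exists>x\<in>X. v \<alpha> x < m \<alpha> + \<epsilon>"
  using cInf_lessD[of "v \<alpha> ` X" "m \<alpha> + \<epsilon>"] X_0 unfolding m_def by auto

lemma m_bound: "(1 - \<alpha>) * m \<alpha> \<le> base_cost 0"
proof -
  have "(1 - \<alpha>) * m \<alpha> \<le> (1 - \<alpha>) * v \<alpha> 0" using \<alpha> by (intro mult_left_mono m_le X_0) simp
  also have "\<dots> \<le> base_cost 0" by (rule v_le_base_cost[OF \<alpha> X_0])
  finally show ?thesis .
qed

lemma disc_min_eq: "disc_min MM \<alpha> = ennreal (m \<alpha>)"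
proof -
  have "disc_min MM \<alpha> = (INF x\<in>X. ennreal (v \<alpha> x))"
    unfolding disc_min_def using disc_value_eq[OF \<alpha>] by (intro INF_cong) auto
  also have "\<dots> = ennreal (m \<alpha>)"
  proof (rule antisym)
    show "ennreal (m \<alpha>) \<le> (INF x\<in>X. ennreal (v \<alpha> x))"
      using m_le by (intro INF_greatest ennreal_leI)
    show "(INF x\<in>X. ennreal (v \<alpha> x)) \<le> ennreal (m \<alpha>)"
    proof (rule ennreal_le_epsilon)
      fix \<epsilon> :: real assume "0 < \<epsilon>"
      then obtain x where x: "x \<in> X" "v \<alpha> x < m \<alpha> + \<epsilon>" using m_approx by blast
      have "(INF x\<in>X. ennreal (v \<alpha> x)) \<le> ennreal (v \<alpha> x)" using x(1) by (rule INF_lower)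
      also have "\<dots> \<le> ennreal (m \<alpha> + \<epsilon>)" using x by (intro ennreal_leI) simp
      also have "\<dots> = ennreal (m \<alpha>) + ennreal \<epsilon>" using m_nonneg \<open>0 < \<epsilon>\<close> by (simp add: ennreal_plus)
      finally show "(INF x\<in>X. ennreal (v \<alpha> x)) \<le> ennreal (m \<alpha>) + ennreal \<epsilon>" .
    qed
  qed
  finally show ?thesis .
qed

lemma rel_disc_value_eq: "x \<in> X \<Longrightarrow> rel_disc_value MM \<alpha> x = ennreal (u \<alpha> x)"
  using m_nonneg by (simp add: rel_disc_value_def disc_value_eq[OF \<alpha>] disc_min_eq u_def ennreal_minus)

lemma regular_u: "regular (u \<alpha>)"
  using regular_diff_const[OF regular_v[OF \<alpha>] m_le] by (simp add: u_def[abs_def])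

lemma Gf_u: "y \<in> X \<Longrightarrow> Gf \<alpha> (u \<alpha>) y = Gf \<alpha> (v \<alpha>) y - \<alpha> * m \<alpha>"
  using regular_integrable[OF regular_v[OF \<alpha>], of y]
  by (simp add: Gf_def Ef_def u_def prob_space right_diff_distrib)

lemma sS_optimal_u: "sS_optimal X K (Gf \<alpha> (u \<alpha>)) s S \<longleftrightarrow> sS_optimal X K (Gf \<alpha> (v \<alpha>)) s S"
proof -
  have "argmin_on X (Gf \<alpha> (u \<alpha>)) = argmin_on X (Gf \<alpha> (v \<alpha>))"
    using Gf_u by (auto simp: argmin_on_def)
  then show ?thesis
    unfolding sS_optimal_def using Gf_u by (auto simp: argmin_on_def)
qed

lemma bellman_u:
  assumes x: "x \<in> X"
  shows "(1 - \<alpha>) * m \<alpha> + u \<alpha> x = bellman \<alpha> (u \<alpha>) x"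
proof -
  obtain s S where o: "sS_optimal X K (Gf \<alpha> (v \<alpha>)) s S"
    using bellman_policy[OF regular_v[OF \<alpha>] \<alpha>(1)] \<alpha> by (metis less_imp_le)
  have S: "S \<in> X" using o by (auto simp: sS_optimal_def argmin_on_def)
  have "bellman \<alpha> (u \<alpha>) x = bellman \<alpha> (v \<alpha>) x - \<alpha> * m \<alpha>"
    using bellman_eq[OF o x] bellman_eq[OF iffD2[OF sS_optimal_u o] x] Gf_u[OF x] Gf_u[OF S] by simp
  then show ?thesis using v_fixed_point[OF \<alpha> x] by (simp add: u_def algebra_simps)
qed

end

text \<open>
  Far to the right the one-step cost alone exceeds \<open>(1 - \<alpha>) * m \<alpha>\<close>, so the infimum \<open>m \<alpha>\<close> is
  approached below a level \<open>b\<close> that does not depend on \<open>\<alpha>\<close>; there, \<open>v \<alpha>\<close> is at least its value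
  at the minimizer \<open>S\<close> up to a constant, since every state can at best move to \<open>S\<close> at unit cost.
\<close>

lemma u_bounded: "\<exists>U. \<forall>\<alpha> x. a0 \<le> \<alpha> \<and> \<alpha> < 1 \<and> x \<in> X \<longrightarrow> u \<alpha> x \<le> U x"
proof -
  obtain b where b: "\<forall>y\<in>X. b \<le> y \<longrightarrow> base_cost 0 + 1 < e y" using e_coercive by blast
  obtain c where c: "c \<in> X" "B0 \<le> c" using X_int[of "\<lceil>B0\<rceil>"] le_of_int_ceiling[of B0] by blast
  define b1 where "b1 = max b B0"
  define U where "U x = (\<bar>x\<bar> + \<bar>z0\<bar> + \<bar>B0\<bar>) * lip (max x c) + cbar * (\<bar>b1\<bar> + \<bar>z0\<bar>) + 1" for x
  have "u \<alpha> x \<le> U x"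
    if \<alpha>: "a0 \<le> \<alpha>" "\<alpha> < 1" and x: "x \<in> X" for \<alpha> x
  proof -
    have \<alpha>': "\<alpha> \<le> 1" "0 \<le> \<alpha>" using \<alpha> a0 by auto
    let ?G = "Gf \<alpha> (v \<alpha>)"
    obtain s S where o: "sS_optimal X K ?G s S" and S0: "z0 \<le> S" "S \<le> B0"
      using bellman_policy[OF regular_v[OF \<alpha>] \<alpha>(1) \<alpha>'(1)] by blast
    have S: "S \<in> X" "\<And>y. y \<in> X \<Longrightarrow> ?G S \<le> ?G y" and sS: "s \<le> S"
      using o by (auto simp: sS_optimal_def argmin_on_def)
    have veq: "v \<alpha> y = (if y < s then K + ?G S else ?G y) - cbar * y" if "y \<in> X" for y
      using v_fixed_point[OF \<alpha> that] bellman_eq[OF o that] by simp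
    have vlow: "?G S - cbar * y \<le> v \<alpha> y" if "y \<in> X" for y
      using S(2)[OF that] K_nonneg by (simp add: veq[OF that])
    obtain y where y: "y \<in> X" "v \<alpha> y < m \<alpha> + 1" using m_approx[OF \<alpha>, of 1] by auto
    have "y \<le> b1"
    proof (rule ccontr)
      assume "\<not> y \<le> b1"
      then have yb: "b < y" "B0 < y" by (auto simp: b1_def)
      have "\<alpha> * (m \<alpha>) \<le> \<alpha> * Ef (v \<alpha>) y"
      proof (intro mult_left_mono \<alpha>')
        have "(\<integral>\<omega>. m \<alpha> \<partial>P) \<le> Ef (v \<alpha>) y"
          unfolding Ef_def using regular_integrable[OF regular_v[OF \<alpha>] y(1)] m_le[OF \<alpha> shift_X[OF y(1)]]
          by (intro integral_mono) auto
        then show "m \<alpha> \<le> Ef (v \<alpha>) y" by (simp add: prob_space)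
      qed
      moreover have "(1 - \<alpha>) * m \<alpha> + 1 < e y" using b y(1) yb m_bound[OF \<alpha>] by fastforce
      moreover have "v \<alpha> y = e y + \<alpha> * Ef (v \<alpha>) y"
        using veq[OF y(1)] yb S0 sS by (simp add: Gf_def)
      ultimately show False using y(2) by (simp add: algebra_simps)
    qed
    then have "cbar * y \<le> cbar * b1" using cbar_pos by simp
    then have "?G S - cbar * b1 - 1 \<le> m \<alpha>" using vlow[OF y(1)] y(2) by simp
    moreover have "v \<alpha> S = ?G S - cbar * S" using veq[OF S(1)] sS by simp
    moreover have "v \<alpha> x \<le> v \<alpha> S + (\<bar>x\<bar> + \<bar>z0\<bar> + \<bar>B0\<bar>) * lip (max x c)"
    proof -
      have cX: "max x c \<in> X" using x c by (simp add: max_def)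
      have "\<bar>v \<alpha> x - v \<alpha> S\<bar> \<le> \<bar>x - S\<bar> * lip (max x c)"
      proof (cases "x \<le> S")
        case True
        then show ?thesis
          using regular_Lipschitz[OF regular_v[OF \<alpha>] x S(1) cX True] S0 c by (simp add: abs_minus_commute)
      next
        case False
        then show ?thesis
          using regular_Lipschitz[OF regular_v[OF \<alpha>] S(1) x cX] by simp
      qed
      also have "\<dots> \<le> (\<bar>x\<bar> + \<bar>z0\<bar> + \<bar>B0\<bar>) * lip (max x c)"
        using S0 lip_nonneg[OF cX] by (intro mult_right_mono) auto
      finally show ?thesis by simp
    qed
    moreover have "cbar * (b1 - S) \<le> cbar * (\<bar>b1\<bar> + \<bar>z0\<bar>)"
      using S0 cbar_pos by (intro mult_left_mono) auto
    ultimately show ?thesis by (simp add: u_def U_def algebra_simps)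
  qed
  then show ?thesis by (intro exI[of _ U]) simp
qed

lemma dense_countable: "x \<in> X \<Longrightarrow> 0 < \<epsilon> \<Longrightarrow> \<exists>q\<in>X \<inter> \<rat>. \<bar>q - x\<bar> < \<epsilon>"
proof -
  assume x: "x \<in> X" and \<epsilon>: "0 < \<epsilon>"
  show ?thesis
  proof (cases "X = UNIV")
    case True
    obtain q where "q \<in> \<rat>" "x - \<epsilon> < q" "q < x + \<epsilon>" using Rats_dense_in_real[of "x - \<epsilon>" "x + \<epsilon>"] \<epsilon> by auto
    then show ?thesis using True by (intro bexI[of _ q]) auto
  next
    case False
    then have "x \<in> \<rat>" using X_cases x Ints_subset_Rats by auto
    then show ?thesis using x \<epsilon> by (intro bexI[of _ x]) auto
  qed
qed

lemma u_Lipschitz: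
  assumes \<alpha>: "a0 \<le> \<alpha>" "\<alpha> < 1" and X: "x \<in> X" "z \<in> X" "\<bar>z - x\<bar> \<le> 1"
  shows "\<bar>u \<alpha> z - u \<alpha> x\<bar> \<le> lip (x + 1) * \<bar>z - x\<bar>"
proof (cases "z \<le> x")
  case True
  then show ?thesis
    using regular_Lipschitz[OF regular_u[OF \<alpha>] X(2,1) X_add[OF X(1) X_1]] by (simp add: abs_minus_commute mult.commute)
next
  case False
  then show ?thesis
    using regular_Lipschitz[OF regular_u[OF \<alpha>] X(1,2) X_add[OF X(1) X_1]] X by (simp add: mult.commute)
qed

text \<open>
  A diagonal sequence on the rational states, extended by equicontinuity. Dividing by \<open>1 + U x\<close> makes
  the pointwise bound uniform.
\<close>

lemma vanishing_discount:
  assumes \<beta>: "\<And>n. a0 \<le> \<beta> n" "\<And>n. \<beta> n < 1"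
  obtains r ut w where "strict_mono (r :: nat \<Rightarrow> nat)" "\<And>x. x \<in> X \<Longrightarrow> (\<lambda>n. u (\<beta> (r n)) x) \<longlonglongrightarrow> ut x"
    "(\<lambda>n. (1 - \<beta> (r n)) * m (\<beta> (r n))) \<longlonglongrightarrow> w"
proof -
  obtain U where U: "\<And>\<alpha> x. a0 \<le> \<alpha> \<Longrightarrow> \<alpha> < 1 \<Longrightarrow> x \<in> X \<Longrightarrow> u \<alpha> x \<le> U x" using u_bounded by blast
  have nn: "0 \<le> u (\<beta> n) x" if "x \<in> X" for n x using regular_nonneg[OF regular_u[OF \<beta>] that] .
  have "countable (X \<inter> \<rat>)" using countable_rat by (rule countable_subset[rotated]) simp
  moreover have "norm (u (\<beta> n) x / (1 + U x)) \<le> 1" if "x \<in> X \<inter> \<rat>" for n x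
    using U[OF \<beta>, of x n] nn[of x n] that by simp
  ultimately obtain k where k: "strict_mono k"
    and lim: "\<And>x. x \<in> X \<inter> \<rat> \<Longrightarrow> \<exists>l. (\<lambda>n. u (\<beta> (k n)) x / (1 + U x)) \<longlonglongrightarrow> l"
    using function_convergent_subsequence[of "X \<inter> \<rat>" "\<lambda>n x. u (\<beta> n) x / (1 + U x)" 1] by blast
  have rat: "Cauchy (\<lambda>n. u (\<beta> (k n)) q)" if q: "q \<in> X \<inter> \<rat>" for q
  proof -
    obtain l where "(\<lambda>n. u (\<beta> (k n)) q / (1 + U q)) \<longlonglongrightarrow> l" using lim[OF q] by blast
    then have "(\<lambda>n. u (\<beta> (k n)) q / (1 + U q) * (1 + U q)) \<longlonglongrightarrow> l * (1 + U q)" by (intro tendsto_intros)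
    moreover have "1 + U q \<noteq> 0" using U[OF \<beta>, of q 0] nn[of q 0] q by auto
    ultimately show ?thesis by (auto intro: LIMSEQ_imp_Cauchy)
  qed
  have "convergent (\<lambda>n. u (\<beta> (k n)) x)" if x: "x \<in> X" for x
  proof (rule Cauchy_convergent, rule metric_CauchyI)
    fix \<epsilon> :: real assume \<epsilon>: "0 < \<epsilon>"
    have l: "0 \<le> lip (x + 1)" by (rule lip_nonneg[OF X_add[OF x X_1]])
    obtain q where q: "q \<in> X \<inter> \<rat>" and qx: "\<bar>q - x\<bar> < min 1 (\<epsilon> / (3 * (lip (x + 1) + 1)))"
      using dense_countable[OF x, of "min 1 (\<epsilon> / (3 * (lip (x + 1) + 1)))"] \<epsilon> l by auto
    have close: "\<bar>u (\<beta> n) q - u (\<beta> n) x\<bar> < \<epsilon> / 3" for n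
    proof -
      have "\<bar>u (\<beta> n) q - u (\<beta> n) x\<bar> \<le> lip (x + 1) * \<bar>q - x\<bar>"
        using u_Lipschitz[OF \<beta> x] q qx by auto
      also have "\<dots> \<le> (lip (x + 1) + 1) * \<bar>q - x\<bar>" by (intro mult_right_mono) auto
      also have "\<dots> < (lip (x + 1) + 1) * (\<epsilon> / (3 * (lip (x + 1) + 1)))"
        using qx l by (intro mult_strict_left_mono) auto
      also have "\<dots> = \<epsilon> / 3" using l by (simp add: field_simps)
      finally show ?thesis .
    qed
    obtain N where N: "\<And>i j. i \<ge> N \<Longrightarrow> j \<ge> N \<Longrightarrow> dist (u (\<beta> (k i)) q) (u (\<beta> (k j)) q) < \<epsilon> / 3"
      using metric_CauchyD[OF rat[OF q], of "\<epsilon> / 3"] \<epsilon> by auto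
    have "dist (u (\<beta> (k i)) x) (u (\<beta> (k j)) x) < \<epsilon>" if ij: "i \<ge> N" "j \<ge> N" for i j
      using N[OF ij] close[of "k i"] close[of "k j"] unfolding dist_real_def by linarith
    then show "\<exists>N. \<forall>i\<ge>N. \<forall>j\<ge>N. dist (u (\<beta> (k i)) x) (u (\<beta> (k j)) x) < \<epsilon>" by blast
  qed
  then have lim_k: "(\<lambda>n. u (\<beta> (k n)) x) \<longlonglongrightarrow> lim (\<lambda>n. u (\<beta> (k n)) x)" if "x \<in> X" for x
    using that by (simp add: convergent_LIMSEQ_iff)
  have "seq_compact {0..base_cost 0}" by (intro compact_imp_seq_compact) simp
  moreover have "\<forall>n. (1 - \<beta> (k n)) * m (\<beta> (k n)) \<in> {0..base_cost 0}"
    using m_bound[OF \<beta>] m_nonneg[OF \<beta>] \<beta> by (simp add: less_imp_le)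
  ultimately obtain w k' where k': "strict_mono k'"
    and w: "((\<lambda>n. (1 - \<beta> (k n)) * m (\<beta> (k n))) \<circ> k') \<longlonglongrightarrow> w"
    by (rule seq_compactE)
  show ?thesis
  proof (rule that[of "k \<circ> k'"])
    show "strict_mono (k \<circ> k')" using k k' by (rule strict_mono_o)
    show "(\<lambda>n. (1 - \<beta> ((k \<circ> k') n)) * m (\<beta> ((k \<circ> k') n))) \<longlonglongrightarrow> w" using w by (simp add: comp_def)
    show "(\<lambda>n. u (\<beta> ((k \<circ> k') n)) x) \<longlonglongrightarrow> lim (\<lambda>n. u (\<beta> (k n)) x)" if "x \<in> X" for x
      using LIMSEQ_subseq_LIMSEQ[OF lim_k[OF that] k'] by (simp add: comp_def)
  qed
qed


section \<open>Average cost\<close>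

lemma acoe_limit:
  assumes \<beta>: "\<And>n. a0 \<le> \<beta> n" "\<And>n. \<beta> n < 1" "\<beta> \<longlonglongrightarrow> 1"
    and lim: "\<And>x. x \<in> X \<Longrightarrow> (\<lambda>n. u (\<beta> n) x) \<longlonglongrightarrow> ut x" and w: "(\<lambda>n. (1 - \<beta> n) * m (\<beta> n)) \<longlonglongrightarrow> w"
    and x: "x \<in> X"
  shows "w + ut x = bellman 1 ut x"
  by (rule bellman_limit[of "\<lambda>n. u (\<beta> n)" ut \<beta>, OF regular_u[OF \<beta>(1,2)] lim \<beta>(1) less_imp_le[OF \<beta>(2)] \<beta>(3) bellman_u[OF \<beta>(1,2) x] x w lim[OF x]])

lemma avg_cost_le:
  assumes f: "regular f" and \<phi>: "\<phi> \<in> stationary_policies MM" and x: "x \<in> X" and w: "0 \<le> w"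
    and acoe: "\<And>y. y \<in> X \<Longrightarrow> w + f y = (if \<phi> y > 0 then K else 0) + Gf 1 f (y + \<phi> y) - cbar * y"
  shows "avg_cost MM (stationary MM \<phi>) x \<le> ennreal w"
proof -
  have p: "stationary MM \<phi> \<in> policies MM" using \<phi> by (rule stationary_in_policies)
  interpret R: mdp_run MM "stationary MM \<phi>" x using mdp_run_MM[OF p x] .
  have fm: "(\<lambda>y. ennreal (f y)) \<in> borel_measurable (state_space MM)"
    using measurable_continuous_on_X[OF regular_continuous[OF f]] by simp
  have fx: "0 \<le> f x" by (rule regular_nonneg[OF f x])
  have le: "(\<Sum>t<N. R.stage_cost t) \<le> ennreal (f x + real N * w)" for N
  proof -
    have "(\<Sum>t<N. ennreal (1 ^ t) * R.stage_cost t) + ennreal (1 ^ N) * R.expect N (\<lambda>z. ennreal (f (fst z)))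
        \<le> ennreal (f x) + (\<Sum>t<N. ennreal (1 ^ t) * ennreal w)"
    proof (rule R.stationary_supersolution[OF refl \<phi> cost_measurable fm])
      fix y assume "y \<in> states MM"
      then have y: "y \<in> X" by simp
      show "ennreal (cost MM y (\<phi> y)) + ennreal 1 * (\<integral>\<^sup>+y'. ennreal (f y') \<partial>kern MM y (\<phi> y)) \<le> ennreal w + ennreal (f y)"
        unfolding one_step[OF f y stationary_action[OF \<phi> y] zero_le_one] acoe[OF y, symmetric]
        using w regular_nonneg[OF f y] by (simp add: ennreal_plus)
    qed simp
    also have "(\<Sum>t<N. ennreal (1 ^ t) * ennreal w) = ennreal (real N * w)"
      using w by (simp add: ennreal_mult ennreal_of_nat_eq_real_of_nat)
    also have "ennreal (f x) + ennreal (real N * w) = ennreal (f x + real N * w)"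
      using w fx by (simp add: ennreal_plus)
    finally have "(\<Sum>t<N. ennreal (1 ^ t) * R.stage_cost t) + ennreal (1 ^ N) * R.expect N (\<lambda>z. ennreal (f (fst z)))
        \<le> ennreal (f x + real N * w)" .
    then have "(\<Sum>t<N. ennreal (1 ^ t) * R.stage_cost t) \<le> ennreal (f x + real N * w)"
      by (rule order_trans[rotated]) simp
    then show ?thesis by simp
  qed
  have "avg_cost MM (stationary MM \<phi>) x = limsup (\<lambda>N. (\<Sum>t<N. R.stage_cost t) / of_nat N)"
    by (rule R.avg_cost_eq_limsup[OF cost_measurable])
  also have "\<dots> \<le> limsup (\<lambda>N. ennreal (f x / real N + w))"
  proof (rule Limsup_mono)
    show "eventually (\<lambda>N. (\<Sum>t<N. R.stage_cost t) / of_nat N \<le> ennreal (f x / real N + w)) sequentially"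
      using eventually_gt_at_top[of 0]
    proof eventually_elim
      case (elim N)
      have "(\<Sum>t<N. R.stage_cost t) / of_nat N \<le> ennreal (f x + real N * w) / of_nat N"
        using le by (rule divide_right_mono_ennreal)
      also have "\<dots> = ennreal ((f x + real N * w) / real N)"
        unfolding ennreal_of_nat_eq_real_of_nat using elim fx w by (intro divide_ennreal) auto
      also have "(f x + real N * w) / real N = f x / real N + w" using elim by (simp add: field_simps)
      finally show ?case .
    qed
  qed
  also have "\<dots> = ennreal w"
  proof (rule lim_imp_Limsup)
    have "(\<lambda>N. f x / real N + w) \<longlonglongrightarrow> 0 + w"
      by (intro tendsto_intros real_tendsto_divide_at_top[OF tendsto_const] filterlim_real_sequentially)
    then show "(\<lambda>N. ennreal (f x / real N + w)) \<longlonglongrightarrow> ennreal w" by (intro tendsto_ennrealI) simp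
  qed simp
  finally show ?thesis .
qed

text \<open>
  Summation by parts against \<open>D\<close>, the excess of the partial sums over \<open>A\<close> per step.
\<close>

lemma Abel_sum_bound:
  fixes r :: "nat \<Rightarrow> real"
  assumes r: "\<And>n. (\<Sum>t<n. r t) \<le> B + A * real n" and \<alpha>: "0 \<le> \<alpha>" "\<alpha> < 1" and A: "0 \<le> A" "0 \<le> B"
  shows "(\<Sum>t<n. \<alpha> ^ t * r t) \<le> B + A / (1 - \<alpha>)"
proof -
  define D where "D n = (\<Sum>t<n. r t) - A * real n" for n
  have D: "D n \<le> B" for n using r[of n] by (simp add: D_def)
  have geo: "(1 - \<alpha>) * (\<Sum>t<n. \<alpha> ^ t) = 1 - \<alpha> ^ n" for n
    by (rule one_diff_power_eq[symmetric])
  have "(\<Sum>t<n. \<alpha> ^ t * r t) = \<alpha> ^ n * D n + (1 - \<alpha>) * (\<Sum>t<n. \<alpha> ^ t * D (Suc t)) + A * (\<Sum>t<n. \<alpha> ^ t)"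
    by (induction n) (simp_all add: D_def algebra_simps)
  also have "\<dots> \<le> \<alpha> ^ n * B + (1 - \<alpha>) * (\<Sum>t<n. \<alpha> ^ t * B) + A * (\<Sum>t<n. \<alpha> ^ t)"
    using D \<alpha> by (intro add_mono[OF add_mono order_refl] mult_left_mono sum_mono) auto
  also have "(1 - \<alpha>) * (\<Sum>t<n. \<alpha> ^ t * B) = (1 - \<alpha> ^ n) * B"
    unfolding geo[symmetric] by (simp add: sum_distrib_right)
  also have "\<alpha> ^ n * B + (1 - \<alpha> ^ n) * B = B" by (simp add: algebra_simps)
  also have "A * (\<Sum>t<n. \<alpha> ^ t) \<le> A * (1 / (1 - \<alpha>))"
  proof (intro mult_left_mono A)
    have "(1 - \<alpha>) * (\<Sum>t<n. \<alpha> ^ t) \<le> 1" unfolding geo using \<alpha> by simp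
    then show "(\<Sum>t<n. \<alpha> ^ t) \<le> 1 / (1 - \<alpha>)" using \<alpha> by (simp add: field_simps)
  qed
  finally show ?thesis by simp
qed

text \<open>
  Eventually the cumulative cost of \<open>N\<close> steps is below \<open>A N\<close>. Abel summation turns this into a bound
  \<open>B + A / (1 - \<alpha>)\<close> for the discounted cost, which is at least \<open>m \<alpha>\<close>; the constant \<open>B\<close> is the cost
  of the first steps.
\<close>

lemma avg_cost_Abel:
  assumes p: "p \<in> policies MM" and x: "x \<in> X" and A: "avg_cost MM p x < ennreal A"
  shows "\<exists>B. \<forall>\<alpha>. a0 \<le> \<alpha> \<and> \<alpha> < 1 \<longrightarrow> (1 - \<alpha>) * m \<alpha> \<le> (1 - \<alpha>) * B + A"
proof -
  interpret R: mdp_run MM p x using mdp_run_MM[OF p x] .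
  let ?S = "\<lambda>N. \<Sum>t<N. R.stage_cost t"
  have A0: "0 \<le> A"
  proof (rule ccontr)
    assume "\<not> 0 \<le> A"
    then show False using A by (simp add: ennreal_neg)
  qed
  have "limsup (\<lambda>N. ?S N / of_nat N) < ennreal A"
    using A unfolding R.avg_cost_eq_limsup[OF cost_measurable] .
  then have "eventually (\<lambda>N. ?S N / of_nat N < ennreal A) sequentially"
    by (rule Limsup_lessD)
  then obtain N0 where N0: "\<And>N. N \<ge> N0 \<Longrightarrow> ?S N / of_nat N < ennreal A"
    by (auto simp: eventually_sequentially)
  have le: "?S N \<le> ennreal (A * real N)" if "N \<ge> N0" "N > 0" for N
  proof -
    have "?S N = ?S N * of_nat N / of_nat N"
      by (rule ennreal_mult_divide_eq[symmetric]) (use that in auto)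
    also have "\<dots> = ?S N / of_nat N * of_nat N"
      by (simp add: ennreal_times_divide mult.commute)
    also have "\<dots> \<le> ennreal A * of_nat N" using N0[OF that(1)] by (intro mult_right_mono) auto
    also have "\<dots> = ennreal (A * real N)" using A0 by (simp add: ennreal_mult ennreal_of_nat_eq_real_of_nat)
    finally show ?thesis .
  qed
  have mono: "?S N \<le> ?S N'" if "N \<le> N'" for N N'
    using that by (intro sum_mono2) auto
  have fin: "R.stage_cost t < \<infinity>" for t
  proof -
    have "R.stage_cost t \<le> ?S (Suc t)" by (simp add: add_increasing)
    also have "\<dots> \<le> ?S (Suc t + N0)" by (rule mono) simp
    also have "\<dots> \<le> ennreal (A * real (Suc t + N0))" by (rule le) auto
    also have "\<dots> < \<infinity>" by simp
    finally show ?thesis .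
  qed
  define r where "r t = enn2real (R.stage_cost t)" for t
  have r: "R.stage_cost t = ennreal (r t)" "0 \<le> r t" for t
    using fin[of t] by (simp_all add: r_def ennreal_enn2real)
  have S: "?S N = ennreal (\<Sum>t<N. r t)" for N using r by (simp add: sum_ennreal)
  define B where "B = (\<Sum>t<Suc N0. r t)"
  have B0: "0 \<le> B" unfolding B_def using r by (intro sum_nonneg) auto
  have rB: "(\<Sum>t<N. r t) \<le> B + A * real N" for N
  proof (cases "N \<ge> Suc N0")
    case True
    have "ennreal (\<Sum>t<N. r t) \<le> ennreal (A * real N)" using le[of N] True unfolding S by simp
    then have "(\<Sum>t<N. r t) \<le> A * real N" using A0 by (simp add: ennreal_le_iff)
    then show ?thesis using B0 by simp
  next
    case False
    then have "(\<Sum>t<N. r t) \<le> B" unfolding B_def using r by (intro sum_mono2) auto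
    then show ?thesis using A0 by (simp add: add_increasing2)
  qed
  have "(1 - \<alpha>) * m \<alpha> \<le> (1 - \<alpha>) * B + A" if \<alpha>: "a0 \<le> \<alpha>" "\<alpha> < 1" for \<alpha>
  proof -
    have \<alpha>0: "0 \<le> \<alpha>" using \<alpha> a0 by simp
    have "disc_cost MM \<alpha> p x \<le> ennreal (B + A / (1 - \<alpha>))"
      unfolding R.disc_cost_eq_suminf[OF cost_measurable \<alpha>0]
    proof (rule suminf_le_const)
      fix n
      have "(\<Sum>t<n. ennreal (\<alpha> ^ t) * R.stage_cost t) = ennreal (\<Sum>t<n. \<alpha> ^ t * r t)"
        using r \<alpha>0 by (simp add: sum_ennreal ennreal_mult[symmetric])
      also have "\<dots> \<le> ennreal (B + A / (1 - \<alpha>))"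
        by (intro ennreal_leI Abel_sum_bound rB \<alpha>0 \<alpha> A0 B0)
      finally show "(\<Sum>t<n. ennreal (\<alpha> ^ t) * R.stage_cost t) \<le> ennreal (B + A / (1 - \<alpha>))" .
    qed simp
    then have "ennreal (v \<alpha> x) \<le> ennreal (B + A / (1 - \<alpha>))" using v_le_disc_cost[OF p x \<alpha>] by simp
    moreover have "0 \<le> B + A / (1 - \<alpha>)" using A0 B0 \<alpha> by simp
    ultimately have "v \<alpha> x \<le> B + A / (1 - \<alpha>)" by (rule iffD1[OF ennreal_le_iff, rotated])
    then have "m \<alpha> \<le> B + A / (1 - \<alpha>)" using m_le[OF \<alpha> x] by simp
    then have "(1 - \<alpha>) * m \<alpha> \<le> (1 - \<alpha>) * (B + A / (1 - \<alpha>))" using \<alpha> by (intro mult_left_mono) auto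
    also have "\<dots> = (1 - \<alpha>) * B + A" using \<alpha> by (simp add: field_simps)
    finally show ?thesis .
  qed
  then show ?thesis by blast
qed

lemma avg_cost_ge_limit:
  assumes p: "p \<in> policies MM" and x: "x \<in> X"
    and \<beta>: "\<And>n. a0 \<le> \<beta> n" "\<And>n. \<beta> n < 1" "\<beta> \<longlonglongrightarrow> 1" and w: "(\<lambda>n. (1 - \<beta> n) * m (\<beta> n)) \<longlonglongrightarrow> w"
  shows "ennreal w \<le> avg_cost MM p x"
proof (rule ccontr)
  assume "\<not> ennreal w \<le> avg_cost MM p x"
  then have "avg_cost MM p x < ennreal w" by simp
  then obtain A' where A': "avg_cost MM p x < A'" "A' < ennreal w" using dense by blast
  define A where "A = enn2real A'"
  have A: "A' = ennreal A" using A' unfolding A_def by (metis ennreal_enn2real ennreal_less_top less_trans)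
  have Aw: "A < w" using A'(2) unfolding A by (simp add: A_def ennreal_less_iff)
  obtain B where B: "\<And>\<alpha>. a0 \<le> \<alpha> \<Longrightarrow> \<alpha> < 1 \<Longrightarrow> (1 - \<alpha>) * m \<alpha> \<le> (1 - \<alpha>) * B + A"
    using avg_cost_Abel[OF p x A'(1)[unfolded A]] by blast
  have "(\<lambda>n. (1 - \<beta> n) * B + A) \<longlonglongrightarrow> (1 - 1) * B + A" by (intro tendsto_intros \<beta>)
  then have "w \<le> (1 - 1) * B + A" by (rule LIMSEQ_le[OF w]) (use B[OF \<beta>(1,2)] in auto)
  then show False using Aw by simp
qed

end

context inventory_low
begin

lemma acoe_policy:
  assumes f: "regular f" and acoe: "\<And>y. y \<in> X \<Longrightarrow> w + f y = bellman 1 f y"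
    and o: "sS_optimal X K (Gf 1 f) s S" and y: "y \<in> X"
  shows "w + f y = (if sS_policy s S y > 0 then K else 0) + Gf 1 f (y + sS_policy s S y) - cbar * y"
  unfolding acoe[OF y] bellman_def sS_policy_value[OF o y] by simp

lemma sS_optimal_1_exists: "regular f \<Longrightarrow> \<exists>s S. sS_optimal X K (Gf 1 f) s S"
  using bellman_policy[of f 1] a0 by (metis less_imp_le order_refl)

text \<open>
  Along \<open>\<beta>\<close> there is a stationary policy of average cost at most \<open>w\<close>, while by the Abelian comparison
  no policy has an average cost below \<open>w'\<close>.
\<close>

lemma limit_unique:
  assumes \<beta>: "\<And>n. a0 \<le> \<beta> n" "\<And>n. \<beta> n < 1" "\<beta> \<longlonglongrightarrow> 1" and w: "(\<lambda>n. (1 - \<beta> n) * m (\<beta> n)) \<longlonglongrightarrow> w"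
    and \<gamma>: "\<And>n. a0 \<le> \<gamma> n" "\<And>n. \<gamma> n < 1" "\<gamma> \<longlonglongrightarrow> 1" and w': "(\<lambda>n. (1 - \<gamma> n) * m (\<gamma> n)) \<longlonglongrightarrow> w'"
  shows "w' \<le> w"
proof -
  obtain r ut w1 where r: "strict_mono r" and ut: "\<And>x. x \<in> X \<Longrightarrow> (\<lambda>n. u (\<beta> (r n)) x) \<longlonglongrightarrow> ut x"
    and w1: "(\<lambda>n. (1 - \<beta> (r n)) * m (\<beta> (r n))) \<longlonglongrightarrow> w1"
    by (rule vanishing_discount[of \<beta>, OF \<beta>(1,2)]) (rule that)
  have w1_eq: "w1 = w" by (rule LIMSEQ_unique[OF w1 LIMSEQ_subseq_LIMSEQ[OF w r, unfolded comp_def]])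
  have \<beta>r: "(\<lambda>n. \<beta> (r n)) \<longlonglongrightarrow> 1" using LIMSEQ_subseq_LIMSEQ[OF \<beta>(3) r] unfolding comp_def .
  have f: "regular ut" by (rule regular_limit[of "\<lambda>n. u (\<beta> (r n))", OF regular_u[OF \<beta>(1,2)] ut])
  have acoe: "w + ut y = bellman 1 ut y" if "y \<in> X" for y
    using acoe_limit[of "\<lambda>n. \<beta> (r n)", OF \<beta>(1,2) \<beta>r ut w1 that] unfolding w1_eq .
  obtain s S where o: "sS_optimal X K (Gf 1 ut) s S" using sS_optimal_1_exists[OF f] by blast
  have st: "sS_policy s S \<in> stationary_policies MM"
    using o by (intro sS_policy_stationary) (auto simp: sS_optimal_def argmin_on_def)
  have w0: "0 \<le> w" by (rule LIMSEQ_le_const[OF w]) (use m_nonneg[OF \<beta>(1,2)] \<beta>(2) in \<open>auto simp: less_imp_le\<close>)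
  have "ennreal w' \<le> avg_cost MM (stationary MM (sS_policy s S)) 0"
    by (rule avg_cost_ge_limit[of _ _ \<gamma>, OF stationary_in_policies[OF st] X_0 \<gamma> w'])
  also have "\<dots> \<le> ennreal w" by (rule avg_cost_le[OF f st X_0 w0 acoe_policy[OF f acoe o]])
  finally show ?thesis using w0 by (simp add: ennreal_le_iff)
qed

lemma discounts_to_1:
  "\<exists>\<beta> :: nat \<Rightarrow> real. (\<forall>n. a0 \<le> \<beta> n \<and> \<beta> n < 1) \<and> \<beta> \<longlonglongrightarrow> 1"
proof -
  define \<beta> where "\<beta> n = 1 - (1 - a0) / real (Suc n)" for n
  have \<beta>: "a0 \<le> \<beta> n" "\<beta> n < 1" for n
  proof -
    have "(1 - a0) / real (Suc n) \<le> 1 - a0"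
      using a0 mult_right_mono[of a0 1 "real n"] by (simp add: field_simps)
    then show "a0 \<le> \<beta> n" unfolding \<beta>_def by linarith
    have "0 < (1 - a0) / real (Suc n)" using a0 by simp
    then show "\<beta> n < 1" unfolding \<beta>_def by linarith
  qed
  have "(\<lambda>n. 1 - (1 - a0) * inverse (real (Suc n))) \<longlonglongrightarrow> 1 - (1 - a0) * 0"
    by (intro tendsto_intros LIMSEQ_inverse_real_of_nat)
  moreover have "\<beta> = (\<lambda>n. 1 - (1 - a0) * inverse (real (Suc n)))"
    by (rule ext) (simp add: \<beta>_def divide_inverse)
  ultimately have \<beta>1: "\<beta> \<longlonglongrightarrow> 1" by simp
  show ?thesis using \<beta> \<beta>1 by blast
qed

text \<open>
  Every sequence has a subsequence along which \<open>(1 - \<alpha>) m \<alpha>\<close> converges, and all these limits agree.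
\<close>

lemma discounted_min_limit:
  "\<exists>w\<ge>0. ((\<lambda>\<alpha>. (1 - \<alpha>) * m \<alpha>) \<longlongrightarrow> w) (at_left 1)"
proof -
  obtain \<beta> :: "nat \<Rightarrow> real" where \<beta>: "\<And>n. a0 \<le> \<beta> n" "\<And>n. \<beta> n < 1" and \<beta>1: "\<beta> \<longlonglongrightarrow> 1"
    using discounts_to_1 by blast
  obtain r ut w where r: "strict_mono r" and "\<And>x. x \<in> X \<Longrightarrow> (\<lambda>n. u (\<beta> (r n)) x) \<longlonglongrightarrow> ut x"
    and w: "(\<lambda>n. (1 - \<beta> (r n)) * m (\<beta> (r n))) \<longlonglongrightarrow> w"
    by (rule vanishing_discount[of "\<lambda>n. \<beta> n", OF \<beta>(1,2)]) (rule that)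
  have \<beta>r: "(\<lambda>n. \<beta> (r n)) \<longlonglongrightarrow> 1" using LIMSEQ_subseq_LIMSEQ[OF \<beta>1 r] unfolding comp_def .
  have "((\<lambda>\<alpha>. (1 - \<alpha>) * m \<alpha>) \<longlongrightarrow> w) (at_left 1)"
  proof (rule tendsto_at_left_sequentially[OF a0(2)])
    fix \<gamma> :: "nat \<Rightarrow> real" assume \<gamma>: "\<And>n. \<gamma> n < 1" "\<And>n. a0 < \<gamma> n" "\<gamma> \<longlonglongrightarrow> 1"
    show "(\<lambda>n. (1 - \<gamma> n) * m (\<gamma> n)) \<longlonglongrightarrow> w"
    proof (rule ccontr)
      assume "\<not> ?thesis"
      then obtain \<epsilon> where \<epsilon>: "0 < \<epsilon>" "\<not> eventually (\<lambda>n. dist ((1 - \<gamma> n) * m (\<gamma> n)) w < \<epsilon>) sequentially"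
        unfolding tendsto_iff by blast
      define N where "N = {n. \<not> dist ((1 - \<gamma> n) * m (\<gamma> n)) w < \<epsilon>}"
      have "infinite N"
        using \<epsilon>(2) unfolding N_def eventually_sequentially infinite_nat_iff_unbounded_le by blast
      from infinite_enumerate[OF this] obtain k :: "nat \<Rightarrow> nat"
        where k: "strict_mono k" "\<forall>n. k n \<in> N" by blast
      have \<gamma>k: "a0 \<le> \<gamma> (k n)" "\<gamma> (k n) < 1" for n using \<gamma>(1,2)[of "k n"] by auto
      obtain k' ut' w' where k': "strict_mono k'"
        and "\<And>x. x \<in> X \<Longrightarrow> (\<lambda>n. u (\<gamma> (k (k' n))) x) \<longlonglongrightarrow> ut' x"
        and w': "(\<lambda>n. (1 - \<gamma> (k (k' n))) * m (\<gamma> (k (k' n)))) \<longlonglongrightarrow> w'"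
        by (rule vanishing_discount[of "\<lambda>n. \<gamma> (k n)", OF \<gamma>k]) (rule that)
      have \<gamma>1: "(\<lambda>n. \<gamma> (k (k' n))) \<longlonglongrightarrow> 1"
        using LIMSEQ_subseq_LIMSEQ[OF LIMSEQ_subseq_LIMSEQ[OF \<gamma>(3) k(1)] k'] unfolding comp_def .
      have "w' = w"
        using limit_unique[of "\<lambda>n. \<beta> (r n)" w "\<lambda>n. \<gamma> (k (k' n))" w', OF \<beta> \<beta>r w \<gamma>k \<gamma>1 w']
          limit_unique[of "\<lambda>n. \<gamma> (k (k' n))" w' "\<lambda>n. \<beta> (r n)" w, OF \<gamma>k \<gamma>1 w' \<beta> \<beta>r w] by simp
      moreover have "eventually (\<lambda>n. dist ((1 - \<gamma> (k (k' n))) * m (\<gamma> (k (k' n)))) w' < \<epsilon>) sequentially"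
        using tendstoD[OF w' \<epsilon>(1)] .
      ultimately show False using k(2) by (auto simp: N_def eventually_sequentially)
    qed
  qed
  moreover have "0 \<le> w"
    by (rule LIMSEQ_le_const[OF w]) (use m_nonneg[OF \<beta>] \<beta> in \<open>auto simp: less_imp_le\<close>)
  ultimately show ?thesis by (intro exI[of _ w] conjI)
qed

definition wbar :: real where
  "wbar = (SOME w. 0 \<le> w \<and> ((\<lambda>\<alpha>. (1 - \<alpha>) * m \<alpha>) \<longlongrightarrow> w) (at_left 1))"

lemma wbar: "0 \<le> wbar" "((\<lambda>\<alpha>. (1 - \<alpha>) * m \<alpha>) \<longlongrightarrow> wbar) (at_left 1)"
proof -
  have "0 \<le> wbar \<and> ((\<lambda>\<alpha>. (1 - \<alpha>) * m \<alpha>) \<longlongrightarrow> wbar) (at_left 1)"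
    unfolding wbar_def by (rule someI_ex[OF discounted_min_limit])
  then show "0 \<le> wbar" "((\<lambda>\<alpha>. (1 - \<alpha>) * m \<alpha>) \<longlongrightarrow> wbar) (at_left 1)" by (rule conjunct1, rule conjunct2)
qed

lemma wbar_sequence:
  assumes "\<And>n. \<beta> n < 1" "\<beta> \<longlonglongrightarrow> 1"
  shows "(\<lambda>n. (1 - \<beta> n) * m (\<beta> n)) \<longlonglongrightarrow> wbar"
proof -
  have "filterlim \<beta> (at_left 1) sequentially"
    unfolding filterlim_at using assms(1) by (intro conjI assms(2) always_eventually) (auto simp: less_le)
  from filterlim_compose[OF wbar(2) this] show ?thesis .
qed

lemma avg_const_eq: "avg_const MM = ennreal wbar"
  unfolding avg_const_def
proof (rule lim_imp_Liminf)
  have "((\<lambda>\<alpha>. ennreal ((1 - \<alpha>) * m \<alpha>)) \<longlongrightarrow> ennreal wbar) (at_left 1)"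
    by (intro tendsto_ennrealI wbar)
  moreover have "eventually (\<lambda>\<alpha>. ennreal ((1 - \<alpha>) * m \<alpha>) = ennreal (1 - \<alpha>) * disc_min MM \<alpha>) (at_left 1)"
    using eventually_at_left_real[OF a0(2)]
  proof eventually_elim
    case (elim \<alpha>)
    then show ?case using disc_min_eq[of \<alpha>] m_nonneg[of \<alpha>] by (simp add: ennreal_mult)
  qed
  ultimately show "((\<lambda>\<alpha>. ennreal (1 - \<alpha>) * disc_min MM \<alpha>) \<longlongrightarrow> ennreal wbar) (at_left 1)"
    by (rule Lim_transform_eventually)
qed simp

lemma avg_cost_ge: "p \<in> policies MM \<Longrightarrow> x \<in> X \<Longrightarrow> ennreal wbar \<le> avg_cost MM p x"
proof -
  assume p: "p \<in> policies MM" and x: "x \<in> X"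
  obtain \<beta> :: "nat \<Rightarrow> real" where \<beta>: "\<And>n. a0 \<le> \<beta> n" "\<And>n. \<beta> n < 1" and \<beta>1: "\<beta> \<longlonglongrightarrow> 1"
    using discounts_to_1 by blast
  show ?thesis by (rule avg_cost_ge_limit[of _ _ \<beta>, OF p x \<beta> \<beta>1 wbar_sequence[OF \<beta>(2) \<beta>1]])
qed

lemma acoe_avg_optimal:
  assumes f: "regular f" and \<phi>: "\<phi> \<in> stationary_policies MM"
    and acoe: "\<And>y. y \<in> X \<Longrightarrow> wbar + f y = (if \<phi> y > 0 then K else 0) + Gf 1 f (y + \<phi> y) - cbar * y"
  shows "avg_optimal MM (stationary MM \<phi>)"
    and "x \<in> X \<Longrightarrow> avg_value MM x = ennreal wbar"
proof -
  have p: "stationary MM \<phi> \<in> policies MM" using \<phi> by (rule stationary_in_policies)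
  have c: "avg_cost MM (stationary MM \<phi>) x = ennreal wbar" if "x \<in> X" for x
    using avg_cost_le[OF f \<phi> that wbar(1) acoe] avg_cost_ge[OF p that] by (rule antisym)
  have val: "avg_value MM x = ennreal wbar" if x: "x \<in> X" for x
    unfolding avg_value_def
  proof (rule antisym)
    show "(INF p\<in>policies MM. avg_cost MM p x) \<le> ennreal wbar"
      using p by (rule INF_lower2) (simp add: c[OF x])
    show "ennreal wbar \<le> (INF p\<in>policies MM. avg_cost MM p x)"
      using avg_cost_ge x by (intro INF_greatest)
  qed
  show "avg_optimal MM (stationary MM \<phi>)" unfolding avg_optimal_def using p c val by simp
  show "x \<in> X \<Longrightarrow> avg_value MM x = ennreal wbar" by (rule val)
qed

end

section \<open>The average-cost optimality equations\<close>

context inventory_low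
begin

definition rel_limit :: "(nat \<Rightarrow> real) \<Rightarrow> real \<Rightarrow> real" where
  "rel_limit \<beta> x = enn2real (avg_rel_value MM \<beta> x)"

definition acoe :: "(nat \<Rightarrow> real) \<Rightarrow> (real \<Rightarrow> real) \<Rightarrow> bool" where
  "acoe \<beta> \<phi> \<longleftrightarrow> \<phi> \<in> stationary_policies MM \<and>
     optimality_equations X K cbar (enn2real (avg_const MM)) (rel_limit \<beta>)
       (inventory_H P dem cbar h (rel_limit \<beta>)) \<phi>"

lemma inventory_H_eq: "inventory_H P dem cbar h f = Gf 1 f"
  by (rule ext) (simp add: inventory_H_def Gf_def e_def Ef_def)

lemma enn2real_avg_const: "enn2real (avg_const MM) = wbar"
  using avg_const_eq wbar(1) by simp

lemma bellman_eq_min: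
  assumes f: "regular f" and x: "x \<in> X" and b: "b \<in> X" "x \<le> b"
    and min: "\<And>y. y \<in> X \<Longrightarrow> x \<le> y \<Longrightarrow> Gf 1 f b \<le> Gf 1 f y"
  shows "bellman 1 f x = min (K + Gf 1 f b) (Gf 1 f x) - cbar * x"
proof (rule antisym)
  have a1: "a0 \<le> 1" using a0 by simp
  show "bellman 1 f x \<le> min (K + Gf 1 f b) (Gf 1 f x) - cbar * x"
    using bellman_le(1)[OF f a1 order_refl x] bellman_le(2)[OF f a1 order_refl x b] by simp
  show "min (K + Gf 1 f b) (Gf 1 f x) - cbar * x \<le> bellman 1 f x"
    using f a1 order_refl x
  proof (cases rule: bellman_attained)
    case 1
    then show ?thesis by simp
  next
    case (2 y)
    then show ?thesis using min[OF 2(1)] by simp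
  qed
qed

text \<open>
  Equicontinuity makes the lower limit over neighbouring states agree with the pointwise limit.
\<close>

lemma avg_rel_value_eq:
  assumes \<beta>: "\<And>n. a0 \<le> \<beta> n" "\<And>n. \<beta> n < 1"
    and lim: "\<And>x. x \<in> X \<Longrightarrow> (\<lambda>n. u (\<beta> n) x) \<longlonglongrightarrow> ut x" and x: "x \<in> X"
  shows "avg_rel_value MM \<beta> x = ennreal (ut x)"
proof -
  have "liminf (\<lambda>n. rel_disc_value MM (\<beta> n) (y n)) = ennreal (ut x)"
    if y: "\<And>n. y n \<in> X" "y \<longlonglongrightarrow> x" for y
  proof (rule lim_imp_Liminf)
    have "(\<lambda>n. u (\<beta> n) (y n)) \<longlonglongrightarrow> ut x"
      by (rule locally_Lipschitz_tendsto[of x "\<lambda>n. u (\<beta> n)", OF u_Lipschitz[OF \<beta> x] lim[OF x] y])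
    then show "(\<lambda>n. rel_disc_value MM (\<beta> n) (y n)) \<longlonglongrightarrow> ennreal (ut x)"
      using rel_disc_value_eq[OF \<beta> y(1)] by (simp add: tendsto_ennrealI)
  qed simp
  then have "{liminf (\<lambda>n. rel_disc_value MM (\<beta> n) (y n)) | y. (\<forall>n. y n \<in> states MM) \<and> y \<longlonglongrightarrow> x} = {ennreal (ut x)}"
    using x by (auto intro!: exI[of _ "\<lambda>_. x"])
  then show ?thesis by (simp add: avg_rel_value_def)
qed

text \<open>
  What is claimed of one sequence of discount factors: convergence of its relative values, and the
  properties of the resulting optimality equation and of its \<open>(s, S)\<close> solutions.
\<close>

definition average_solution :: "(nat \<Rightarrow> real) \<Rightarrow> bool" where
  "average_solution \<beta> \<longleftrightarrow>
    (\<forall>x\<in>X. avg_rel_value MM \<beta> x < \<infinity> \<and> (\<lambda>k. rel_disc_value MM (\<beta> k) x) \<longlonglongrightarrow> avg_rel_value MM \<beta> x) \<and>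
    (\<forall>x\<in>X. integrable P (\<lambda>\<omega>. rel_limit \<beta> (x - dem \<omega>))) \<and>
    continuous_on X (rel_limit \<beta>) \<and>
    (\<exists>\<phi>. acoe \<beta> \<phi>) \<and>
    (\<forall>\<phi>. acoe \<beta> \<phi> \<longrightarrow> avg_optimal MM (stationary MM \<phi>)) \<and>
    K_convex_on X K (rel_limit \<beta>) \<and> inf_compact_on X (rel_limit \<beta>) \<and>
    K_convex_on X K (inventory_H P dem cbar h (rel_limit \<beta>)) \<and>
    continuous_on X (inventory_H P dem cbar h (rel_limit \<beta>)) \<and>
    inf_compact_on X (inventory_H P dem cbar h (rel_limit \<beta>)) \<and>
    argmin_on X (inventory_H P dem cbar h (rel_limit \<beta>)) \<noteq> {} \<and>
    (\<forall>S \<in> argmin_on X (inventory_H P dem cbar h (rel_limit \<beta>)).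
      \<forall>s. s = Inf {x \<in> X. x \<le> S \<and> inventory_H P dem cbar h (rel_limit \<beta>) x
                \<le> K + inventory_H P dem cbar h (rel_limit \<beta>) S} \<longrightarrow>
        s \<in> X \<and> s \<le> S \<and> acoe \<beta> (sS_policy s S) \<and> avg_optimal MM (stationary MM (sS_policy s S)))"

context
  fixes \<beta> :: "nat \<Rightarrow> real"
  assumes \<beta>: "\<And>n. a0 \<le> \<beta> n" "\<And>n. \<beta> n < 1" "\<beta> \<longlonglongrightarrow> 1"
    and conv: "\<And>x. x \<in> X \<Longrightarrow> convergent (\<lambda>n. u (\<beta> n) x)"
begin

lemma rel_limit_tendsto: "x \<in> X \<Longrightarrow> (\<lambda>n. u (\<beta> n) x) \<longlonglongrightarrow> rel_limit \<beta> x"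
  and avg_rel_value_rel_limit: "x \<in> X \<Longrightarrow> avg_rel_value MM \<beta> x = ennreal (rel_limit \<beta> x)"
proof -
  have lim: "(\<lambda>n. u (\<beta> n) x) \<longlonglongrightarrow> lim (\<lambda>n. u (\<beta> n) x)" if "x \<in> X" for x
    using conv[OF that] by (simp add: convergent_LIMSEQ_iff)
  assume x: "x \<in> X"
  have "0 \<le> lim (\<lambda>n. u (\<beta> n) x)"
    by (rule LIMSEQ_le_const[OF lim[OF x]]) (use regular_nonneg[OF regular_u[OF \<beta>(1,2)] x] in blast)
  moreover have eq: "avg_rel_value MM \<beta> x = ennreal (lim (\<lambda>n. u (\<beta> n) x))"
    by (rule avg_rel_value_eq[OF \<beta>(1,2) lim x])
  ultimately have rl: "rel_limit \<beta> x = lim (\<lambda>n. u (\<beta> n) x)" by (simp add: rel_limit_def)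
  show "(\<lambda>n. u (\<beta> n) x) \<longlonglongrightarrow> rel_limit \<beta> x" unfolding rl by (rule lim[OF x])
  show "avg_rel_value MM \<beta> x = ennreal (rel_limit \<beta> x)" unfolding rl by (rule eq)
qed

lemma regular_rel_limit: "regular (rel_limit \<beta>)"
  by (rule regular_limit[of "\<lambda>n. u (\<beta> n)", OF regular_u[OF \<beta>(1,2)] rel_limit_tendsto])

lemma rel_limit_acoe: "x \<in> X \<Longrightarrow> wbar + rel_limit \<beta> x = bellman 1 (rel_limit \<beta>) x"
  by (rule acoe_limit[OF \<beta> rel_limit_tendsto wbar_sequence[OF \<beta>(2,3)]])

lemma rel_limit_problem: "setup_cost_problem X K z0 B0 \<eta> (Gf 1 (rel_limit \<beta>))"
  using Gf_problem[OF regular_rel_limit] a0 by simp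

lemma acoe_avg_opt: "acoe \<beta> \<phi> \<Longrightarrow> avg_optimal MM (stationary MM \<phi>)"
  unfolding acoe_def optimality_equations_def inventory_H_eq enn2real_avg_const
  by (rule acoe_avg_optimal(1)[OF regular_rel_limit]) auto

lemma sS_optimal_acoe:
  assumes o: "sS_optimal X K (Gf 1 (rel_limit \<beta>)) s S"
  shows "acoe \<beta> (sS_policy s S)"
  unfolding acoe_def optimality_equations_def inventory_H_eq enn2real_avg_const
proof (intro conjI ballI)
  interpret G: setup_cost_problem X K z0 B0 \<eta> "Gf 1 (rel_limit \<beta>)" by (rule rel_limit_problem)
  show "sS_policy s S \<in> stationary_policies MM"
    using o by (intro sS_policy_stationary) (auto simp: sS_optimal_def argmin_on_def)
  fix x assume x: "x \<in> X"
  show "wbar + rel_limit \<beta> x = (if 0 < sS_policy s S x then K else 0)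
      + Gf 1 (rel_limit \<beta>) (x + sS_policy s S x) - cbar * x"
    by (rule acoe_policy[OF regular_rel_limit rel_limit_acoe o x])
  obtain b where b: "b \<in> X" "x \<le> b" "\<And>y. y \<in> X \<Longrightarrow> x \<le> y \<Longrightarrow> Gf 1 (rel_limit \<beta>) b \<le> Gf 1 (rel_limit \<beta>) y"
    using G.minimizer_above[OF x] by blast
  show "\<exists>b\<in>X \<inter> {0..}. (\<forall>a\<in>X \<inter> {0..}. K + Gf 1 (rel_limit \<beta>) (x + b) \<le> K + Gf 1 (rel_limit \<beta>) (x + a)) \<and>
      wbar + rel_limit \<beta> x = min (K + Gf 1 (rel_limit \<beta>) (x + b)) (Gf 1 (rel_limit \<beta>) x) - cbar * x"
  proof (rule bexI[of _ "b - x"], intro conjI ballI)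
    fix a assume a: "a \<in> X \<inter> {0..}"
    then show "K + Gf 1 (rel_limit \<beta>) (x + (b - x)) \<le> K + Gf 1 (rel_limit \<beta>) (x + a)"
      using b(3)[of "x + a"] X_add[OF x, of a] by simp
  next
    show "wbar + rel_limit \<beta> x = min (K + Gf 1 (rel_limit \<beta>) (x + (b - x))) (Gf 1 (rel_limit \<beta>) x) - cbar * x"
      using rel_limit_acoe[OF x] bellman_eq_min[OF regular_rel_limit x b] by simp
    show "b - x \<in> X \<inter> {0..}" using b X_diff[OF b(1) x] by simp
  qed
qed

text \<open>
  On the left \<open>rel_limit\<close> grows with slope at least \<open>cbar\<close>; on the right, where no order is
  placed, the optimality equation bounds it below by \<open>e - wbar\<close>.
\<close>

lemma inf_compact_rel_limit: "inf_compact_on X (rel_limit \<beta>)"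
  unfolding inf_compact_on_def
proof
  fix l
  note f = regular_rel_limit
  obtain s S where o: "sS_optimal X K (Gf 1 (rel_limit \<beta>)) s S" using sS_optimal_1_exists[OF f] by blast
  obtain b where b: "\<forall>y\<in>X. b \<le> y \<longrightarrow> l + wbar < e y" using e_coercive by blast
  have low: "z0 - \<bar>l\<bar> / cbar \<le> x" if x: "x \<in> X" "rel_limit \<beta> x \<le> l" for x
  proof (cases "x \<le> z0")
    case True
    have "cbar * (z0 - x) \<le> \<bar>l\<bar>"
      using regular_low[OF f x(1) z0 True] regular_nonneg[OF f z0] x by simp
    then show ?thesis using cbar_pos by (simp add: field_simps)
  next
    case False
    moreover have "0 \<le> \<bar>l\<bar> / cbar" using cbar_pos by simp
    ultimately show ?thesis by linarith
  qed
  have high: "x \<le> max b s" if x: "x \<in> X" "rel_limit \<beta> x \<le> l" for x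
  proof (rule ccontr)
    assume c: "\<not> x \<le> max b s"
    then have "\<not> x < s" by simp
    then have "wbar + rel_limit \<beta> x = e x + Ef (rel_limit \<beta>) x"
      using rel_limit_acoe[OF x(1)] bellman_eq[OF o x(1)] by (simp add: Gf_def)
    moreover have "l + wbar < e x" using b x(1) c by simp
    ultimately show False using Ef_nonneg[OF f x(1)] x(2) by simp
  qed
  have sub: "{x \<in> X. rel_limit \<beta> x \<le> l} \<subseteq> {z0 - \<bar>l\<bar> / cbar..max b s}"
    using low high by auto
  have "closed {x \<in> X. rel_limit \<beta> x \<le> l}"
    using regular_continuous[OF f] closed_X by (intro continuous_on_closed_Collect_le continuous_on_const)
  moreover have "bounded {x \<in> X. rel_limit \<beta> x \<le> l}"
    using sub by (rule bounded_subset[rotated]) simp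
  ultimately show "compact {x \<in> X. rel_limit \<beta> x \<le> l}" by (simp add: compact_eq_bounded_closed)
qed

lemma average_solution_sequence: "average_solution \<beta>"
proof -
  interpret G: setup_cost_problem X K z0 B0 \<eta> "Gf 1 (rel_limit \<beta>)" by (rule rel_limit_problem)
  have conv': "avg_rel_value MM \<beta> x < \<infinity> \<and> (\<lambda>k. rel_disc_value MM (\<beta> k) x) \<longlonglongrightarrow> avg_rel_value MM \<beta> x"
    if x: "x \<in> X" for x
    unfolding avg_rel_value_rel_limit[OF x] rel_disc_value_eq[OF \<beta>(1,2) x]
    using tendsto_ennrealI[OF rel_limit_tendsto[OF x]] by simp
  have ex: "\<exists>\<phi>. acoe \<beta> \<phi>" using G.sS_optimal_exists sS_optimal_acoe by blast
  have sS: "s \<in> X \<and> s \<le> S \<and> acoe \<beta> (sS_policy s S) \<and> avg_optimal MM (stationary MM (sS_policy s S))"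
    if S: "S \<in> argmin_on X (Gf 1 (rel_limit \<beta>))"
      and s: "s = Inf {x \<in> X. x \<le> S \<and> Gf 1 (rel_limit \<beta>) x \<le> K + Gf 1 (rel_limit \<beta>) S}" for s S
  proof -
    have o: "sS_optimal X K (Gf 1 (rel_limit \<beta>)) s S" by (rule G.sS_optimal_Inf[OF S s])
    then have "s \<in> X" "s \<le> S" by (auto simp: sS_optimal_def)
    then show ?thesis using sS_optimal_acoe[OF o] acoe_avg_opt by blast
  qed
  show ?thesis
    unfolding average_solution_def inventory_H_eq
    using conv' ex sS regular_integrable[OF regular_rel_limit] regular_continuous[OF regular_rel_limit]
      acoe_avg_opt regular_convex[OF regular_rel_limit] inf_compact_rel_limit
      G.G_convex G.G_cont G.inf_compact_G G.argmin_nonempty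
    by (intro conjI ballI allI impI; (elim conjE)?) (assumption | blast | metis)+
qed

end

lemma convergent_subsequence:
  assumes "\<And>n. a0 \<le> \<beta> n" "\<And>n. \<beta> n < 1"
  shows "\<exists>r. strict_mono (r :: nat \<Rightarrow> nat) \<and> (\<forall>x\<in>X. convergent (\<lambda>n. u (\<beta> (r n)) x))"
proof -
  obtain r ut w where "strict_mono (r :: nat \<Rightarrow> nat)" and lim: "\<And>x. x \<in> X \<Longrightarrow> (\<lambda>n. u (\<beta> (r n)) x) \<longlonglongrightarrow> ut x"
    and "(\<lambda>n. (1 - \<beta> (r n)) * m (\<beta> (r n))) \<longlonglongrightarrow> w"
    by (rule vanishing_discount[of \<beta>, OF assms]) (rule that)
  moreover have "convergent (\<lambda>n. u (\<beta> (r n)) x)" if "x \<in> X" for x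
    using lim[OF that] by (rule convergentI)
  ultimately show ?thesis by blast
qed

lemma avg_value_eq: "x \<in> X \<Longrightarrow> avg_value MM x = ennreal wbar"
proof -
  assume x: "x \<in> X"
  obtain \<beta> :: "nat \<Rightarrow> real" where \<beta>: "\<And>n. a0 \<le> \<beta> n" "\<And>n. \<beta> n < 1" and \<beta>1: "\<beta> \<longlonglongrightarrow> 1"
    using discounts_to_1 by blast
  obtain r :: "nat \<Rightarrow> nat" where r: "strict_mono r" and conv: "\<forall>x\<in>X. convergent (\<lambda>n. u (\<beta> (r n)) x)"
    using convergent_subsequence[of \<beta>, OF \<beta>] by blast
  have \<beta>r: "(\<lambda>n. \<beta> (r n)) \<longlonglongrightarrow> 1" using LIMSEQ_subseq_LIMSEQ[OF \<beta>1 r] unfolding comp_def .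
  let ?\<gamma> = "\<lambda>n. \<beta> (r n)"
  have f: "regular (rel_limit ?\<gamma>)" by (rule regular_rel_limit[of ?\<gamma>]) (use \<beta> \<beta>r conv in auto)
  have acoe: "wbar + rel_limit ?\<gamma> y = bellman 1 (rel_limit ?\<gamma>) y" if "y \<in> X" for y
    by (rule rel_limit_acoe[of ?\<gamma>]) (use \<beta> \<beta>r conv that in auto)
  obtain s S where o: "sS_optimal X K (Gf 1 (rel_limit ?\<gamma>)) s S" using sS_optimal_1_exists[OF f] by blast
  have st: "sS_policy s S \<in> stationary_policies MM"
    using o by (intro sS_policy_stationary) (auto simp: sS_optimal_def argmin_on_def)
  show ?thesis by (rule acoe_avg_optimal(2)[OF f st acoe_policy[OF f acoe o] x])
qed

lemma assumption_B_MM: "assumption_B MM"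
  unfolding assumption_B_def
proof (intro conjI ballI)
  have "(INF x\<in>states MM. avg_value MM x) \<le> avg_value MM 0" using X_0 by (intro INF_lower) simp
  also have "\<dots> < \<infinity>" by (simp add: avg_value_eq[OF X_0])
  finally show "(INF x\<in>states MM. avg_value MM x) < \<infinity>" .
next
  fix x assume "x \<in> states MM"
  then have x: "x \<in> X" by simp
  obtain U where U: "\<And>\<alpha> x. a0 \<le> \<alpha> \<Longrightarrow> \<alpha> < 1 \<Longrightarrow> x \<in> X \<Longrightarrow> u \<alpha> x \<le> U x" using u_bounded by blast
  let ?C = "K + (K + cbar * mean + e x) / (1 - a0)"
  have "rel_disc_value MM \<alpha> x \<le> ennreal (max (U x) ?C)" if \<alpha>: "0 \<le> \<alpha>" "\<alpha> < 1" for \<alpha>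
  proof (cases "a0 \<le> \<alpha>")
    case True
    then show ?thesis
      using rel_disc_value_eq[OF True \<alpha>(2) x] U[OF True \<alpha>(2) x] by (simp add: ennreal_leI le_max_iff_disj)
  next
    case False
    have "rel_disc_value MM \<alpha> x \<le> disc_value MM \<alpha> x" unfolding rel_disc_value_def by (rule diff_le_self_ennreal)
    also have "\<dots> \<le> ennreal (K + (K + cbar * mean + e x) / (1 - \<alpha>))" by (rule disc_value_le[OF \<alpha> x])
    also have "\<dots> \<le> ennreal (max (U x) ?C)"
    proof (rule ennreal_leI)
      have "(K + cbar * mean + e x) / (1 - \<alpha>) \<le> (K + cbar * mean + e x) / (1 - a0)"
        using False a0 K_nonneg cbar_pos mean_nonneg e_nonneg[OF x] by (intro divide_left_mono) auto
      then show "K + (K + cbar * mean + e x) / (1 - \<alpha>) \<le> max (U x) ?C" by simp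
    qed
    finally show ?thesis .
  qed
  then have "(SUP \<alpha>\<in>{0..<1}. rel_disc_value MM \<alpha> x) \<le> ennreal (max (U x) ?C)"
    by (intro SUP_least) auto
  also have "\<dots> < \<infinity>" by simp
  finally show "(SUP \<alpha>\<in>{0..<1}. rel_disc_value MM \<alpha> x) < \<infinity>" .
qed

lemma equicontinuous_rel_values:
  fixes \<beta> :: "nat \<Rightarrow> real"
  assumes \<beta>: "\<And>n. a0 \<le> \<beta> n" "\<And>n. \<beta> n < 1"
  shows "equicontinuous_on X (range (\<lambda>n x. enn2real (rel_disc_value MM (\<beta> n) x)))"
  unfolding equicontinuous_on_def
proof (intro ballI allI impI)
  fix x \<epsilon> :: real assume x: "x \<in> X" and \<epsilon>: "0 < \<epsilon>"
  have l: "0 \<le> lip (x + 1)" by (rule lip_nonneg[OF X_add[OF x X_1]])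
  define \<delta> where "\<delta> = min 1 (\<epsilon> / (lip (x + 1) + 1))"
  have \<delta>: "0 < \<delta>" using \<epsilon> l by (simp add: \<delta>_def)
  have eq: "enn2real (rel_disc_value MM (\<beta> n) y) = u (\<beta> n) y" if "y \<in> X" for n y
    using rel_disc_value_eq[OF \<beta> that] regular_nonneg[OF regular_u[OF \<beta>] that] by simp
  have close: "\<bar>u (\<beta> n) y - u (\<beta> n) x\<bar> < \<epsilon>" if y: "y \<in> ball x \<delta> \<inter> X" for y n
  proof -
    have yx: "\<bar>y - x\<bar> < \<delta>" using y by (simp add: dist_real_def abs_minus_commute)
    have "\<bar>u (\<beta> n) y - u (\<beta> n) x\<bar> \<le> lip (x + 1) * \<bar>y - x\<bar>"
      using u_Lipschitz[OF \<beta> x] y yx by (simp add: \<delta>_def)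
    also have "\<dots> \<le> (lip (x + 1) + 1) * \<bar>y - x\<bar>" by (intro mult_right_mono) auto
    also have "\<dots> < (lip (x + 1) + 1) * (\<epsilon> / (lip (x + 1) + 1))"
      using yx l by (intro mult_strict_left_mono) (auto simp: \<delta>_def)
    also have "\<dots> = \<epsilon>" using l by simp
    finally show ?thesis .
  qed
  show "\<exists>G. open G \<and> x \<in> G \<and> (\<forall>y\<in>G \<inter> X. \<forall>g\<in>range (\<lambda>n x. enn2real (rel_disc_value MM (\<beta> n) x)). \<bar>g y - g x\<bar> < \<epsilon>)"
  proof (intro exI[of _ "ball x \<delta>"] conjI ballI)
    fix y g assume y: "y \<in> ball x \<delta> \<inter> X" and "g \<in> range (\<lambda>n x. enn2real (rel_disc_value MM (\<beta> n) x))"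
    then obtain n where "g = (\<lambda>x. enn2real (rel_disc_value MM (\<beta> n) x))" by blast
    then show "\<bar>g y - g x\<bar> < \<epsilon>" using close[OF y] eq x y by simp
  qed (use \<delta> in auto)
qed

text \<open>
  The supremum of the relative values is an integrable majorant: it inherits the bound for moving
  to a higher state, which is affine in the demand.
\<close>

lemma majorant:
  fixes \<beta> :: "nat \<Rightarrow> real"
  assumes \<beta>: "\<And>n. a0 \<le> \<beta> n" "\<And>n. \<beta> n < 1"
  shows "\<exists>U. U \<in> borel_measurable (state_space MM) \<and> (\<forall>x\<in>X. 0 \<le> U x) \<and>
    (\<forall>x\<in>X. \<forall>n. rel_disc_value MM (\<beta> n) x \<le> ennreal (U x)) \<and>
    (\<forall>x\<in>X. \<forall>a\<in>actions MM. (\<integral>\<^sup>+y. ennreal (U y) \<partial>kern MM x a) < \<infinity>)"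
proof -
  obtain U0 where U0: "\<And>\<alpha> x. a0 \<le> \<alpha> \<Longrightarrow> \<alpha> < 1 \<Longrightarrow> x \<in> X \<Longrightarrow> u \<alpha> x \<le> U0 x" using u_bounded by blast
  define U where "U x = (SUP n. u (\<beta> n) x)" for x
  have bdd: "bdd_above (range (\<lambda>n. u (\<beta> n) x))" if "x \<in> X" for x
    using U0[OF \<beta> that] by (rule bdd_aboveI2)
  have le: "u (\<beta> n) x \<le> U x" if "x \<in> X" for n x
    unfolding U_def using bdd[OF that] by (intro cSUP_upper) auto
  have nn: "0 \<le> U x" if "x \<in> X" for x
    using regular_nonneg[OF regular_u[of "\<beta> 0", OF \<beta>] that] le[OF that, of 0] by simp
  have sp: "space (state_space MM) = X" by (simp add: state_space_MM space_restrict_space)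
  have meas: "U \<in> borel_measurable (state_space MM)"
    unfolding U_def
  proof (rule borel_measurable_cSUP)
    show "u (\<beta> n) \<in> borel_measurable (state_space MM)" for n
      by (rule measurable_continuous_on_X[OF regular_continuous[OF regular_u[OF \<beta>]]])
    show "bdd_above ((\<lambda>n. u (\<beta> n) x) ` UNIV)" if "x \<in> space (state_space MM)" for x
      using bdd that unfolding sp .
  qed simp
  have shift: "U (x - dem \<omega>) \<le> U x + K + cbar * dem \<omega>" if x: "x \<in> X" and \<omega>: "\<omega> \<in> space P" for x \<omega>
    unfolding U_def[of "x - dem \<omega>"]
  proof (rule cSUP_least)
    fix n
    show "u (\<beta> n) (x - dem \<omega>) \<le> U x + K + cbar * dem \<omega>"
      using regular_shift_le[OF regular_u[OF \<beta>] x \<omega>] le[OF x] by (smt (verit))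
  qed simp
  have int: "(\<integral>\<^sup>+y. ennreal (U y) \<partial>kern MM x a) < \<infinity>" if x: "x \<in> X" and a: "a \<in> actions MM" for x a
  proof -
    have aX: "a \<in> X" "x + a \<in> X" using a x X_add[OF x, of a] by auto
    have m: "(\<lambda>y. ennreal (U y)) \<in> borel_measurable (state_space MM)"
      using measurable_compose[OF meas measurable_ennreal] .
    have "(\<integral>\<^sup>+y. ennreal (U y) \<partial>kern MM x a) = (\<integral>\<^sup>+\<omega>. ennreal (U (x + a - dem \<omega>)) \<partial>P)"
      by (rule nn_integral_kern[OF x aX(1) m])
    also have "\<dots> \<le> (\<integral>\<^sup>+\<omega>. ennreal (U (x + a) + K + cbar * dem \<omega>) \<partial>P)"
      by (intro nn_integral_mono ennreal_leI shift aX)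
    also have "\<dots> = ennreal (\<integral>\<omega>. U (x + a) + K + cbar * dem \<omega> \<partial>P)"
      using integrable_dem nn[OF aX(2)] K_nonneg cbar_pos dem_nonneg
      by (intro nn_integral_eq_integral AE_I2) auto
    also have "\<dots> < \<infinity>" by simp
    finally show ?thesis .
  qed
  show ?thesis
  proof (intro exI[of _ U] conjI ballI allI)
    show "rel_disc_value MM (\<beta> n) x \<le> ennreal (U x)" if "x \<in> X" for x n
      unfolding rel_disc_value_eq[OF \<beta> that] by (rule ennreal_leI[OF le[OF that]])
  qed (use meas nn int in blast)+
qed

end

text \<open>
  As \<open>h 0 = 0\<close>, convexity makes \<open>h x / x\<close> monotone on the negative states, so its limit at
  \<open>- \<infinity>\<close> is its infimum. The condition on the discount factor therefore says that already some
  secant of \<open>h\<close> through the origin is steep enough.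
\<close>

lemma (in inventory_demand) steep_state:
  assumes "alpha_star X cbar h < ereal a"
  obtains x0 where "x0 \<in> X" "x0 < 0" "(1 - a) * cbar * (- x0) < h x0"
proof -
  define q where "q x = ereal (h x / (cbar * x))" for x
  define I where "I = (INF x\<in>X \<inter> {..<0}. q x)"
  let ?F = "inf at_bot (principal X)"
  have mono: "q x \<le> q y" if xy: "x \<in> X" "y \<in> X" "x \<le> y" "y < 0" for x y
  proof -
    have "(0 - x) * h y \<le> (0 - y) * h x + (y - x) * (h 0 + 0)"
      using K_convex_onD[OF order_refl h_convex xy(1,2) X_0 xy(3)] xy(4) by simp
    then have "h x / x \<le> h y / y" using xy by (simp add: h_zero field_simps)
    then have "h x / x / cbar \<le> h y / y / cbar" using cbar_pos by (intro divide_right_mono) auto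
    then show ?thesis by (simp add: q_def mult.commute)
  qed
  have "(q \<longlongrightarrow> I) ?F"
  proof (rule order_tendstoI)
    fix l assume l: "l < I"
    have "eventually (\<lambda>x::real. x < 0) at_bot" by (rule eventually_gt_at_bot)
    then have "eventually (\<lambda>x. x \<in> X \<longrightarrow> l < q x) at_bot"
    proof eventually_elim
      case (elim x)
      then show ?case using l INF_lower[of x "X \<inter> {..<0}" q] unfolding I_def by (auto intro: less_le_trans)
    qed
    then show "eventually (\<lambda>x. l < q x) ?F" by (simp add: eventually_inf_principal)
  next
    fix r assume "I < r"
    then obtain x0 where x0: "x0 \<in> X" "x0 < 0" "q x0 < r" unfolding I_def INF_less_iff by auto
    have "eventually (\<lambda>x. x \<le> x0) at_bot" by (rule eventually_le_at_bot)
    then have "eventually (\<lambda>x. x \<in> X \<longrightarrow> q x < r) at_bot"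
    proof eventually_elim
      case (elim x)
      then show ?case using mono[of x x0] x0 by (auto intro: le_less_trans)
    qed
    then show "eventually (\<lambda>x. q x < r) ?F" by (simp add: eventually_inf_principal)
  qed
  moreover have "?F \<noteq> bot"
  proof
    assume "?F = bot"
    then have "eventually (\<lambda>x. False) ?F" by simp
    then have "eventually (\<lambda>x. x \<notin> X) at_bot" by (simp add: eventually_inf_principal)
    then obtain N where "\<And>x. x \<le> N \<Longrightarrow> x \<notin> X" by (auto simp: eventually_at_bot_linorder)
    then show False using X_int[of "\<lfloor>N\<rfloor>"] by force
  qed
  ultimately have "Lim ?F q = I" by (intro tendsto_Lim)
  then have "1 + I < ereal a" using assms unfolding alpha_star_def q_def by simp
  then have "I < ereal (a - 1)" by (cases I) (auto simp: one_ereal_def)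
  then obtain x0 where x0: "x0 \<in> X" "x0 < 0" "q x0 < ereal (a - 1)" unfolding I_def INF_less_iff by auto
  then have "h x0 / (cbar * x0) < a - 1" by (simp add: q_def)
  moreover have "cbar * x0 < 0" using cbar_pos x0 by (simp add: mult_pos_neg)
  ultimately have "(a - 1) * (cbar * x0) < h x0" by (simp add: neg_divide_less_eq)
  then show ?thesis using x0 by (intro that[of x0]) (auto simp: algebra_simps)
qed

lemma (in inventory_demand) inventory_low_exists:
  assumes a: "0 \<le> a" "a < 1" "alpha_star X cbar h < ereal a"
  shows "\<exists>z0 \<kappa>. inventory_low P D X K cbar h dem a z0 \<kappa>"
proof -
  obtain x0 where x0: "x0 \<in> X" "x0 < 0" and steep: "(1 - a) * cbar * (- x0) < h x0"
    using steep_state[OF a(3)] by blast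
  have "inventory_low P D X K cbar h dem a x0 (h x0 / (- x0))"
  proof unfold_locales
    show "(1 - a) * cbar < h x0 / (- x0)"
      using steep x0(2) by (subst pos_less_divide_eq) auto
    fix x y assume X: "x \<in> X" "y \<in> X" and o: "x \<le> y" "y \<le> x0"
    \<comment> \<open>both inequalities compare with the secant to the origin, where \<open>h\<close> vanishes\<close>
    have "(0 - x) * h y \<le> (0 - y) * h x + (y - x) * (h 0 + 0)"
      using K_convex_onD[OF order_refl h_convex X X_0 o(1)] o x0 by simp
    then have 1: "(- x) * h y \<le> (- y) * h x" by (simp add: h_zero)
    have "(0 - y) * h x0 \<le> (0 - x0) * h y + (x0 - y) * (h 0 + 0)"
      using K_convex_onD[OF order_refl h_convex X(2) x0(1) X_0 o(2)] x0 by simp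
    then have 2: "(- y) * h x0 \<le> (- x0) * h y" by (simp add: h_zero)
    have "(y - x) * ((- y) * h x0) \<le> (y - x) * ((- x0) * h y)" using 2 o by (intro mult_left_mono) auto
    also have "\<dots> = (- x0) * ((- x) * h y - (- y) * h y)" by (simp add: algebra_simps)
    also have "\<dots> \<le> (- x0) * ((- y) * h x - (- y) * h y)" using 1 x0 by (intro mult_left_mono diff_right_mono) auto
    finally have "(- y) * ((y - x) * h x0) \<le> (- y) * ((- x0) * (h x - h y))" by (simp add: algebra_simps)
    then have "(y - x) * h x0 \<le> (- x0) * (h x - h y)" using o x0 by (subst (asm) mult_le_cancel_left_pos) auto
    then show "h x0 / (- x0) * (y - x) \<le> h x - h y" using x0 by (simp add: field_simps)
  qed (use a x0 in auto)
  then show ?thesis by blast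
qed

text \<open>
  The vanishing discount limit along optimal \<open>(s, S)\<close> levels: the limit levels solve the limit
  problem, because optimality of levels is stable under continuous convergence.
\<close>

lemma (in inventory_low) limit_levels:
  assumes \<beta>: "\<And>n. a0 \<le> \<beta> n" "\<And>n. \<beta> n < 1" "\<beta> \<longlonglongrightarrow> 1"
    and conv: "\<And>x. x \<in> X \<Longrightarrow> convergent (\<lambda>n. u (\<beta> n) x)"
    and o: "\<And>n. sS_optimal X K (Gf (\<beta> n) (v (\<beta> n))) (s n) (S n)"
    and lim: "s \<longlonglongrightarrow> s'" "S \<longlonglongrightarrow> S'"
  shows "s' \<in> X" "S' \<in> X" "s' \<le> S'" "acoe \<beta> (sS_policy s' S')" "avg_optimal MM (stationary MM (sS_policy s' S'))"
proof -
  have \<beta>': "0 \<le> \<beta> n" "\<beta> n \<le> 1" for n using \<beta>(1,2)[of n] a0 by auto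
  have "sS_optimal X K (Gf 1 (rel_limit \<beta>)) s' S'"
  proof (rule sS_optimal_limit[of K "\<lambda>n. Gf (\<beta> n) (u (\<beta> n))"])
    show "sS_optimal X K (Gf (\<beta> n) (u (\<beta> n))) (s n) (S n)" for n
      using sS_optimal_u[OF \<beta>(1,2)] o by blast
    show "(\<lambda>k. Gf (\<beta> k) (u (\<beta> k)) (y k)) \<longlonglongrightarrow> Gf 1 (rel_limit \<beta>) z"
      if "\<And>k. y k \<in> X" "z \<in> X" "y \<longlonglongrightarrow> z" for y z
      by (rule Gf_limit[of "\<lambda>n. u (\<beta> n)" "rel_limit \<beta>" \<beta>, OF regular_u[OF \<beta>(1,2)]
            rel_limit_tendsto[OF \<beta> conv] \<beta>' \<beta>(3) that])
  qed (rule lim)+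
  then show "s' \<in> X" "S' \<in> X" "s' \<le> S'" "acoe \<beta> (sS_policy s' S')"
    "avg_optimal MM (stationary MM (sS_policy s' S'))"
    using sS_optimal_acoe[OF \<beta> conv] acoe_avg_opt[OF \<beta> conv]
    by (auto simp: sS_optimal_def argmin_on_def)
qed

theorem theorem4p5:
  fixes P :: "'w measure" and D :: "nat \<Rightarrow> 'w \<Rightarrow> real" and X :: "real set"
    and K cbar :: real and h :: "real \<Rightarrow> real" and \<alpha> :: "nat \<Rightarrow> real"
  assumes inv: "inventory P D X K cbar h"
    and alpha_range: "\<And>n. 0 \<le> \<alpha> n \<and> \<alpha> n < 1"
    and alpha_mono: "incseq \<alpha>"
    and alpha_lim: "\<alpha> \<longlonglongrightarrow> 1"
    and alpha_first: "alpha_star X cbar h < ereal (\<alpha> 0)"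
  defines "M \<equiv> inventory_mdp P (D 1) X K cbar h"
  defines "u \<equiv> \<lambda>a x. enn2real (rel_disc_value M a x)"
    and "w \<equiv> enn2real (avg_const M)"
    and "ut \<equiv> \<lambda>\<beta> x. enn2real (avg_rel_value M \<beta> x)"
  defines "H \<equiv> \<lambda>\<beta>. inventory_H P (D 1) cbar h (ut \<beta>)"
  defines "ACOE \<equiv> \<lambda>\<beta> \<phi>. \<phi> \<in> stationary_policies M \<and>
      optimality_equations X K cbar w (ut \<beta>) (H \<beta>) \<phi>"
  \<comment> \<open>assertions (b), (c), (e) for a subsequence \<open>\<beta>\<close> of \<open>\<alpha>\<close>\<close>
  defines "Good \<equiv> \<lambda>\<beta>.
      (\<forall>x\<in>X. avg_rel_value M \<beta> x < \<infinity> \<and> (\<lambda>k. rel_disc_value M (\<beta> k) x) \<longlonglongrightarrow> avg_rel_value M \<beta> x) \<and>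
      (\<forall>x\<in>X. integrable P (\<lambda>\<omega>. ut \<beta> (x - D 1 \<omega>))) \<and>
      continuous_on X (ut \<beta>) \<and>
      (\<exists>\<phi>. ACOE \<beta> \<phi>) \<and>
      (\<forall>\<phi>. ACOE \<beta> \<phi> \<longrightarrow> avg_optimal M (stationary M \<phi>)) \<and>
      K_convex_on X K (ut \<beta>) \<and> inf_compact_on X (ut \<beta>) \<and>
      K_convex_on X K (H \<beta>) \<and> continuous_on X (H \<beta>) \<and> inf_compact_on X (H \<beta>) \<and>
      argmin_on X (H \<beta>) \<noteq> {} \<and>
      (\<forall>S \<in> argmin_on X (H \<beta>). \<forall>s. s = Inf {x \<in> X. x \<le> S \<and> H \<beta> x \<le> K + H \<beta> S} \<longrightarrow>
          s \<in> X \<and> s \<le> S \<and> ACOE \<beta> (sS_policy s S) \<and> avg_optimal M (stationary M (sS_policy s S)))"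
  defines "Disc_opt \<equiv> \<lambda>a s S. s \<in> X \<and> S \<in> X \<and> s \<le> S \<and> disc_optimal M a (stationary M (sS_policy s S))"
  \<comment> \<open>(a), finiteness of \<open>w\<close>, (b) with (c) and (e), (d)\<close>
  shows "(assumption_W M \<and>
      assumption_B M \<and>
      equicontinuous_on X (range (\<lambda>n. u (\<alpha> n))) \<and>
      (\<exists>U. U \<in> borel_measurable (state_space M) \<and>
        (\<forall>x\<in>X. 0 \<le> U x) \<and>
        (\<forall>x\<in>X. \<forall>n. rel_disc_value M (\<alpha> n) x \<le> ennreal (U x)) \<and>
        (\<forall>x\<in>X. \<forall>a\<in>actions M. (\<integral>\<^sup>+y. ennreal (U y) \<partial>kern M x a) < \<infinity>))) \<and>
    (avg_const M < \<infinity>) \<and>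
    (\<exists>r. strict_mono r \<and> Good (\<alpha> \<circ> r)) \<and>
    (\<forall>a. 0 \<le> a \<and> alpha_star X cbar h < ereal a \<and> a < 1 \<longrightarrow> (\<exists>s S. Disc_opt a s S)) \<and>
    (\<forall>s' S'. (\<forall>a. 0 \<le> a \<and> alpha_star X cbar h < ereal a \<and> a < 1 \<longrightarrow> Disc_opt a (s' a) (S' a)) \<longrightarrow>
        bounded (range (\<lambda>n. (s' (\<alpha> n), S' (\<alpha> n)))) \<and>
        (\<forall>s S. (\<exists>r. strict_mono r \<and> (\<lambda>k. (s' (\<alpha> (r k)), S' (\<alpha> (r k)))) \<longlonglongrightarrow> (s, S)) \<longrightarrow>
           s \<in> X \<and> S \<in> X \<and> s \<le> S \<and>
           (\<exists>r. strict_mono r \<and> Good (\<alpha> \<circ> r) \<and>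
              (\<lambda>k. (s' (\<alpha> (r k)), S' (\<alpha> (r k)))) \<longlonglongrightarrow> (s, S) \<and>
              ACOE (\<alpha> \<circ> r) (sS_policy s S) \<and> avg_optimal M (stationary M (sS_policy s S)))))"
proof -
  define dem where "dem = D 1"
  interpret inventory_demand P D X K cbar h dem
    by (intro inventory_demand.intro inventory_demand_axioms.intro inv dem_def)
  have M: "M = inventory_mdp P dem X K cbar h" unfolding M_def dem_def ..
  have \<alpha>: "\<alpha> 0 \<le> \<alpha> n" "0 \<le> \<alpha> n" "\<alpha> n < 1" for n
    using alpha_range alpha_mono by (auto simp: incseq_def)
  have \<alpha>_star: "alpha_star X cbar h < ereal (\<alpha> n)" for n
    using alpha_first \<alpha>(1)[of n] by (metis ereal_less_eq(3) less_le_trans)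
  from inventory_low_exists[OF \<alpha>(2,3) alpha_first] obtain z0 \<kappa>
    where "inventory_low P D X K cbar h dem (\<alpha> 0) z0 \<kappa>" by blast
  then interpret I: inventory_low P D X K cbar h dem "\<alpha> 0" z0 \<kappa> .
  have ut_eq: "ut = I.rel_limit"
    by (intro ext) (simp only: ut_def I.rel_limit_def M)
  have H_eq: "H = (\<lambda>\<beta>. inventory_H P dem cbar h (I.rel_limit \<beta>))"
    unfolding H_def ut_eq dem_def ..
  have ACOE_eq: "ACOE = I.acoe"
    by (intro ext) (simp only: ACOE_def I.acoe_def H_eq ut_eq M w_def)
  have Good_eq: "Good = I.average_solution"
    by (intro ext) (simp only: Good_def I.average_solution_def ACOE_eq H_eq ut_eq M dem_def[symmetric])
  have sub: "\<alpha> 0 \<le> \<alpha> (r n)" "\<alpha> (r n) < 1" for r and n :: nat using \<alpha> by auto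
  have lim_sub: "(\<lambda>n. \<alpha> (r n)) \<longlonglongrightarrow> 1" if "strict_mono r" for r :: "nat \<Rightarrow> nat"
    using LIMSEQ_subseq_LIMSEQ[OF alpha_lim that] unfolding comp_def .

  have a: "assumption_W M \<and> assumption_B M \<and> equicontinuous_on X (range (\<lambda>n. u (\<alpha> n))) \<and>
      (\<exists>U. U \<in> borel_measurable (state_space M) \<and> (\<forall>x\<in>X. 0 \<le> U x) \<and>
        (\<forall>x\<in>X. \<forall>n. rel_disc_value M (\<alpha> n) x \<le> ennreal (U x)) \<and>
        (\<forall>x\<in>X. \<forall>a\<in>actions M. (\<integral>\<^sup>+y. ennreal (U y) \<partial>kern M x a) < \<infinity>))"
    unfolding M u_def
    using assumption_W_MM I.assumption_B_MM I.equicontinuous_rel_values[of \<alpha>, OF \<alpha>(1,3)] I.majorant[of \<alpha>, OF \<alpha>(1,3)]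
    by (intro conjI)
  have w: "avg_const M < \<infinity>" unfolding M I.avg_const_eq by simp
  have b: "\<exists>r. strict_mono r \<and> Good (\<alpha> \<circ> r)"
  proof -
    obtain r :: "nat \<Rightarrow> nat" where r: "strict_mono r" and conv: "\<forall>x\<in>X. convergent (\<lambda>n. I.u (\<alpha> (r n)) x)"
      using I.convergent_subsequence[of \<alpha>, OF \<alpha>(1,3)] by blast
    have "I.average_solution (\<lambda>n. \<alpha> (r n))"
      by (rule I.average_solution_sequence[of "\<lambda>n. \<alpha> (r n)", OF sub[of r] lim_sub[OF r]]) (use conv in blast)
    then show ?thesis using r unfolding Good_eq comp_def by blast
  qed
  have d1: "\<exists>s S. Disc_opt a s S" if a: "0 \<le> a" "alpha_star X cbar h < ereal a" "a < 1" for a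
  proof -
    \<comment> \<open>as \<open>a\<close> may be less than \<open>\<alpha> 0\<close>, the slope and the state \<open>z0\<close> are chosen anew\<close>
    from inventory_low_exists[OF a(1,3,2)] obtain z0' \<kappa>'
      where "inventory_low P D X K cbar h dem a z0' \<kappa>'" by blast
    then interpret J: inventory_low P D X K cbar h dem a z0' \<kappa>' .
    obtain s S where o: "sS_optimal X K (J.Gf a (J.v a)) s S"
      using J.bellman_policy[OF J.regular_v[OF order_refl a(3)] order_refl less_imp_le[OF a(3)]] by blast
    have "disc_optimal M a (stationary M (sS_policy s S))"
      unfolding M by (rule J.disc_optimal_sS[OF o order_refl a(3)])
    then show ?thesis
      using o unfolding Disc_opt_def by (auto simp: sS_optimal_def argmin_on_def)
  qed
  have d2: "bounded (range (\<lambda>n. (s' (\<alpha> n), S' (\<alpha> n)))) \<and>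
      (\<forall>s S. (\<exists>r. strict_mono r \<and> (\<lambda>k. (s' (\<alpha> (r k)), S' (\<alpha> (r k)))) \<longlonglongrightarrow> (s, S)) \<longrightarrow>
         s \<in> X \<and> S \<in> X \<and> s \<le> S \<and>
         (\<exists>r. strict_mono r \<and> Good (\<alpha> \<circ> r) \<and>
            (\<lambda>k. (s' (\<alpha> (r k)), S' (\<alpha> (r k)))) \<longlonglongrightarrow> (s, S) \<and>
            ACOE (\<alpha> \<circ> r) (sS_policy s S) \<and> avg_optimal M (stationary M (sS_policy s S))))"
    if opt: "\<forall>a. 0 \<le> a \<and> alpha_star X cbar h < ereal a \<and> a < 1 \<longrightarrow> Disc_opt a (s' a) (S' a)" for s' S'
  proof (intro conjI allI impI)
    have o: "sS_optimal X K (I.Gf (\<alpha> n) (I.v (\<alpha> n))) (s' (\<alpha> n)) (S' (\<alpha> n))" for n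
    proof -
      have "Disc_opt (\<alpha> n) (s' (\<alpha> n)) (S' (\<alpha> n))" using opt \<alpha>(2,3) \<alpha>_star by blast
      then show ?thesis
        unfolding Disc_opt_def M using I.disc_optimal_sS_imp[OF _ _ _ _ \<alpha>(1,3)] by blast
    qed
    define c where "c = z0 - K / I.\<eta>"
    have range: "z0 \<le> S' (\<alpha> n)" "S' (\<alpha> n) \<le> I.B0" "c \<le> s' (\<alpha> n)" "s' (\<alpha> n) \<le> S' (\<alpha> n)" for n
      using setup_cost_problem.sS_optimal_range[OF I.Gf_problem[OF I.regular_v[OF \<alpha>(1,3)] \<alpha>(1) less_imp_le[OF \<alpha>(3)]] o] o[of n]
      unfolding c_def sS_optimal_def by auto
    show "bounded (range (\<lambda>n. (s' (\<alpha> n), S' (\<alpha> n))))"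
    proof (rule bounded_subset)
      show "bounded ({c..I.B0} \<times> {z0..I.B0})" by (intro bounded_Times) auto
      show "range (\<lambda>n. (s' (\<alpha> n), S' (\<alpha> n))) \<subseteq> {c..I.B0} \<times> {z0..I.B0}"
        using range order_trans[OF range(4) range(2)] by auto
    qed
    fix s S assume "\<exists>r. strict_mono r \<and> (\<lambda>k. (s' (\<alpha> (r k)), S' (\<alpha> (r k)))) \<longlonglongrightarrow> (s, S)"
    then obtain r :: "nat \<Rightarrow> nat" where r: "strict_mono r"
      and lim: "(\<lambda>k. (s' (\<alpha> (r k)), S' (\<alpha> (r k)))) \<longlonglongrightarrow> (s, S)" by blast
    obtain q :: "nat \<Rightarrow> nat" where q: "strict_mono q"
      and conv: "\<forall>x\<in>X. convergent (\<lambda>n. I.u (\<alpha> (r (q n))) x)"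
      using I.convergent_subsequence[of "\<lambda>n. \<alpha> (r n)", OF sub[of r]] by blast
    define p where "p n = r (q n)" for n
    have p: "strict_mono p" using r q by (simp add: strict_mono_def p_def)
    have conv': "\<And>x. x \<in> X \<Longrightarrow> convergent (\<lambda>n. I.u (\<alpha> (p n)) x)" using conv by (simp add: p_def)
    have lim': "(\<lambda>k. (s' (\<alpha> (p k)), S' (\<alpha> (p k)))) \<longlonglongrightarrow> (s, S)"
      using LIMSEQ_subseq_LIMSEQ[OF lim q] unfolding comp_def p_def .
    have lims: "(\<lambda>k. s' (\<alpha> (p k))) \<longlonglongrightarrow> s" "(\<lambda>k. S' (\<alpha> (p k))) \<longlonglongrightarrow> S"
      using tendsto_fst[OF lim'] tendsto_snd[OF lim'] by simp_all
    note levels = I.limit_levels[of "\<lambda>n. \<alpha> (p n)", OF sub[of p] lim_sub[OF p] conv' o lims]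
    show "s \<in> X" by (rule levels(1))
    show "S \<in> X" by (rule levels(2))
    show "s \<le> S" by (rule levels(3))
    have "I.average_solution (\<lambda>n. \<alpha> (p n))" by (rule I.average_solution_sequence[of "\<lambda>n. \<alpha> (p n)", OF sub[of p] lim_sub[OF p] conv'])
    then show "\<exists>r. strict_mono r \<and> Good (\<alpha> \<circ> r) \<and>
        (\<lambda>k. (s' (\<alpha> (r k)), S' (\<alpha> (r k)))) \<longlonglongrightarrow> (s, S) \<and>
        ACOE (\<alpha> \<circ> r) (sS_policy s S) \<and> avg_optimal M (stationary M (sS_policy s S))"
      using p lim' levels(4,5) unfolding Good_eq ACOE_eq M comp_def by blast
  qed
  show ?thesis
    using a w b d1 d2 by blast
qed

end
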